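(* Let $\Bbbk$ be an algebraically closed field of characteristic zero, $N > 1$ an odd integer, $q \in \Bbbk$ a primitive $N$-th root of unity, $r$ a positive divisor of $N$, and $\alpha,\beta \in \Bbbk$. Put $\tilde F = (q-q^{-1})KF \in \overline{U}_q(\mathfrak{sl}_2)$. For a right coideal subalgebra $A$ of $\overline{U}_q(\mathfrak{sl}_2)$ let $A^\dagger = \{ f \in \overline{\mathcal{O}}_q(SL_2) \mid f \leftharpoonup u = \varepsilon(u) f \text{ for all } u \in A\}$. Then \begin{align*} \overline{U}_q(\mathfrak{sl}_2)^\dagger &= \langle 1 \rangle, \\ \langle K^r \rangle^\dagger &= \langle a^{N/r}, a^{-1}b, ac \rangle = \langle d^{N/r}, bd, cd^{-1} \rangle, \\ \langle K^r, E \rangle^\dagger &= \langle d^{N/r}, cd^{-1} \rangle, \\ \langle K^r, \tilde F \rangle^\dagger &= \langle a^{N/r}, a^{-1}b \rangle, \\ \langle E + \alpha K \rangle^\dagger &= \langle cd^{-1},\ d^2 + (q - q^{-1})\alpha\, bd \rangle, \\ \langle \tilde F + \beta K \rangle^\dagger &= \langle a^{-1}b,\ a^2 - q^2\beta\, ac \rangle. \end{align*} In particular, $\langle K \rangle^\dagger = \langle a^{-1}b, ac \rangle = \langle bd, cd^{-1} \rangle$, $\langle E \rangle^\dagger = \langle c, d \rangle$, $\langle \tilde F \rangle^\dagger = \langle a, b \rangle$, $\langle K, E \rangle^\dagger = \langle cd^{-1} \rangle$, and $\langle K, \tilde F \rangle^\dagger = \langle K, F \rangle^\dagger = \langle a^{-1}b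 \rangle$.
   Context: $\overline{U}_q(\mathfrak{sl}_2)$ is the algebra generated by $K, E, F$ subject to $K^N = 1$, $KE = q^2 EK$, $KF = q^{-2}FK$, $E^N = F^N = 0$, $EF - FE = (K - K^{-1})/(q - q^{-1})$; it is a Hopf algebra with $\Delta(K) = K \otimes K$, $\Delta(E) = E \otimes K + 1 \otimes E$, $\Delta(F) = F \otimes 1 + K^{-1} \otimes F$, $\varepsilon(K)=1$, $\varepsilon(E)=\varepsilon(F)=0$. $\overline{\mathcal{O}}_q(SL_2)$ is the algebra generated by $a,b,c,d$ subject to $ba = qab$, $ca = qac$, $bc = cb$, $db = qbd$, $dc = qcd$, $ad - q^{-1}bc = da - qbc = a^N = d^N = 1$, $b^N = c^N = 0$; it is a Hopf algebra with $\Delta(a) = a\otimes a + b \otimes c$, $\Delta(b) = a \otimes b + b \otimes d$, $\Delta(c) = c \otimes a + d \otimes c$, $\Delta(d) = c \otimes b + d \otimes d$. Note $a^{-1} = a^{N-1}$, $d^{-1} = d^{N-1}$. There is a unique isomorphism of Hopf algebras $\phi : \overline{\mathcal{O}}_q(SL_2) \to \overline{U}_q(\mathfrak{sl}_2)^*$ such that $\begin{pmatrix} \langle\phi(a),u\rangle & \langle\phi(b),u\rangle \\ \langle\phi(c),u\rangle & \langle\phi(d),u\rangle \end{pmatrix} = \rho(u)$, where $\rho$ is the representation with $\rho(E) = \begin{pmatrix} 0&1\\0&0\end{pmatrix}$, $\rho(F) = \begin{pmatrix} 0&0\\1&0\end{pmatrix}$, $\rho(K) = \begin{pmatrix} q&0\\0&q^{-1}\end{pmatrix}$.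 Put $(f,u) = \langle \phi(f), u\rangle$ and $f \leftharpoonup u = (f_{(1)}, u) f_{(2)}$; this is a right action of $\overline{U}_q(\mathfrak{sl}_2)$ on $\overline{\mathcal{O}}_q(SL_2)$. A right coideal subalgebra of a Hopf algebra $H$ is a (unital) subalgebra $A$ with $\Delta(A) \subset A \otimes H$. $\langle\cdots\rangle$ denotes the unital subalgebra generated by the indicated elements. *)

theory Defs
  imports
    "HOL-Library.Poly_Mapping"
    "HOL-Library.Product_Plus"
    "HOL-Algebra.Generated_Rings"
    "HOL-Algebra.Module"
    "HOL-Algebra.QuotRing"
    "HOL-Computational_Algebra.Polynomial"
    "HOL-Analysis.Cartesian_Space"
begin

section \<open>Free algebras and their quotients\<close>

text \<open>
  Words over an alphabet form a monoid, written additively because \<^typ>\<open>'m \<Rightarrow>\<^sub>0 'k\<close> is the monoid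
  algebra of an additively written monoid \<^typ>\<open>'m\<close>.
\<close>

datatype 'x word = Word (letters: "'x list")

instantiation word :: (type) monoid_add
begin

definition zero_word :: "'x word" where
  "zero_word = Word []"

definition plus_word :: "'x word \<Rightarrow> 'x word \<Rightarrow> 'x word" where
  "plus_word v w = Word (letters v @ letters w)"

instance
  by standard (simp_all add: zero_word_def plus_word_def)

end

text \<open>
  The free algebra \<open>k\<langle>X\<rangle>\<close> is the monoid algebra of the words over \<open>X\<close>. Its tensor square is the
  monoid algebra of pairs of words, the pair \<open>(v, w)\<close> standing for \<open>v \<otimes> w\<close>; the componentwise
  product of pairs is the usual product of a tensor product of algebras.
\<close>

type_synonym ('x, 'k) free_alg = "'x word \<Rightarrow>\<^sub>0 'k"
type_synonym ('x, 'k) free_alg2 = "'x word \<times> 'x word \<Rightarrow>\<^sub>0 'k"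

definition scal :: "'k \<Rightarrow> ('m::monoid_add \<Rightarrow>\<^sub>0 'k::field)" where
  "scal c = Poly_Mapping.single 0 c"

definition gen :: "'x \<Rightarrow> ('x, 'k::field) free_alg" where
  "gen x = Poly_Mapping.single (Word [x]) 1"

definition tens :: "('x, 'k::field) free_alg \<Rightarrow> ('x, 'k) free_alg \<Rightarrow> ('x, 'k) free_alg2"
    (infixl \<open>\<otimes>\<^sub>f\<close> 72) where
  "p \<otimes>\<^sub>f s = (\<Sum>v\<in>Poly_Mapping.keys p. \<Sum>w\<in>Poly_Mapping.keys s.
      Poly_Mapping.single (v, w) (Poly_Mapping.lookup p v * Poly_Mapping.lookup s w))"

text \<open>
  The linear extension of a map \<open>f\<close> given on the basis of a monoid algebra, into a vector space
  whose scalar multiplication is \<open>sc\<close>.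
\<close>

definition lin_ext :: "('k \<Rightarrow> 'v \<Rightarrow> 'v::comm_monoid_add) \<Rightarrow> ('m \<Rightarrow> 'v) \<Rightarrow> ('m \<Rightarrow>\<^sub>0 'k::zero) \<Rightarrow> 'v" where
  "lin_ext sc f p = (\<Sum>m\<in>Poly_Mapping.keys p. sc (Poly_Mapping.lookup p m) (f m))"

text \<open>
  Quotients are formed with the cosets of HOL-Algebra; \<open>Idl\<close> is the two-sided ideal generated
  by a set.
\<close>

definition monoid_alg :: "('m::monoid_add \<Rightarrow>\<^sub>0 'k::field) ring" where
  "monoid_alg = \<lparr>carrier = UNIV, monoid.mult = (*), one = 1, zero = 0, add = (+)\<rparr>"

definition quot_class :: "('m::monoid_add \<Rightarrow>\<^sub>0 'k::field) set \<Rightarrow> ('m \<Rightarrow>\<^sub>0 'k) \<Rightarrow> ('m \<Rightarrow>\<^sub>0 'k) set" where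
  "quot_class R p = (Idl\<^bsub>monoid_alg\<^esub> R) +>\<^bsub>monoid_alg\<^esub> p"

definition quot_alg :: "('m::monoid_add \<Rightarrow>\<^sub>0 'k::field) set \<Rightarrow> ('k, ('m \<Rightarrow>\<^sub>0 'k) set) module" where
  "quot_alg R =
    (let Q = monoid_alg Quot (Idl\<^bsub>monoid_alg\<^esub> R) in
      \<lparr>carrier = carrier Q, monoid.mult = monoid.mult Q, one = one Q, zero = zero Q, add = add Q,
       module.smult = (\<lambda>c X. quot_class R (scal c) \<otimes>\<^bsub>Q\<^esub> X)\<rparr>)"

text \<open>The unital subalgebra generated by \<open>S\<close>: the subring generated by \<open>S\<close> and the scalars.\<close>

definition subalg :: "('k, 'a) module \<Rightarrow> 'a set \<Rightarrow> 'a set" where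
  "subalg A S = generate_ring A (range (\<lambda>c. c \<odot>\<^bsub>A\<^esub> \<one>\<^bsub>A\<^esub>) \<union> S)"


section \<open>Bialgebras given by generators and relations\<close>

text \<open>
  A presentation lists the elements of the free algebra to be made zero, and the values of the
  comultiplication and of the counit on the generators. In \<open>the_elem (h ` X)\<close> the image of a coset
  \<open>X\<close> is a singleton whenever \<open>h\<close> respects the relations, so that this is the map induced by \<open>h\<close>.
\<close>

record (overloaded) ('x, 'k::zero) bialg_pres =
  relators :: "('x, 'k) free_alg set"
  comult_gen :: "'x \<Rightarrow> ('x, 'k) free_alg2"
  counit_gen :: "'x \<Rightarrow> 'k"

definition alg :: "('x, 'k::field) bialg_pres \<Rightarrow> ('k, ('x, 'k) free_alg set) module" where
  "alg P = quot_alg (relators P)"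

definition gen_class :: "('x, 'k::field) bialg_pres \<Rightarrow> 'x \<Rightarrow> ('x, 'k) free_alg set" where
  "gen_class P x = quot_class (relators P) (gen x)"

definition word_class :: "('x, 'k::field) bialg_pres \<Rightarrow> 'x word \<Rightarrow> ('x, 'k) free_alg set" where
  "word_class P w = quot_class (relators P) (Poly_Mapping.single w 1)"

text \<open>
  \<open>H \<otimes> H\<close> for \<open>H = k\<langle>X\<rangle>/I\<close> is \<open>(k\<langle>X\<rangle> \<otimes> k\<langle>X\<rangle>)/(I \<otimes> k\<langle>X\<rangle> + k\<langle>X\<rangle> \<otimes> I)\<close>.
\<close>

definition tensor_relators :: "('x, 'k::field) bialg_pres \<Rightarrow> ('x, 'k) free_alg2 set" where
  "tensor_relators P = (\<lambda>p. p \<otimes>\<^sub>f 1) ` relators P \<union> (\<lambda>p. 1 \<otimes>\<^sub>f p) ` relators P"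

definition comult :: "('x, 'k::field) bialg_pres \<Rightarrow> ('x, 'k) free_alg set \<Rightarrow> ('x, 'k) free_alg2 set" where
  "comult P X = the_elem
    ((\<lambda>p. quot_class (tensor_relators P)
        (lin_ext (\<lambda>c t. scal c * t) (\<lambda>w. prod_list (map (comult_gen P) (letters w))) p)) ` X)"

definition counit :: "('x, 'k::field) bialg_pres \<Rightarrow> ('x, 'k) free_alg set \<Rightarrow> 'k" where
  "counit P X = the_elem (lin_ext (*) (\<lambda>w. prod_list (map (counit_gen P) (letters w))) ` X)"

text \<open>
  The maps \<open>g \<otimes> h\<close> and \<open>g \<otimes> id\<close> on \<open>H \<otimes> H\<close>, for linear functionals \<open>g\<close> and \<open>h\<close> on \<open>H\<close>.
\<close>

definition apply_both ::
  "('x, 'k::field) bialg_pres \<Rightarrow> (('x, 'k) free_alg set \<Rightarrow> 'k) \<Rightarrow> (('x, 'k) free_alg set \<Rightarrow> 'k) \<Rightarrow>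
    ('x, 'k) free_alg2 set \<Rightarrow> 'k" where
  "apply_both P g h T =
    the_elem (lin_ext (*) (\<lambda>(v, w). g (word_class P v) * h (word_class P w)) ` T)"

definition apply_left ::
  "('x, 'k::field) bialg_pres \<Rightarrow> (('x, 'k) free_alg set \<Rightarrow> 'k) \<Rightarrow>
    ('x, 'k) free_alg2 set \<Rightarrow> ('x, 'k) free_alg set" where
  "apply_left P g T = the_elem
    ((\<lambda>t. quot_class (relators P)
        (lin_ext (\<lambda>c p. scal c * p) (\<lambda>(v, w). Poly_Mapping.single w (g (word_class P v))) t)) ` T)"

text \<open>Linear functionals are made undefined off the carrier, so that equality is as on the carrier.\<close>

definition dual :: "('k::field, 'a) module \<Rightarrow> ('a \<Rightarrow> 'k) set" where
  "dual A = {g \<in> extensional (carrier A).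
    (\<forall>x\<in>carrier A. \<forall>y\<in>carrier A. g (x \<oplus>\<^bsub>A\<^esub> y) = g x + g y) \<and>
    (\<forall>c. \<forall>x\<in>carrier A. g (c \<odot>\<^bsub>A\<^esub> x) = c * g x)}"

text \<open>
  Isomorphisms \<open>\<phi>\<close> from the bialgebra of \<open>P\<close> onto the dual of the (finite-dimensional) bialgebra
  of \<open>Q\<close>. In the dual, \<open>g h = (g \<otimes> h) \<Delta>\<close>, the unit is the counit of \<open>Q\<close>, the counit is evaluation
  at \<open>1\<close>, and \<open>\<Delta> g\<close> is determined by \<open>\<langle>\<Delta> g, u \<otimes> v\<rangle> = \<langle>g, u v\<rangle>\<close>. Between Hopf algebras such a
  map automatically respects the antipodes.
\<close>

definition bialg_iso_dual ::
  "('x, 'k::field) bialg_pres \<Rightarrow> ('y, 'k) bialg_pres \<Rightarrow>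
    (('x, 'k) free_alg set \<Rightarrow> ('y, 'k) free_alg set \<Rightarrow> 'k) \<Rightarrow> bool" where
  "bialg_iso_dual P Q \<phi> \<longleftrightarrow>
    bij_betw \<phi> (carrier (alg P)) (dual (alg Q)) \<and>
    (\<forall>f\<in>carrier (alg P). \<forall>g\<in>carrier (alg P). \<forall>u\<in>carrier (alg Q).
      \<phi> (f \<oplus>\<^bsub>alg P\<^esub> g) u = \<phi> f u + \<phi> g u) \<and>
    (\<forall>c. \<forall>f\<in>carrier (alg P). \<forall>u\<in>carrier (alg Q).
      \<phi> (c \<odot>\<^bsub>alg P\<^esub> f) u = c * \<phi> f u) \<and>
    (\<forall>f\<in>carrier (alg P). \<forall>g\<in>carrier (alg P). \<forall>u\<in>carrier (alg Q).
      \<phi> (f \<otimes>\<^bsub>alg P\<^esub> g) u = apply_both Q (\<phi> f) (\<phi> g) (comult Q u)) \<and>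
    (\<forall>u\<in>carrier (alg Q). \<phi> \<one>\<^bsub>alg P\<^esub> u = counit Q u) \<and>
    (\<forall>f\<in>carrier (alg P). \<forall>u\<in>carrier (alg Q). \<forall>v\<in>carrier (alg Q).
      \<phi> f (u \<otimes>\<^bsub>alg Q\<^esub> v) = apply_both P (\<lambda>g. \<phi> g u) (\<lambda>g. \<phi> g v) (comult P f)) \<and>
    (\<forall>f\<in>carrier (alg P). \<phi> f \<one>\<^bsub>alg Q\<^esub> = counit P f)"


section \<open>The small quantum group of \<open>sl\<^sub>2\<close>\<close>

datatype gen_U = gK | gE | gF

text \<open>Since \<open>K\<^sup>N = 1\<close>, the inverse of \<open>K\<close> is written \<open>K\<^sup>N\<^sup>-\<^sup>1\<close> in the free algebra.\<close>

definition Uq :: "nat \<Rightarrow> 'k::field \<Rightarrow> (gen_U, 'k) bialg_pres" where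
  "Uq N q =
    (let K = gen gK; E = gen gE; F = gen gF; K' = gen gK ^ (N - 1) in
     \<lparr>relators =
        {K ^ N - 1,
         K * E - scal (q ^ 2) * E * K,
         K * F - scal (inverse (q ^ 2)) * F * K,
         E ^ N,
         F ^ N,
         E * F - F * E - scal (inverse (q - inverse q)) * (K - K')},
      comult_gen = (\<lambda>x. case x of
          gK \<Rightarrow> K \<otimes>\<^sub>f K
        | gE \<Rightarrow> E \<otimes>\<^sub>f K + 1 \<otimes>\<^sub>f E
        | gF \<Rightarrow> F \<otimes>\<^sub>f 1 + K' \<otimes>\<^sub>f F),
      counit_gen = (\<lambda>x. case x of gK \<Rightarrow> 1 | gE \<Rightarrow> 0 | gF \<Rightarrow> 0)\<rparr>)"

definition \<rho>_gen :: "'k::field \<Rightarrow> gen_U \<Rightarrow> 'k ^ 2 ^ 2" where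
  "\<rho>_gen q x = (case x of
      gK \<Rightarrow> vector [vector [q, 0], vector [0, inverse q]]
    | gE \<Rightarrow> vector [vector [0, 1], vector [0, 0]]
    | gF \<Rightarrow> vector [vector [0, 0], vector [1, 0]])"

definition \<rho> :: "'k::field \<Rightarrow> (gen_U, 'k) free_alg set \<Rightarrow> 'k ^ 2 ^ 2" where
  "\<rho> q X = the_elem
    (lin_ext (\<lambda>c M. mat c ** M) (\<lambda>w. foldr (\<lambda>x M. \<rho>_gen q x ** M) (letters w) (mat 1)) ` X)"


section \<open>The coordinate algebra of the small quantum \<open>SL\<^sub>2\<close>\<close>

datatype gen_O = ga | gb | gc | gd

text \<open>The counit is the one determined by the comultiplication: \<open>1\<close> on \<open>a, d\<close> and \<open>0\<close> on \<open>b, c\<close>.\<close>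

definition Oq :: "nat \<Rightarrow> 'k::field \<Rightarrow> (gen_O, 'k) bialg_pres" where
  "Oq N q =
    (let a = gen ga; b = gen gb; c = gen gc; d = gen gd in
     \<lparr>relators =
        {b * a - scal q * a * b,
         c * a - scal q * a * c,
         b * c - c * b,
         d * b - scal q * b * d,
         d * c - scal q * c * d,
         a * d - scal (inverse q) * b * c - 1,
         d * a - scal q * b * c - 1,
         a ^ N - 1,
         d ^ N - 1,
         b ^ N,
         c ^ N},
      comult_gen = (\<lambda>x. case x of
          ga \<Rightarrow> a \<otimes>\<^sub>f a + b \<otimes>\<^sub>f c
        | gb \<Rightarrow> a \<otimes>\<^sub>f b + b \<otimes>\<^sub>f d
        | gc \<Rightarrow> c \<otimes>\<^sub>f a + d \<otimes>\<^sub>f c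
        | gd \<Rightarrow> c \<otimes>\<^sub>f b + d \<otimes>\<^sub>f d),
      counit_gen = (\<lambda>x. case x of ga \<Rightarrow> 1 | gb \<Rightarrow> 0 | gc \<Rightarrow> 0 | gd \<Rightarrow> 1)\<rparr>)"


section \<open>The pairing, the action and the invariants\<close>

definition hopf_iso ::
  "nat \<Rightarrow> 'k::field \<Rightarrow> ((gen_O, 'k) free_alg set \<Rightarrow> (gen_U, 'k) free_alg set \<Rightarrow> 'k) \<Rightarrow> bool" where
  "hopf_iso N q \<phi> \<longleftrightarrow>
    bialg_iso_dual (Oq N q) (Uq N q) \<phi> \<and>
    (\<forall>u\<in>carrier (alg (Uq N q)).
      vector [vector [\<phi> (gen_class (Oq N q) ga) u, \<phi> (gen_class (Oq N q) gb) u],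
              vector [\<phi> (gen_class (Oq N q) gc) u, \<phi> (gen_class (Oq N q) gd) u]] = \<rho> q u)"

text \<open>\<open>f \<leftharpoonup> u = (f\<^sub>1, u) f\<^sub>2\<close> with \<open>(f, u) = \<langle>\<phi> f, u\<rangle>\<close>\<close>

definition act ::
  "nat \<Rightarrow> 'k::field \<Rightarrow> ((gen_O, 'k) free_alg set \<Rightarrow> (gen_U, 'k) free_alg set \<Rightarrow> 'k) \<Rightarrow>
    (gen_O, 'k) free_alg set \<Rightarrow> (gen_U, 'k) free_alg set \<Rightarrow> (gen_O, 'k) free_alg set" where
  "act N q \<phi> f u = apply_left (Oq N q) (\<lambda>g. \<phi> g u) (comult (Oq N q) f)"

definition dagger ::
  "nat \<Rightarrow> 'k::field \<Rightarrow> ((gen_O, 'k) free_alg set \<Rightarrow> (gen_U, 'k) free_alg set \<Rightarrow> 'k) \<Rightarrow>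
    (gen_U, 'k) free_alg set set \<Rightarrow> (gen_O, 'k) free_alg set set" where
  "dagger N q \<phi> A =
    {f \<in> carrier (alg (Oq N q)). \<forall>u\<in>A.
      act N q \<phi> f u = counit (Uq N q) u \<odot>\<^bsub>alg (Oq N q)\<^esub> f}"

end

theory Submission
  imports Defs
begin

text \<open>
  Write \<open>f \<leftharpoonup> u\<close> for the action. Since \<open>\<langle>\<phi> (f \<leftharpoonup> u), v\<rangle> = \<langle>\<phi> f, u v\<rangle>\<close> and \<open>\<phi>\<close> is injective, \<open>f \<leftharpoonup> u\<close> is
  multiplicative for \<open>u = K\<close>, and both \<open>E\<close> and \<open>G = (q - q\<^sup>-\<^sup>1) K F\<close> act as skew derivations:
  \<open>(f g) \<leftharpoonup> E = (f \<leftharpoonup> E) (g \<leftharpoonup> K) + f (g \<leftharpoonup> E)\<close>. Invariance under a subalgebra need only be tested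
  on its generators. For the derivation \<open>E\<close> put \<open>(x, s, t) = (b, c, d)\<close>, for \<open>G\<close> put
  \<open>(x, s, t) = (c, b, a)\<close>; then \<open>D x\<close> is a multiple of \<open>t\<close>, \<open>D\<close> kills \<open>B = \<langle>s, t\<rangle>\<close>, and applying \<open>D\<close>
  repeatedly shows that \<open>1, x, \<dots>, x\<^sup>N\<^sup>-\<^sup>1\<close> is a basis of the whole algebra over \<open>B\<close>. Comparing top
  coefficients gives the kernel of \<open>D\<close> and of \<open>D + \<alpha> (K - 1)\<close>, and averaging over the powers of
  \<open>K\<^sup>r\<close> gives the fixed elements of \<open>K\<^sup>r\<close>.

  To compute with equations rather than congruences, \<open>\<O>\<^sub>q(SL\<^sub>2)\<close> is embedded into the type of all
  functions on words in \<open>K, E, G\<close> with the convolution product dual to the comultiplication; on that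
  type the skew Leibniz rules hold by definition.
\<close>

section \<open>Linear extensions and quotients of monoid algebras\<close>

text \<open>The choice of G rather than F makes the two halves alike: the coproduct of KF is KF
  \<otimes> K + KK^-1 \<otimes> KF, of the same shape as that of E, while the coproduct of F is not.
  Hence one locale, \<open>quantum_half\<close>, serves both, with \<omega> = q for E and \<omega> =
  q^-1 for G. Neither algebra comes with a PBW basis; only generators, relations and the map \<phi>
  are given. Independence of the powers of x is produced by D itself: D (x^(m+1) g) = l [m+1] x^m t
  K g for g in B, where [m+1] is the q-number for \<omega>^2. It is nonzero for m+1 < N because N is
  odd; moreover t is a unit and K is injective on B. The constants in the two families come from the
  ansatz w = t^2 + \<mu> x t: D w + \<alpha> K w = \<alpha> w amounts to \<mu> l = \<alpha>
  (\<omega> - \<omega>^-1). For \<alpha> \<noteq> 0 the power w^m has a leading term in x^m, so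
  powers of w remove top coefficients. The invariants of the whole algebra need both halves: K and E
  leave the polynomials in z = c d^-1, and G sends z to a nonzero multiple of the unit d^-2.\<close>

abbreviation lk :: "('a \<Rightarrow>\<^sub>0 'b::zero) \<Rightarrow> 'a \<Rightarrow> 'b" where "lk \<equiv> Poly_Mapping.lookup"
abbreviation sgl :: "'a \<Rightarrow> 'b::zero \<Rightarrow> 'a \<Rightarrow>\<^sub>0 'b" where "sgl \<equiv> Poly_Mapping.single"

lemma poly_mapping_sum_single: "p = (\<Sum>m\<in>Poly_Mapping.keys p. sgl m (lk p m))"
  by (rule poly_mapping_eqI)
    (auto simp: lookup_sum lookup_single when_def not_in_keys_iff_lookup_eq_zero)

lemma additive_eqI:
  fixes f g :: "('m \<Rightarrow>\<^sub>0 'k::ab_group_add) \<Rightarrow> 'v::ab_group_add"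
  assumes "\<And>p p'. f (p + p') = f p + f p'" "\<And>p p'. g (p + p') = g p + g p'"
    and "\<And>m c. f (sgl m c) = g (sgl m c)"
  shows "f p = g p"
proof -
  have 0: "f 0 = 0" "g 0 = 0"
    using assms(1)[of 0 0] assms(2)[of 0 0] by simp_all
  have "f (\<Sum>m\<in>S. sgl m (lk p m)) = g (\<Sum>m\<in>S. sgl m (lk p m))" if "finite S" for S
    using that by induction (simp_all add: 0 assms)
  then show ?thesis
    using poly_mapping_sum_single[of p] by (metis finite_keys)
qed

lemma scal_0 [simp]: "scal 0 = 0" and scal_1 [simp]: "scal 1 = 1"
  by (simp_all add: scal_def)

lemma scal_add: "scal (c + d) = scal c + scal d"
  and scal_uminus: "scal (- c) = - scal c"
  and scal_mult: "scal (c * d) = scal c * scal d"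
  by (simp_all add: scal_def single_add single_uminus mult_single)

lemma scal_mult_single: "scal c * sgl m d = sgl m (c * d)"
  by (simp add: scal_def mult_single)

lemma scal_central: "p * scal c = scal c * p"
  by (rule additive_eqI[where f = "\<lambda>p. p * scal c" and g = "\<lambda>p. scal c * p"])
    (simp_all add: algebra_simps scal_def mult_single)

context vector_space
begin

lemma lin_ext_superset:
  assumes "finite S" "Poly_Mapping.keys p \<subseteq> S"
  shows "lin_ext scale f p = (\<Sum>m\<in>S. scale (lk p m) (f m))"
  unfolding lin_ext_def using assms
  by (intro sum.mono_neutral_left) (auto simp: not_in_keys_iff_lookup_eq_zero)

lemma lin_ext_add: "lin_ext scale f (p + p') = lin_ext scale f p + lin_ext scale f p'"
proof -
  let ?S = "Poly_Mapping.keys p \<union> Poly_Mapping.keys p'"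
  have "Poly_Mapping.keys (p + p') \<subseteq> ?S" by (rule keys_add)
  then show ?thesis
    by (subst (1 2 3) lin_ext_superset[where S = ?S])
      (auto simp: lookup_add scale_left_distrib sum.distrib)
qed

lemma lin_ext_single [simp]: "lin_ext scale f (sgl m c) = scale c (f m)"
  by (subst lin_ext_superset[where S = "{m}"]) auto

lemma lin_ext_0 [simp]: "lin_ext scale f 0 = 0"
  by (simp add: lin_ext_def)

lemma lin_ext_uminus: "lin_ext scale f (- p) = - lin_ext scale f p"
  using lin_ext_add[of f p "- p"] by (simp add: eq_neg_iff_add_eq_0 add.commute)

lemma lin_ext_diff: "lin_ext scale f (p - p') = lin_ext scale f p - lin_ext scale f p'"
  using lin_ext_add[of f p "- p'"] by (simp add: lin_ext_uminus)

text \<open>The product \<open>mul\<close> is a parameter because one target is the space of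
  matrices, where the relevant product is \<open>**\<close> and not \<open>*\<close>.\<close>

lemma lin_ext_mult:
  assumes add: "\<And>x y z. mul (x + y) z = mul x z + mul y z" "\<And>x y z. mul z (x + y) = mul z x + mul z y"
    and sc: "\<And>c d x y. mul (scale c x) (scale d y) = scale (c * d) (mul x y)"
    and f: "\<And>v w. f (v + w) = mul (f v) (f w)"
  shows "lin_ext scale f (p * p') = mul (lin_ext scale f p) (lin_ext scale f p')"
proof (rule additive_eqI[where f = "\<lambda>p. lin_ext scale f (p * p')"])
  fix m c
  show "lin_ext scale f (sgl m c * p') = mul (lin_ext scale f (sgl m c)) (lin_ext scale f p')"
    by (rule additive_eqI[where f = "\<lambda>p'. lin_ext scale f (sgl m c * p')"])
      (simp_all add: algebra_simps lin_ext_add mult_single add sc f)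
qed (simp_all add: algebra_simps lin_ext_add add)

end

lemma vector_space_scal: "vector_space (\<lambda>c p. scal c * (p :: 'm::monoid_add \<Rightarrow>\<^sub>0 'k::field))"
  by standard (simp_all add: algebra_simps scal_add scal_mult)

interpretation alg_mod: vector_space "\<lambda>c p. scal c * (p :: 'm::monoid_add \<Rightarrow>\<^sub>0 'k::field)"
  by (rule vector_space_scal)

section \<open>The monoid algebra as a ring with carrier\<close>

lemma monoid_alg_simps [simp]:
  "carrier monoid_alg = UNIV" "x \<otimes>\<^bsub>monoid_alg\<^esub> y = x * y" "x \<oplus>\<^bsub>monoid_alg\<^esub> y = x + y"
  "\<one>\<^bsub>monoid_alg\<^esub> = 1" "\<zero>\<^bsub>monoid_alg\<^esub> = 0"
  by (simp_all add: monoid_alg_def)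

lemma ring_monoid_alg: "ring (monoid_alg :: ('m::monoid_add \<Rightarrow>\<^sub>0 'k::field) ring)"
proof (rule ringI)
  show "abelian_group (monoid_alg :: ('m \<Rightarrow>\<^sub>0 'k) ring)"
  proof (rule abelian_groupI)
    fix p :: "'m \<Rightarrow>\<^sub>0 'k"
    show "\<exists>p'\<in>carrier monoid_alg. p' \<oplus>\<^bsub>monoid_alg\<^esub> p = \<zero>\<^bsub>monoid_alg\<^esub>"
      by (rule bexI[of _ "- p"]) simp_all
  qed (simp_all add: algebra_simps)
  show "Group.monoid (monoid_alg :: ('m \<Rightarrow>\<^sub>0 'k) ring)"
    by unfold_locales (simp_all add: algebra_simps)
qed (simp_all add: algebra_simps)

lemma a_inv_monoid_alg: "\<ominus>\<^bsub>monoid_alg\<^esub> p = - (p :: 'm::monoid_add \<Rightarrow>\<^sub>0 'k::field)"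
proof -
  interpret ring "monoid_alg :: ('m \<Rightarrow>\<^sub>0 'k) ring" by (rule ring_monoid_alg)
  show ?thesis by (rule minus_equality) simp_all
qed

text \<open>Two-sided ideals of a type-class ring, so that congruences are handled with ordinary
  ring arithmetic. \<open>two_sided_rel_ideal\<close> and \<open>ideal_monoid_algI\<close> translate
  from and to ideals of rings with carrier.\<close>

locale two_sided =
  fixes J :: "'a::ring_1 set"
  assumes zero_mem [simp, intro]: "0 \<in> J"
    and add_mem [intro]: "x \<in> J \<Longrightarrow> y \<in> J \<Longrightarrow> x + y \<in> J"
    and lmult_mem [intro]: "x \<in> J \<Longrightarrow> z * x \<in> J"
    and rmult_mem [intro]: "x \<in> J \<Longrightarrow> x * z \<in> J"
begin

lemma uminus_mem: "x \<in> J \<Longrightarrow> - x \<in> J"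
  using lmult_mem[of x "-1"] by simp

lemma uminus_mem_iff [simp]: "- x \<in> J \<longleftrightarrow> x \<in> J"
  using uminus_mem[of x] uminus_mem[of "- x"] by auto

lemma diff_mem [intro]: "x \<in> J \<Longrightarrow> y \<in> J \<Longrightarrow> x - y \<in> J"
  using add_mem[of x "- y"] by simp

lemma sum_mem: "(\<And>i. i \<in> S \<Longrightarrow> f i \<in> J) \<Longrightarrow> sum f S \<in> J"
  by (induction S rule: infinite_finite_induct) auto

lemma diff_mem_trans: "x - y \<in> J \<Longrightarrow> y - z \<in> J \<Longrightarrow> x - z \<in> J"
  using add_mem[of "x - y" "y - z"] by simp

lemma diff_mem_cong: "x - y \<in> J \<Longrightarrow> x \<in> J \<longleftrightarrow> y \<in> J"
  using add_mem[of "x - y" y] diff_mem[of x "x - y"] by auto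

lemma mult_diff_mem:
  assumes "x - x' \<in> J" "y - y' \<in> J"
  shows "x * y - x' * y' \<in> J"
proof -
  have "x * y - x' * y' = (x - x') * y + x' * (y - y')" by (simp add: algebra_simps)
  then show ?thesis using assms by auto
qed

end

section \<open>Ideals generated by relators and their cosets\<close>

definition rel_ideal :: "('m::monoid_add \<Rightarrow>\<^sub>0 'k::field) set \<Rightarrow> ('m \<Rightarrow>\<^sub>0 'k) set" where
  "rel_ideal R = Idl\<^bsub>monoid_alg\<^esub> R"

lemma ideal_rel_ideal: "ideal (rel_ideal R) monoid_alg"
  unfolding rel_ideal_def by (rule ring.genideal_ideal[OF ring_monoid_alg]) simp

lemma two_sided_rel_ideal: "two_sided (rel_ideal R)"
proof -
  interpret ideal "rel_ideal R" monoid_alg by (rule ideal_rel_ideal)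
  show ?thesis
    using a_closed I_l_closed I_r_closed additive_subgroup.zero_closed[OF is_additive_subgroup]
      additive_subgroup.a_closed[OF is_additive_subgroup]
    by unfold_locales auto
qed

lemma ideal_monoid_algI: "two_sided S \<Longrightarrow> ideal S monoid_alg"
proof -
  assume "two_sided S"
  interpret two_sided S by fact
  interpret A: ring monoid_alg by (rule ring_monoid_alg)
  have "subgroup S (add_monoid monoid_alg)"
    by (rule A.add.subgroupI) (auto simp flip: a_inv_def simp: a_inv_monoid_alg uminus_mem)
  then show "ideal S monoid_alg"
    by (intro idealI[OF ring_monoid_alg]) (auto simp: monoid_alg_def)
qed

lemma rel_ideal_incl: "x \<in> R \<Longrightarrow> x \<in> rel_ideal R"
  unfolding rel_ideal_def
  using ring.genideal_self[OF ring_monoid_alg, of R] by auto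

text \<open>Together with \<open>two_sided_vimage\<close> this reduces well-definedness on a
  quotient to a check on the relators: the elements mapped into the target ideal form a two-sided
  ideal.\<close>

lemma rel_ideal_minimal: "two_sided S \<Longrightarrow> R \<subseteq> S \<Longrightarrow> rel_ideal R \<subseteq> S"
  unfolding rel_ideal_def by (rule ring.genideal_minimal[OF ring_monoid_alg]) (rule ideal_monoid_algI)

lemma two_sided_vimage:
  fixes h :: "'a::ring_1 \<Rightarrow> 'b::ring_1"
  assumes "two_sided J" "\<And>x y. h (x + y) = h x + h y" "\<And>x y. h (x * y) = h x * h y"
  shows "two_sided {x. h x \<in> J}"
proof -
  interpret two_sided J by fact
  have "h 0 = 0" using assms(2)[of 0 0] by simp
  then show ?thesis by unfold_locales (auto simp: assms)
qed

lemma mem_quot_class: "x \<in> quot_class R p \<longleftrightarrow> x - p \<in> rel_ideal R"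
  by (auto simp: quot_class_def rel_ideal_def a_r_coset_def r_coset_def
      intro!: bexI[of _ "x - p"])

lemma quot_class_self [simp]: "p \<in> quot_class R p"
  using two_sided.zero_mem[OF two_sided_rel_ideal] by (simp add: mem_quot_class)

lemma quot_class_eq_iff: "quot_class R p = quot_class R p' \<longleftrightarrow> p - p' \<in> rel_ideal R"
proof
  assume "quot_class R p = quot_class R p'"
  with quot_class_self[of p R] show "p - p' \<in> rel_ideal R" by (simp only: mem_quot_class)
next
  interpret two_sided "rel_ideal R" by (rule two_sided_rel_ideal)
  assume *: "p - p' \<in> rel_ideal R"
  have "x - p \<in> rel_ideal R \<longleftrightarrow> x - p' \<in> rel_ideal R" for x
  proof (rule diff_mem_cong)
    have "x - p - (x - p') = - (p - p')" by simp
    then show "x - p - (x - p') \<in> rel_ideal R" using uminus_mem[OF *] by simp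
  qed
  then show "quot_class R p = quot_class R p'" by (simp add: set_eq_iff mem_quot_class)
qed

lemma the_elem_image_quot_class:
  assumes "\<And>x. x - p \<in> rel_ideal R \<Longrightarrow> h x = h p"
  shows "the_elem (h ` quot_class R p) = h p"
proof -
  have "h ` quot_class R p = {h p}"
  proof (intro equalityI subsetI)
    show "y \<in> h ` quot_class R p" if "y \<in> {h p}" for y
      using that quot_class_self[of p R] by blast
    show "y \<in> {h p}" if "y \<in> h ` quot_class R p" for y
    proof -
      from that obtain x where "x \<in> quot_class R p" "y = h x" by blast
      then show ?thesis using assms[of x] by (simp add: mem_quot_class)
    qed
  qed
  then show ?thesis by simp
qed

lemma the_elem_image_quot_class_hom:
  fixes h :: "_ \<Rightarrow> 'b::ab_group_add"
  assumes "\<And>x. x \<in> rel_ideal R \<Longrightarrow> h x = 0" "\<And>x y. h (x - y) = h x - h y"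
  shows "the_elem (h ` quot_class R p) = h p"
proof (rule the_elem_image_quot_class)
  fix x assume "x - p \<in> rel_ideal R"
  then show "h x = h p" using assms(1)[of "x - p"] by (simp add: assms(2))
qed

section \<open>Arithmetic in the quotient algebra\<close>

lemma quot_alg_Quot: "monoid_alg Quot (Idl\<^bsub>monoid_alg\<^esub> R) = monoid_alg Quot (rel_ideal R)"
  by (simp add: rel_ideal_def)

text \<open>The factor ring and \<open>quot_alg\<close> are records of different types, so one
  cannot be rewritten to the other. The ring axioms mention only the fields that both share.\<close>

lemma ring_truncate_iff: "ring A \<longleftrightarrow> ring \<lparr>carrier = carrier A, monoid.mult = monoid.mult A,
    one = one A, zero = zero A, add = add A, module.smult = s\<rparr>"
  by (simp only: ring_def abelian_group_def abelian_monoid_def abelian_group_axioms_def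
      ring_axioms_def Group.monoid_def comm_group_def Group.comm_monoid_def
      comm_monoid_axioms_def Group.group_def group_axioms_def Units_def partial_object.simps monoid.simps ring.simps)

lemma ring_quot_alg: "ring (quot_alg R)"
proof -
  interpret ideal "rel_ideal R" monoid_alg by (rule ideal_rel_ideal)
  show ?thesis
    using quotient_is_ring
    unfolding quot_alg_def Let_def quot_alg_Quot by (subst (asm) ring_truncate_iff)
qed

lemma carrier_quot_alg: "carrier (quot_alg R) = range (quot_class R)"
  using A_RCOSETS_def'[of monoid_alg "Idl\<^bsub>monoid_alg\<^esub> R"]
  by (auto simp: quot_alg_def Let_def FactRing_def quot_class_def)

lemma quot_class_closed [simp]: "quot_class R p \<in> carrier (quot_alg R)"
  by (simp add: carrier_quot_alg)

lemma one_quot_alg: "\<one>\<^bsub>quot_alg R\<^esub> = quot_class R 1"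
  by (simp add: quot_alg_def Let_def FactRing_simps quot_class_def)

lemma zero_quot_alg: "\<zero>\<^bsub>quot_alg R\<^esub> = quot_class R 0"
proof -
  have "quot_class R 0 = rel_ideal R" by (auto simp: mem_quot_class)
  then show ?thesis by (simp add: quot_alg_def Let_def FactRing_simps rel_ideal_def)
qed

lemma add_quot_alg: "quot_class R p \<oplus>\<^bsub>quot_alg R\<^esub> quot_class R p' = quot_class R (p + p')"
proof -
  interpret ideal "rel_ideal R" monoid_alg by (rule ideal_rel_ideal)
  show ?thesis
    using a_rcos_sum[of p p'] by (simp add: quot_alg_def Let_def FactRing_simps quot_class_def rel_ideal_def)
qed

lemma mult_quot_alg: "quot_class R p \<otimes>\<^bsub>quot_alg R\<^esub> quot_class R p' = quot_class R (p * p')"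
proof -
  interpret ideal "rel_ideal R" monoid_alg by (rule ideal_rel_ideal)
  show ?thesis
    using rcoset_mult_add[of p p'] by (simp add: quot_alg_def Let_def FactRing_simps quot_class_def rel_ideal_def)
qed

lemma smult_quot_alg: "c \<odot>\<^bsub>quot_alg R\<^esub> quot_class R p = quot_class R (scal c * p)"
  using mult_quot_alg[of R "scal c" p] by (simp add: quot_alg_def Let_def)

lemma uminus_quot_alg: "\<ominus>\<^bsub>quot_alg R\<^esub> quot_class R p = quot_class R (- p)"
proof -
  interpret ring "quot_alg R" by (rule ring_quot_alg)
  show ?thesis by (rule minus_equality) (simp_all add: add_quot_alg zero_quot_alg)
qed

lemma power_quot_alg: "quot_class R p [^]\<^bsub>quot_alg R\<^esub> (n::nat) = quot_class R (p ^ n)"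
proof -
  interpret ring "quot_alg R" by (rule ring_quot_alg)
  show ?thesis by (induction n) (simp_all add: one_quot_alg mult_quot_alg power_commutes)
qed

section \<open>Gaussian binomials and tensor squares\<close>

context two_sided
begin

definition cong :: "'a \<Rightarrow> 'a \<Rightarrow> bool" (infix \<open>\<approx>\<close> 50) where "x \<approx> y \<longleftrightarrow> x - y \<in> J"

lemma cong_refl [simp, intro]: "x \<approx> x" by (simp add: cong_def)

lemma cong_trans [trans]: "x \<approx> y \<Longrightarrow> y \<approx> z \<Longrightarrow> x \<approx> z"
  unfolding cong_def by (rule diff_mem_trans)

lemma cong_add: "x \<approx> x' \<Longrightarrow> y \<approx> y' \<Longrightarrow> x + y \<approx> x' + y'"
  unfolding cong_def using add_mem[of "x - x'" "y - y'"] by (simp add: algebra_simps)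

lemma cong_mult: "x \<approx> x' \<Longrightarrow> y \<approx> y' \<Longrightarrow> x * y \<approx> x' * y'"
  unfolding cong_def by (rule mult_diff_mem)

lemma cong_sum: "(\<And>i. i \<in> S \<Longrightarrow> f i \<approx> g i) \<Longrightarrow> sum f S \<approx> sum g S"
  unfolding cong_def by (simp add: sum_mem flip: sum_subtractf)

end

lemma scal_left_commute: "Z * (scal c * p) = scal c * (Z * p)"
  by (simp only: mult.assoc[symmetric] scal_central[of Z])

text \<open>The Pascal rule for Gaussian binomials. The power of \<theta> sits on the second summand
  because it arises from moving Y past X^(k+1) when YX = \<theta> XY and monomials are written X^k
  Y^(n-k).\<close>

fun qbinom :: "'k::field \<Rightarrow> nat \<Rightarrow> nat \<Rightarrow> 'k" where
  "qbinom \<theta> n 0 = 1"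
| "qbinom \<theta> 0 (Suc k) = 0"
| "qbinom \<theta> (Suc n) (Suc k) = qbinom \<theta> n k + \<theta> ^ Suc k * qbinom \<theta> n (Suc k)"

lemma qbinom_eq_0: "n < k \<Longrightarrow> qbinom \<theta> n k = 0"
  by (induction \<theta> n k rule: qbinom.induct) auto

lemma qbinom_self [simp]: "qbinom \<theta> n n = 1"
  by (induction n) (simp_all add: qbinom_eq_0)

definition qnum :: "'k::field \<Rightarrow> nat \<Rightarrow> 'k" where "qnum \<theta> n = (\<Sum>i<n. \<theta> ^ i)"
definition qfact :: "'k::field \<Rightarrow> nat \<Rightarrow> 'k" where "qfact \<theta> n = (\<Prod>i<n. qnum \<theta> (Suc i))"

lemma qnum_add: "qnum \<theta> (m + n) = qnum \<theta> m + \<theta> ^ m * qnum \<theta> n"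
  by (induction n) (simp_all add: qnum_def algebra_simps power_add)

lemma qfact_Suc: "qfact \<theta> (Suc n) = qnum \<theta> (Suc n) * qfact \<theta> n"
  by (simp add: qfact_def)

text \<open>The factorial formula in multiplied-out form, since at a root of unity the q-factorials
  may vanish. The Pascal rule reduces it to the splitting of q-numbers in
  \<open>qnum_add\<close>.\<close>

lemma qbinom_fact: "k \<le> n \<Longrightarrow> qbinom \<theta> n k * (qfact \<theta> k * qfact \<theta> (n - k)) = qfact \<theta> n"
proof (induction n arbitrary: k)
  case 0
  then show ?case by (simp add: qfact_def)
next
  case (Suc n)
  show ?case
  proof (cases "k = 0 \<or> k = Suc n")
    case True
    then show ?thesis by (auto simp: qfact_def qbinom_eq_0)
  next
    case False
    then obtain j where j: "k = Suc j" "j < n" using Suc.prems by (cases k) auto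
    define i where "i = n - Suc j"
    have i: "n - j = Suc i" "n - Suc j = i" "n = Suc j + i" using j by (auto simp: i_def)
    have 1: "qbinom \<theta> n j * (qfact \<theta> j * qfact \<theta> (n - j)) = qfact \<theta> n"
      and 2: "qbinom \<theta> n (Suc j) * (qfact \<theta> (Suc j) * qfact \<theta> (n - Suc j)) = qfact \<theta> n"
      using Suc.IH j by auto
    have "qbinom \<theta> (Suc n) k * (qfact \<theta> k * qfact \<theta> (Suc n - k))
      = qnum \<theta> (Suc j) * (qbinom \<theta> n j * (qfact \<theta> j * qfact \<theta> (n - j)))
        + \<theta> ^ Suc j * qnum \<theta> (Suc i) * (qbinom \<theta> n (Suc j) * (qfact \<theta> (Suc j) * qfact \<theta> (n - Suc j)))"
      by (simp add: j i qfact_Suc algebra_simps)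
    also have "\<dots> = (qnum \<theta> (Suc j) + \<theta> ^ Suc j * qnum \<theta> (Suc i)) * qfact \<theta> n"
      by (simp only: 1 2) (simp add: algebra_simps)
    also have "\<dots> = qfact \<theta> (Suc n)"
      by (simp only: qnum_add[symmetric] qfact_Suc) (simp add: i)
    finally show ?thesis .
  qed
qed

text \<open>The q-factorial of N contains the q-number of N, which is 0, while the factorials of k
  and N - k contain only nonzero q-numbers.\<close>

lemma qbinom_primitive_root:
  assumes "\<theta> ^ N = 1" "\<And>j. 0 < j \<Longrightarrow> j < N \<Longrightarrow> \<theta> ^ j \<noteq> 1" "0 < k" "k < N"
  shows "qbinom \<theta> N k = 0"
proof -
  have geo: "(\<theta> - 1) * qnum \<theta> j = \<theta> ^ j - 1" for j
    by (simp add: qnum_def power_diff_1_eq)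
  have nz: "qfact \<theta> j \<noteq> 0" if "j < N" for j
  proof -
    have "qnum \<theta> (Suc i) \<noteq> 0" if "i < j" for i
      using geo[of "Suc i"] assms(2)[of "Suc i"] that \<open>j < N\<close> by auto
    then show ?thesis by (simp add: qfact_def)
  qed
  obtain M where M: "N = Suc M" using assms(4) by (cases N) auto
  have "\<theta> \<noteq> 1" using assms(2)[of 1] assms(3,4) by auto
  then have "qfact \<theta> N = 0" using geo[of N] assms(1) M by (simp add: qfact_Suc)
  then show ?thesis using qbinom_fact[of k N \<theta>] nz[of k] nz[of "N - k"] assms(3,4) by simp
qed

text \<open>The q-binomial theorem modulo an ideal, because X and Y will be representatives in a
  free algebra that q-commute only up to relators.\<close>

lemma qbinomial:
  fixes X :: "'m::monoid_add \<Rightarrow>\<^sub>0 'k::field"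
  assumes J: "two_sided J'" and YX: "Y * X - scal \<theta> * (X * Y) \<in> J'"
  shows "(X + Y) ^ n - (\<Sum>k\<le>n. scal (qbinom \<theta> n k) * (X ^ k * Y ^ (n - k))) \<in> J'"
proof -
  interpret J: two_sided J' by (rule J)
  note sc = scal_left_commute
  have *: "J.cong (Y * X ^ k) (scal (\<theta> ^ k) * (X ^ k * Y))" for k
  proof (induction k)
    case (Suc k)
    have "Y * X ^ Suc k = (Y * X) * X ^ k" by (simp add: mult.assoc)
    also have "J.cong \<dots> ((scal \<theta> * (X * Y)) * X ^ k)"
      by (rule J.cong_mult) (use YX in \<open>simp_all add: J.cong_def\<close>)
    also have "(scal \<theta> * (X * Y)) * X ^ k = scal \<theta> * (X * (Y * X ^ k))" by (simp add: mult.assoc)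
    also have "J.cong \<dots> (scal \<theta> * (X * (scal (\<theta> ^ k) * (X ^ k * Y))))"
      by (intro J.cong_mult Suc) auto
    also have "scal \<theta> * (X * (scal (\<theta> ^ k) * (X ^ k * Y))) = scal (\<theta> ^ Suc k) * (X ^ Suc k * Y)"
      by (simp only: sc[of X] scal_mult power_Suc mult.assoc)
    finally show ?case .
  qed simp
  have "J.cong ((X + Y) ^ n) (\<Sum>k\<le>n. scal (qbinom \<theta> n k) * (X ^ k * Y ^ (n - k)))"
  proof (induction n)
    case (Suc n)
    let ?g = "qbinom \<theta> n"
    have "(X + Y) ^ Suc n = (X + Y) * (X + Y) ^ n" by simp
    also have "J.cong \<dots> ((X + Y) * (\<Sum>k\<le>n. scal (?g k) * (X ^ k * Y ^ (n - k))))"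
      by (intro J.cong_mult Suc) auto
    also have "\<dots> = (\<Sum>k\<le>n. scal (?g k) * (X ^ Suc k * Y ^ (n - k)))
        + (\<Sum>k\<le>n. scal (?g k) * ((Y * X ^ k) * Y ^ (n - k)))"
      by (simp only: distrib_right sum_distrib_left mult.assoc sc[of X] sc[of Y] power_Suc sum.distrib)
    also have "J.cong \<dots> ((\<Sum>k\<le>n. scal (?g k) * (X ^ Suc k * Y ^ (n - k)))
        + (\<Sum>k\<le>n. scal (?g k) * ((scal (\<theta> ^ k) * (X ^ k * Y)) * Y ^ (n - k))))"
      by (intro J.cong_add J.cong_sum J.cong_mult *) auto
    also have "(\<Sum>k\<le>n. scal (?g k) * ((scal (\<theta> ^ k) * (X ^ k * Y)) * Y ^ (n - k)))
        = (\<Sum>k\<le>n. scal (\<theta> ^ k * ?g k) * (X ^ k * Y ^ (Suc n - k)))"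
      by (intro sum.cong refl) (simp only: mult.commute[of "\<theta> ^ _"] scal_mult mult.assoc Suc_diff_le atMost_iff power_Suc)
    \<comment> \<open>The new summand k = n + 1 is zero; it is added so that splitting off k = 0
      leaves a sum over the same range as the X-part.\<close>
    also have "\<dots> = (\<Sum>k\<le>Suc n. scal (\<theta> ^ k * ?g k) * (X ^ k * Y ^ (Suc n - k)))"
      by (simp add: qbinom_eq_0)
    also have "\<dots> = Y ^ Suc n + (\<Sum>k\<le>n. scal (\<theta> ^ Suc k * ?g (Suc k)) * (X ^ Suc k * Y ^ (n - k)))"
      by (subst sum.atMost_Suc_shift) simp
    also have "(\<Sum>k\<le>n. scal (?g k) * (X ^ Suc k * Y ^ (n - k))) +
        (Y ^ Suc n + (\<Sum>k\<le>n. scal (\<theta> ^ Suc k * ?g (Suc k)) * (X ^ Suc k * Y ^ (n - k))))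
      = (\<Sum>k\<le>Suc n. scal (qbinom \<theta> (Suc n) k) * (X ^ k * Y ^ (Suc n - k)))"
      by (subst sum.atMost_Suc_shift) (simp add: scal_add distrib_right sum.distrib add_ac)
    finally show ?case .
  qed simp
  then show ?thesis by (simp add: J.cong_def)
qed

text \<open>This makes the relations on N-th powers of E, F, a, b, c, d compatible with the
  comultiplication: each of these coproducts is a sum of two tensors that q^2-commute, so only the
  two pure N-th powers survive.\<close>

lemma qbinomial_primitive_root:
  fixes X :: "'m::monoid_add \<Rightarrow>\<^sub>0 'k::field"
  assumes "two_sided J" "Y * X - scal \<theta> * (X * Y) \<in> J"
    and "\<theta> ^ N = 1" "\<And>j. 0 < j \<Longrightarrow> j < N \<Longrightarrow> \<theta> ^ j \<noteq> 1" "N > 0"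
  shows "(X + Y) ^ N - (X ^ N + Y ^ N) \<in> J"
proof -
  obtain M where M: "N = Suc M" using assms(5) by (cases N) auto
  have "(\<Sum>k\<le>N. scal (qbinom \<theta> N k) * (X ^ k * Y ^ (N - k)))
      = (\<Sum>k\<in>{0, N}. scal (qbinom \<theta> N k) * (X ^ k * Y ^ (N - k)))"
  proof (rule sum.mono_neutral_right)
    show "\<forall>i\<in>{..N} - {0, N}. scal (qbinom \<theta> N i) * (X ^ i * Y ^ (N - i)) = 0"
      using qbinom_primitive_root[OF assms(3,4)] by auto
  qed auto
  also have "\<dots> = X ^ N + Y ^ N" using assms(5) by (simp add: add.commute)
  finally show ?thesis using qbinomial[OF assms(1,2), of N] by simp
qed

section \<open>Tensors in the monoid algebra of pairs of words\<close>

lemma tens_single: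
  "tens (sgl v c) (sgl w d) = sgl (v, w) (c * d)"
  by (simp add: tens_def)

lemma tens_superset:
  assumes "finite S" "Poly_Mapping.keys p \<subseteq> S" "finite T" "Poly_Mapping.keys s \<subseteq> T"
  shows "tens p s = (\<Sum>v\<in>S. \<Sum>w\<in>T. sgl (v, w) (lk p v * lk s w))"
proof -
  have "tens p s = (\<Sum>v\<in>Poly_Mapping.keys p. \<Sum>w\<in>T. sgl (v, w) (lk p v * lk s w))"
    unfolding tens_def using assms
    by (intro sum.cong refl sum.mono_neutral_left) (auto simp: not_in_keys_iff_lookup_eq_zero)
  also have "\<dots> = (\<Sum>v\<in>S. \<Sum>w\<in>T. sgl (v, w) (lk p v * lk s w))"
    using assms by (intro sum.mono_neutral_left) (auto simp: not_in_keys_iff_lookup_eq_zero)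
  finally show ?thesis .
qed

lemma tens_add_left: "tens (p + p') s = tens p s + tens p' s"
proof -
  let ?S = "Poly_Mapping.keys p \<union> Poly_Mapping.keys p'"
  have "Poly_Mapping.keys (p + p') \<subseteq> ?S" by (rule keys_add)
  then show ?thesis
    by (subst (1 2 3) tens_superset[where S = ?S and T = "Poly_Mapping.keys s"])
      (auto simp: lookup_add distrib_right single_add sum.distrib)
qed

lemma tens_add_right: "tens s (p + p') = tens s p + tens s p'"
proof -
  let ?S = "Poly_Mapping.keys p \<union> Poly_Mapping.keys p'"
  have "Poly_Mapping.keys (p + p') \<subseteq> ?S" by (rule keys_add)
  then show ?thesis
    by (subst (1 2 3) tens_superset[where T = ?S and S = "Poly_Mapping.keys s"])
      (auto simp: lookup_add distrib_left single_add sum.distrib)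
qed

lemma tens_0_left [simp]: "tens 0 s = 0" and tens_0_right [simp]: "tens s 0 = 0"
  by (simp_all add: tens_def)

lemma tens_uminus_left: "tens (- p) s = - tens p s" and tens_uminus_right: "tens s (- p) = - tens s p"
  using tens_add_left[of p "- p" s] tens_add_right[of s p "- p"]
  by (simp_all add: eq_neg_iff_add_eq_0 add.commute)

lemma tens_diff_left: "tens (p - p') s = tens p s - tens p' s"
  and tens_diff_right: "tens s (p - p') = tens s p - tens s p'"
  using tens_add_left[of p "- p'" s] tens_add_right[of s p "- p'"]
  by (simp_all add: tens_uminus_left tens_uminus_right)

lemma tens_scal_left: "tens (scal c * p) s = scal c * tens p s"
proof (rule additive_eqI[where f = "\<lambda>p. tens (scal c * p) s"])
  fix v d
  show "tens (scal c * sgl v d) s = scal c * tens (sgl v d) s"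
    by (rule additive_eqI[where f = "\<lambda>s. tens (scal c * sgl v d) s"])
      (simp_all add: tens_add_right algebra_simps scal_mult_single tens_single)
qed (simp_all add: tens_add_left algebra_simps)

lemma tens_scal_right: "tens p (scal c * s) = scal c * tens p s"
proof (rule additive_eqI[where f = "\<lambda>p. tens p (scal c * s)"])
  fix v d
  show "tens (sgl v d) (scal c * s) = scal c * tens (sgl v d) s"
    by (rule additive_eqI[where f = "\<lambda>s. tens (sgl v d) (scal c * s)"])
      (simp_all add: tens_add_right algebra_simps scal_mult_single tens_single)
qed (simp_all add: tens_add_left algebra_simps)

lemma tens_induct [case_names add tens]:
  assumes "\<And>x y. P x \<Longrightarrow> P y \<Longrightarrow> P (x + y)" "\<And>p s. P (tens p s)"
  shows "P t"
proof -
  have s: "P (sgl m c)" for m c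
    using assms(2)[of "sgl (fst m) c" "sgl (snd m) 1"] by (simp add: tens_single)
  have "P (\<Sum>m\<in>S. sgl m (lk t m))" if "finite S" for S
    using that
  proof induction
    case empty
    then show ?case using assms(2)[of 0 0] by simp
  qed (simp add: s assms)
  then show ?thesis using poly_mapping_sum_single[of t] by (metis finite_keys)
qed

lemma tens_eqI:
  assumes "\<And>t t'. f (t + t') = f t + f t'" "\<And>t t'. g (t + t') = g t + g t'"
    and "\<And>p s. f (tens p s) = g (tens p s)"
  shows "f t = g t"
  by (induction t rule: tens_induct) (simp_all add: assms)

lemma tens_mult: "tens p s * tens p' s' = tens (p * p') (s * s')"
proof -
  have 1: "tens (sgl v c) (sgl w d) * tens (sgl v' c') (sgl w' d')
      = tens (sgl v c * sgl v' c') (sgl w d * sgl w' d')" for v c w d v' c' w' d'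
    by (simp add: tens_single mult_single mult_ac)
  have 2: "tens p s * tens (sgl v' c') (sgl w' d') = tens (p * sgl v' c') (s * sgl w' d')" for v' c' w' d' p s
  proof (rule additive_eqI[where f = "\<lambda>p. tens p s * tens (sgl v' c') (sgl w' d')"])
    fix v c
    show "tens (sgl v c) s * tens (sgl v' c') (sgl w' d') = tens (sgl v c * sgl v' c') (s * sgl w' d')"
      by (rule additive_eqI[where f = "\<lambda>s. tens (sgl v c) s * tens (sgl v' c') (sgl w' d')"])
        (simp_all add: tens_add_right distrib_right 1)
  qed (simp_all add: tens_add_left distrib_right)
  show ?thesis
  proof (rule additive_eqI[where f = "\<lambda>p'. tens p s * tens p' s'"])
    fix v c
    show "tens p s * tens (sgl v c) s' = tens (p * sgl v c) (s * s')"
      by (rule additive_eqI[where f = "\<lambda>s'. tens p s * tens (sgl v c) s'"])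
        (simp_all add: tens_add_right distrib_left 2)
  qed (simp_all add: tens_add_left distrib_left)
qed

lemma tens_one [simp]: "tens 1 1 = 1"
proof -
  have "tens (sgl 0 1) (sgl 0 1) = sgl (0, 0) (1 * 1)" by (rule tens_single)
  then show ?thesis by (simp add: zero_prod_def[symmetric])
qed

lemma tens_power: "tens p s ^ n = tens (p ^ n) (s ^ n)"
  by (induction n) (simp_all add: tens_mult)

section \<open>Comultiplication and counit on representatives\<close>

definition cop :: "('x, 'k::field) bialg_pres \<Rightarrow> ('x, 'k) free_alg \<Rightarrow> ('x, 'k) free_alg2" where
  "cop P = lin_ext (\<lambda>c t. scal c * t) (\<lambda>w. prod_list (map (comult_gen P) (letters w)))"

definition ceps :: "('x, 'k::field) bialg_pres \<Rightarrow> ('x, 'k) free_alg \<Rightarrow> 'k" where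
  "ceps P = lin_ext (*) (\<lambda>w. prod_list (map (counit_gen P) (letters w)))"

lemma cop_add: "cop P (p + p') = cop P p + cop P p'"
  and cop_diff: "cop P (p - p') = cop P p - cop P p'"
  by (simp_all add: cop_def alg_mod.lin_ext_add alg_mod.lin_ext_diff)

lemma cop_mult: "cop P (p * p') = cop P p * cop P p'"
  unfolding cop_def
proof (rule alg_mod.lin_ext_mult)
  show "scal c * x * (scal d * y) = scal (c * d) * (x * y)" for c d and x y :: "('x, 'k::field) free_alg2"
    by (simp only: mult.assoc scal_left_commute[of x] scal_mult)
qed (simp_all add: distrib_left distrib_right plus_word_def)

lemma cop_scal: "cop P (scal c) = scal c"
  by (simp add: cop_def scal_def zero_word_def alg_mod.lin_ext_single[unfolded scal_def])

lemma cop_gen: "cop P (gen x) = comult_gen P x"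
  by (simp add: cop_def gen_def)

lemma cop_one: "cop P 1 = 1"
  using cop_scal[of P 1] by simp

lemma cop_power: "cop P (p ^ n) = cop P p ^ n"
  by (induction n) (simp_all add: cop_one cop_mult)

lemmas cop_simps = cop_add cop_diff cop_mult cop_scal cop_gen cop_one cop_power

lemma ceps_add: "ceps P (p + p') = ceps P p + ceps P p'"
  and ceps_diff: "ceps P (p - p') = ceps P p - ceps P p'"
  by (simp_all add: ceps_def vector_space_over_itself.lin_ext_add vector_space_over_itself.lin_ext_diff)

lemma ceps_mult: "ceps P (p * p') = ceps P p * ceps P p'"
  unfolding ceps_def
  by (rule vector_space_over_itself.lin_ext_mult) (simp_all add: distrib_left distrib_right mult_ac plus_word_def)

lemma ceps_scal: "ceps P (scal c) = c"
  by (simp add: ceps_def scal_def zero_word_def)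

lemma ceps_gen: "ceps P (gen x) = counit_gen P x"
  by (simp add: ceps_def gen_def)

lemma ceps_one: "ceps P 1 = 1"
  using ceps_scal[of P 1] by simp

lemma ceps_power: "ceps P (p ^ n) = ceps P p ^ n"
  by (induction n) (simp_all add: ceps_one ceps_mult)

lemmas ceps_simps = ceps_add ceps_diff ceps_mult ceps_scal ceps_gen ceps_one ceps_power

lemma comult_quot_class:
  assumes "\<And>r. r \<in> relators P \<Longrightarrow> cop P r \<in> rel_ideal (tensor_relators P)"
  shows "comult P (quot_class (relators P) p) = quot_class (tensor_relators P) (cop P p)"
proof -
  have "rel_ideal (relators P) \<subseteq> {p. cop P p \<in> rel_ideal (tensor_relators P)}"
    using assms by (intro rel_ideal_minimal two_sided_vimage two_sided_rel_ideal) (auto simp: cop_simps)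
  then show ?thesis
    unfolding comult_def cop_def[symmetric]
    by (intro the_elem_image_quot_class) (auto simp: quot_class_eq_iff simp flip: cop_diff)
qed

lemma two_sided_zero: "two_sided {0::'a::ring_1}"
  by unfold_locales auto

lemma counit_quot_class:
  assumes "\<And>r. r \<in> relators P \<Longrightarrow> ceps P r = 0"
  shows "counit P (quot_class (relators P) p) = ceps P p"
proof -
  have "rel_ideal (relators P) \<subseteq> {p. ceps P p \<in> {0}}"
    using assms by (intro rel_ideal_minimal two_sided_vimage two_sided_zero) (auto simp: ceps_simps)
  then show ?thesis
    unfolding counit_def ceps_def[symmetric]
    by (intro the_elem_image_quot_class_hom) (auto simp: ceps_diff)
qed

text \<open>The tensor relators are only those with a 1 in the other factor. The elements p with p
  \<otimes> 1 in the ideal form a two-sided ideal containing the relators, and multiplying by 1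
  \<otimes> s then gives p \<otimes> s; likewise on the other side.\<close>

lemma tens_rel_ideal:
  assumes "p \<in> rel_ideal (relators P)"
  shows "tens p s \<in> rel_ideal (tensor_relators P)" "tens s p \<in> rel_ideal (tensor_relators P)"
proof -
  interpret J: two_sided "rel_ideal (tensor_relators P)" by (rule two_sided_rel_ideal)
  have "rel_ideal (relators P) \<subseteq> {p. tens p 1 \<in> rel_ideal (tensor_relators P)}"
    by (intro rel_ideal_minimal two_sided_vimage two_sided_rel_ideal)
      (auto simp: tens_add_left tens_mult tensor_relators_def intro: rel_ideal_incl)
  then have "tens p 1 * tens 1 s \<in> rel_ideal (tensor_relators P)" using assms by auto
  then show "tens p s \<in> rel_ideal (tensor_relators P)" by (simp add: tens_mult)
  have "rel_ideal (relators P) \<subseteq> {p. tens 1 p \<in> rel_ideal (tensor_relators P)}"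
    by (intro rel_ideal_minimal two_sided_vimage two_sided_rel_ideal)
      (auto simp: tens_add_right tens_mult tensor_relators_def intro: rel_ideal_incl)
  then have "tens 1 p * tens s 1 \<in> rel_ideal (tensor_relators P)" using assms by auto
  then show "tens s p \<in> rel_ideal (tensor_relators P)" by (simp add: tens_mult)
qed

text \<open>Unlike membership in \<open>dual\<close>, this says nothing about values off the
  carrier. It is therefore stable under composition with left and right multiplication, and it also
  covers evaluation at a fixed element of the other algebra.\<close>

definition lin_fun :: "('x, 'k::field) bialg_pres \<Rightarrow> (('x, 'k) free_alg set \<Rightarrow> 'k) \<Rightarrow> bool" where
  "lin_fun P g \<longleftrightarrow>
    (\<forall>p p'. g (quot_class (relators P) (p + p')) = g (quot_class (relators P) p) + g (quot_class (relators P) p')) \<and>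
    (\<forall>c p. g (quot_class (relators P) (scal c * p)) = c * g (quot_class (relators P) p))"

lemma lin_funD:
  assumes "lin_fun P g"
  shows "g (quot_class (relators P) (p + p')) = g (quot_class (relators P) p) + g (quot_class (relators P) p')"
    and "g (quot_class (relators P) (scal c * p)) = c * g (quot_class (relators P) p)"
    and "g (quot_class (relators P) 0) = 0"
  using assms by (auto simp: lin_fun_def) (metis mult_zero_left scal_0)

lemma mult_alg: "quot_class (relators P) p \<otimes>\<^bsub>alg P\<^esub> quot_class (relators P) p' = quot_class (relators P) (p * p')"
  by (simp add: alg_def mult_quot_alg)

lemma lin_fun_lmult:
  "lin_fun P g \<Longrightarrow> lin_fun P (\<lambda>X. g (quot_class (relators P) z \<otimes>\<^bsub>alg P\<^esub> X))"
  by (simp add: lin_fun_def mult_alg distrib_left scal_left_commute[of z])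

lemma lin_fun_rmult:
  "lin_fun P g \<Longrightarrow> lin_fun P (\<lambda>X. g (X \<otimes>\<^bsub>alg P\<^esub> quot_class (relators P) z))"
  by (auto simp: lin_fun_def mult_alg distrib_right mult.assoc)

section \<open>The maps g \<otimes> id and g \<otimes> h on representatives\<close>

definition slice :: "('x, 'k::field) bialg_pres \<Rightarrow> (('x, 'k) free_alg set \<Rightarrow> 'k) \<Rightarrow>
    ('x, 'k) free_alg2 \<Rightarrow> ('x, 'k) free_alg" where
  "slice P g = lin_ext (\<lambda>c p. scal c * p) (\<lambda>(v, w). sgl w (g (word_class P v)))"

definition bil :: "('x, 'k::field) bialg_pres \<Rightarrow> (('x, 'k) free_alg set \<Rightarrow> 'k) \<Rightarrow>
    (('x, 'k) free_alg set \<Rightarrow> 'k) \<Rightarrow> ('x, 'k) free_alg2 \<Rightarrow> 'k" where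
  "bil P g h = lin_ext (*) (\<lambda>(v, w). g (word_class P v) * h (word_class P w))"

lemma slice_add: "slice P g (t + t') = slice P g t + slice P g t'"
  and slice_diff: "slice P g (t - t') = slice P g t - slice P g t'"
  by (simp_all add: slice_def alg_mod.lin_ext_add alg_mod.lin_ext_diff)

lemma bil_add: "bil P g h (t + t') = bil P g h t + bil P g h t'"
  and bil_diff: "bil P g h (t - t') = bil P g h t - bil P g h t'"
  by (simp_all add: bil_def vector_space_over_itself.lin_ext_add vector_space_over_itself.lin_ext_diff)

lemma slice_single: "slice P g (sgl (v, w) c) = sgl w (c * g (word_class P v))"
  by (simp add: slice_def scal_mult_single)

lemma slice_tens:
  assumes "lin_fun P g"
  shows "slice P g (tens p s) = scal (g (quot_class (relators P) p)) * s"
proof (rule additive_eqI[where f = "\<lambda>p. slice P g (tens p s)"])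
  fix v c
  have 1: "g (quot_class (relators P) (sgl v c)) = c * g (word_class P v)"
    using lin_funD(2)[OF assms, of c "sgl v 1"] by (simp add: scal_mult_single word_class_def)
  show "slice P g (tens (sgl v c) s) = scal (g (quot_class (relators P) (sgl v c))) * s"
    by (rule additive_eqI[where f = "\<lambda>s. slice P g (tens (sgl v c) s)"])
      (simp_all add: tens_add_right slice_add distrib_left tens_single slice_single 1
        scal_mult_single mult_ac)
qed (simp_all add: tens_add_left slice_add lin_funD[OF assms] scal_add distrib_right)

lemma bil_slice:
  assumes "lin_fun P g" "lin_fun P h"
  shows "bil P g h t = h (quot_class (relators P) (slice P g t))"
proof (rule additive_eqI[where f = "bil P g h"])
  fix m c
  show "bil P g h (sgl m c) = h (quot_class (relators P) (slice P g (sgl m c)))"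
    using lin_funD(2)[OF assms(2), of "c * g (word_class P (fst m))" "sgl (snd m) 1"]
    by (simp add: bil_def slice_def split_beta scal_mult_single word_class_def mult_ac)
qed (simp_all add: bil_add slice_add lin_funD[OF assms(2)])

lemma bil_tens:
  assumes "lin_fun P g" "lin_fun P h"
  shows "bil P g h (tens p s) = g (quot_class (relators P) p) * h (quot_class (relators P) s)"
  by (simp add: bil_slice[OF assms] slice_tens[OF assms(1)] lin_funD[OF assms(2)])

text \<open>Multiplication by p \<otimes> s acts on the second leg by s and replaces g by its
  translate by p. Translates of this kind drive both the descent to the quotient and the recursion
  along words.\<close>

lemma slice_lmult:
  assumes "lin_fun P g"
  shows "slice P g (tens p s * t) = s * slice P (\<lambda>X. g (quot_class (relators P) p \<otimes>\<^bsub>alg P\<^esub> X)) t"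
proof (induction t rule: tens_induct)
  case (tens p' s')
  show ?case
    by (simp add: tens_mult slice_tens[OF assms] slice_tens[OF lin_fun_lmult[OF assms]] mult_alg
        scal_left_commute[of s])
qed (simp add: slice_add distrib_left)

lemma slice_rmult:
  assumes "lin_fun P g"
  shows "slice P g (t * tens p s) = slice P (\<lambda>X. g (X \<otimes>\<^bsub>alg P\<^esub> quot_class (relators P) p)) t * s"
proof (induction t rule: tens_induct)
  case (tens p' s')
  show ?case
    by (simp add: tens_mult slice_tens[OF assms] slice_tens[OF lin_fun_rmult[OF assms]] mult.assoc
        mult_alg)
qed (simp add: slice_add distrib_right)

lemma bil_lmult:
  assumes "lin_fun P g" "lin_fun P h"
  shows "bil P g h (tens p s * t) = bil P (\<lambda>X. g (quot_class (relators P) p \<otimes>\<^bsub>alg P\<^esub> X))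
    (\<lambda>X. h (quot_class (relators P) s \<otimes>\<^bsub>alg P\<^esub> X)) t"
  by (simp add: bil_slice[OF assms] bil_slice[OF lin_fun_lmult[OF assms(1)] lin_fun_lmult[OF assms(2)]]
      slice_lmult[OF assms(1)] mult_alg)

lemma slice_rel_ideal:
  assumes "t \<in> rel_ideal (tensor_relators P)" "lin_fun P g"
  shows "slice P g t \<in> rel_ideal (relators P)"
proof -
  interpret I: two_sided "rel_ideal (relators P)" by (rule two_sided_rel_ideal)
  \<comment> \<open>The quantifier over all functionals is essential: multiplying by p \<otimes> s
    replaces g by a translate, so for a single g the set would not be seen to be an ideal.\<close>
  let ?S = "{t. \<forall>g. lin_fun P g \<longrightarrow> slice P g t \<in> rel_ideal (relators P)}"
  have "two_sided ?S"
  proof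
    show "0 \<in> ?S" by (simp add: slice_def)
    show "x + y \<in> ?S" if "x \<in> ?S" "y \<in> ?S" for x y using that by (auto simp: slice_add)
    show "z * x \<in> ?S" if x: "x \<in> ?S" for x z
    proof (induction z rule: tens_induct)
      case (tens p s)
      show ?case
      proof (intro CollectI allI impI)
        fix g assume g: "lin_fun P g"
        then show "slice P g (tens p s * x) \<in> rel_ideal (relators P)"
          unfolding slice_lmult[OF g] using x by (intro I.lmult_mem) (simp add: lin_fun_lmult)
      qed
    qed (auto simp: distrib_right slice_add)
    show "x * z \<in> ?S" if x: "x \<in> ?S" for x z
    proof (induction z rule: tens_induct)
      case (tens p s)
      show ?case
      proof (intro CollectI allI impI)
        fix g assume g: "lin_fun P g"
        then show "slice P g (x * tens p s) \<in> rel_ideal (relators P)"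
          unfolding slice_rmult[OF g] using x by (intro I.rmult_mem) (simp add: lin_fun_rmult)
      qed
    qed (auto simp: distrib_left slice_add)
  qed
  moreover have "tensor_relators P \<subseteq> ?S"
  proof
    fix t assume "t \<in> tensor_relators P"
    then obtain r where r: "r \<in> relators P" "t = tens r 1 \<or> t = tens 1 r"
      by (auto simp: tensor_relators_def)
    have "quot_class (relators P) r = quot_class (relators P) 0"
      using r by (simp add: quot_class_eq_iff rel_ideal_incl)
    then show "t \<in> ?S" using r by (auto simp: slice_tens lin_funD(3) intro!: I.lmult_mem intro: rel_ideal_incl)
  qed
  ultimately have "rel_ideal (tensor_relators P) \<subseteq> ?S" by (rule rel_ideal_minimal)
  then show ?thesis using assms by blast
qed

lemma apply_left_quot_class:
  assumes "lin_fun P g"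
  shows "apply_left P g (quot_class (tensor_relators P) t) = quot_class (relators P) (slice P g t)"
  unfolding apply_left_def slice_def[symmetric]
  by (rule the_elem_image_quot_class)
    (simp add: quot_class_eq_iff slice_rel_ideal[OF _ assms] flip: slice_diff)

lemma apply_both_quot_class:
  assumes "lin_fun P g" "lin_fun P h"
  shows "apply_both P g h (quot_class (tensor_relators P) t) = bil P g h t"
  unfolding apply_both_def bil_def[symmetric]
proof (rule the_elem_image_quot_class_hom)
  fix x assume "x \<in> rel_ideal (tensor_relators P)"
  then have "slice P g x \<in> rel_ideal (relators P)" by (rule slice_rel_ideal[OF _ assms(1)])
  then have "quot_class (relators P) (slice P g x) = quot_class (relators P) 0"
    by (simp add: quot_class_eq_iff)
  then show "bil P g h x = 0" by (simp add: bil_slice[OF assms] lin_funD[OF assms(2)])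
qed (rule bil_diff)

section \<open>Skew derivations\<close>

lemma power_eq_iff_cong:
  fixes \<omega> :: "'k::field"
  assumes "\<omega> ^ N = 1" "\<And>m. 0 < m \<Longrightarrow> m < N \<Longrightarrow> \<omega> ^ m \<noteq> 1" "N > 0"
  shows "\<omega> ^ i = 1 \<longleftrightarrow> N dvd i"
proof
  have "\<omega> ^ i = \<omega> ^ (i mod N)"
    using assms(1) by (metis div_mult_mod_eq mult_1 mult.commute power_add power_mult power_one)
  moreover assume "\<omega> ^ i = 1"
  ultimately have "i mod N = 0"
    using assms(2)[of "i mod N"] assms(3) by (metis bot_nat_0.not_eq_extremum mod_less_divisor)
  then show "N dvd i" by auto
qed (use assms(1) in \<open>auto simp: power_mult\<close>)

lemma qnum_0 [simp]: "qnum \<theta> 0 = 0" by (simp add: qnum_def)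

lemma qnum_Suc: "qnum \<theta> (Suc j) = \<theta> * qnum \<theta> j + 1"
  unfolding qnum_def by (subst sum.lessThan_Suc_shift) (simp add: sum_distrib_left add.commute)

lemma qnum_mult: "(\<theta> - 1) * qnum \<theta> j = \<theta> ^ j - 1"
  by (simp add: qnum_def power_diff_1_eq)

lemma qnum_eq_0_iff: "\<theta> \<noteq> 1 \<Longrightarrow> qnum \<theta> j = 0 \<longleftrightarrow> \<theta> ^ j = 1"
  using qnum_mult[of \<theta> j] by auto

text \<open>The abstract form of the action of a group-like element K and of an element with
  coproduct u \<otimes> K + 1 \<otimes> u, acting as D.\<close>

locale skew_der = vector_space sc
  for sc :: "'k::field \<Rightarrow> 'c::ring_1 \<Rightarrow> 'c" (infixr \<open>\<cdot>\<close> 75) +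
  fixes K D :: "'c \<Rightarrow> 'c"
  assumes sc_mult_left: "(c \<cdot> x) * y = c \<cdot> (x * y)"
    and sc_mult_right: "x * (c \<cdot> y) = c \<cdot> (x * y)"
    and K_add: "K (f + g) = K f + K g" and K_sc: "K (c \<cdot> f) = c \<cdot> K f"
    and K_one [simp]: "K 1 = 1" and K_mult: "K (f * g) = K f * K g"
    and D_add: "D (f + g) = D f + D g" and D_sc: "D (c \<cdot> f) = c \<cdot> D f"
    and D_mult: "D (f * g) = D f * K g + f * D g"
begin

lemmas sc_simps = sc_mult_left sc_mult_right scale_scale mult.assoc

inductive_set gen_alg :: "'c set \<Rightarrow> 'c set" for S :: "'c set" where
  one [intro, simp]: "1 \<in> gen_alg S"
| incl: "y \<in> S \<Longrightarrow> y \<in> gen_alg S"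
| scale [intro]: "y \<in> gen_alg S \<Longrightarrow> c \<cdot> y \<in> gen_alg S"
| add [intro]: "y \<in> gen_alg S \<Longrightarrow> z \<in> gen_alg S \<Longrightarrow> y + z \<in> gen_alg S"
| mult [intro]: "y \<in> gen_alg S \<Longrightarrow> z \<in> gen_alg S \<Longrightarrow> y * z \<in> gen_alg S"

lemma gen_alg_0 [simp, intro]: "0 \<in> gen_alg S"
  using gen_alg.scale[OF gen_alg.one, of 0] by simp

lemma gen_alg_power [intro]: "y \<in> gen_alg S \<Longrightarrow> y ^ n \<in> gen_alg S"
  by (induction n) auto

lemma gen_alg_diff [intro]: "y \<in> gen_alg S \<Longrightarrow> z \<in> gen_alg S \<Longrightarrow> y - z \<in> gen_alg S"
  using gen_alg.add[OF _ gen_alg.scale, of y S z "-1"] by (simp add: scale_minus_left)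

lemma gen_alg_mono: "S \<subseteq> gen_alg S' \<Longrightarrow> gen_alg S \<subseteq> gen_alg S'"
proof
  fix y assume "S \<subseteq> gen_alg S'" "y \<in> gen_alg S"
  from this(2,1) show "y \<in> gen_alg S'" by induction auto
qed

text \<open>The elements y with y V contained in V form a subalgebra, so stability under left
  multiplication by generators suffices; applying y to 1 gives y itself. All spanning statements
  below use this.\<close>

lemma gen_alg_left_closed:
  assumes "y \<in> gen_alg S" "\<And>u v. u \<in> S \<Longrightarrow> v \<in> V \<Longrightarrow> u * v \<in> V"
    and "\<And>c v. v \<in> V \<Longrightarrow> c \<cdot> v \<in> V" "\<And>u v. u \<in> V \<Longrightarrow> v \<in> V \<Longrightarrow> u + v \<in> V" "1 \<in> V"
  shows "y \<in> V"
proof -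
  from assms(1) have "v \<in> V \<Longrightarrow> y * v \<in> V" for v
    by (induction arbitrary: v) (auto simp: assms sc_simps distrib_right)
  then show ?thesis using assms(5) by force
qed

lemma gen_alg_span: "span X \<subseteq> gen_alg S" if "X \<subseteq> gen_alg S"
  using that by (intro span_minimal) (auto simp: subspace_def)

lemma D_one [simp]: "D 1 = 0" using D_mult[of 1 1] by simp
lemma D_0 [simp]: "D 0 = 0" using D_add[of 0 0] by simp
lemma K_0 [simp]: "K 0 = 0" using K_add[of 0 0] by simp

lemma qcomm_power:
  assumes "t * y = c \<cdot> (y * t)"
  shows "t ^ i * y ^ k = (c ^ (i * k)) \<cdot> (y ^ k * t ^ i)"
proof -
  have *: "t * y ^ k = (c ^ k) \<cdot> (y ^ k * t)" for k
  proof (induction k)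
    case (Suc k)
    have "t * y ^ Suc k = (t * y) * y ^ k" by (simp add: mult.assoc)
    also have "\<dots> = c \<cdot> (y * (t * y ^ k))" by (simp add: assms sc_simps)
    finally show ?case by (simp add: Suc sc_simps)
  qed simp
  show ?thesis
  proof (induction i)
    case (Suc i)
    have "t ^ Suc i * y ^ k = t * (t ^ i * y ^ k)" by (simp add: mult.assoc)
    also have "\<dots> = (c ^ (i * k)) \<cdot> ((t * y ^ k) * t ^ i)" by (simp add: Suc sc_simps)
    finally show ?case by (simp add: * sc_simps power_add mult.commute)
  qed simp
qed

text \<open>The scalar is a power of c; only that it is nonzero matters, since it gets absorbed into
  spanning coefficients.\<close>

lemma qcomm_mult_power:
  assumes "t * y = c \<cdot> (y * t)" "c \<noteq> 0"
  shows "\<exists>u. u \<noteq> 0 \<and> (y * t) ^ k = u \<cdot> (y ^ k * t ^ k)"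
proof (induction k)
  case 0
  show ?case by (rule exI[of _ 1]) simp
next
  case (Suc k)
  then obtain u where u: "u \<noteq> 0" "(y * t) ^ k = u \<cdot> (y ^ k * t ^ k)" by blast
  have "(y * t) ^ Suc k = u \<cdot> (y * ((t ^ 1 * y ^ k) * t ^ k))" by (simp add: u sc_simps)
  also have "\<dots> = (u * c ^ k) \<cdot> (y ^ Suc k * t ^ Suc k)"
    by (simp only: qcomm_power[OF assms(1)]) (simp add: sc_simps)
  finally show ?case using u assms(2) by (intro exI[of _ "u * c ^ k"]) simp
qed

lemma K_power: "K (f ^ n) = K f ^ n"
  by (induction n) (simp_all add: K_mult)

lemma sc_power: "(c \<cdot> f) ^ n = (c ^ n) \<cdot> f ^ n"
  by (induction n) (simp_all add: sc_simps)

lemma funpow_K: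
  "(K ^^ r) (f + g) = (K ^^ r) f + (K ^^ r) g" "(K ^^ r) (c \<cdot> f) = c \<cdot> (K ^^ r) f"
  "(K ^^ r) (f * g) = (K ^^ r) f * (K ^^ r) g" "(K ^^ r) 1 = 1"
  by (induction r) (simp_all add: K_add K_sc K_mult)

lemma funpow_K_eigen: "K v = \<xi> \<cdot> v \<Longrightarrow> (K ^^ r) v = (\<xi> ^ r) \<cdot> v"
  by (induction r) (simp_all add: K_sc mult.commute)

lemma gen_alg_fixed:
  assumes "f \<in> gen_alg S" "\<And>u. u \<in> S \<Longrightarrow> (K ^^ r) u = u"
  shows "(K ^^ r) f = f"
  using assms by induction (auto simp: funpow_K)

lemma gen_alg_killed:
  assumes "f \<in> gen_alg S" "\<And>u. u \<in> S \<Longrightarrow> D u = 0"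
  shows "D f = 0"
  using assms by induction (auto simp: D_add D_sc D_mult)

text \<open>With D from u, the coproduct of u + \<alpha> K is (u + \<alpha> K) \<otimes> K + 1
  \<otimes> u, so u + \<alpha> K generates a right coideal subalgebra. This is why products of
  invariants are invariant: the condition on y is used first, then the one on z.\<close>

lemma gen_alg_twisted:
  assumes "f \<in> gen_alg S" "\<And>u. u \<in> S \<Longrightarrow> D u + \<alpha> \<cdot> K u = \<alpha> \<cdot> u"
  shows "D f + \<alpha> \<cdot> K f = \<alpha> \<cdot> f"
  using assms
proof induction
  case (mult y z)
  then have y: "D y + \<alpha> \<cdot> K y = \<alpha> \<cdot> y" and z: "D z + \<alpha> \<cdot> K z = \<alpha> \<cdot> z" by auto
  have "D (y * z) + \<alpha> \<cdot> K (y * z) = (D y + \<alpha> \<cdot> K y) * K z + y * D z"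
    by (simp add: D_mult K_mult sc_simps distrib_right)
  also have "\<dots> = y * (D z + \<alpha> \<cdot> K z)" by (simp add: y sc_simps distrib_left)
  finally show ?case by (simp add: z sc_simps)
next
  case (scale y c)
  then have "c \<cdot> (D y + \<alpha> \<cdot> K y) = c \<cdot> \<alpha> \<cdot> y" by auto
  then show ?case by (simp add: D_sc K_sc scale_right_distrib mult.commute)
next
  case (add y z)
  then have y: "D y + \<alpha> \<cdot> K y = \<alpha> \<cdot> y" and z: "D z + \<alpha> \<cdot> K z = \<alpha> \<cdot> z" by auto
  have "D (y + z) + \<alpha> \<cdot> K (y + z) = (D y + \<alpha> \<cdot> K y) + (D z + \<alpha> \<cdot> K z)"
    by (simp add: D_add K_add scale_right_distrib)
  then show ?case by (simp add: y z scale_right_distrib)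
qed auto

text \<open>Averaging over the powers of \<open>K\<^sup>r\<close> kills every eigenvector that is not fixed.\<close>

lemma span_eigen_fixed:
  assumes X: "\<And>v. v \<in> X \<Longrightarrow> \<exists>\<xi>. K v = \<xi> \<cdot> v \<and> \<xi> ^ (n * r) = 1"
    and n: "of_nat n \<noteq> (0::'k)" and f: "f \<in> span X" "(K ^^ r) f = f"
  shows "f \<in> span {v \<in> X. (K ^^ r) v = v}"
proof -
  let ?Y = "span {v \<in> X. (K ^^ r) v = v}"
  define P where "P g = (\<Sum>i<n. ((K ^^ r) ^^ i) g)" for g
  have it: "((K ^^ r) ^^ i) g = (K ^^ (r * i)) g" for i g
    by (simp add: funpow_mult)
  have P_add: "P (g + h) = P g + P h" and P_sc: "P (c \<cdot> g) = c \<cdot> P g" for g h c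
    by (simp_all add: P_def it funpow_K sum.distrib scale_sum_right)
  have Pv: "P v \<in> ?Y" if v: "v \<in> X" for v
  proof -
    from X[OF v] obtain \<xi> where \<xi>: "K v = \<xi> \<cdot> v" "\<xi> ^ (n * r) = 1" by blast
    have "P v = qnum (\<xi> ^ r) n \<cdot> v"
      by (simp add: P_def it funpow_K_eigen[OF \<xi>(1)] qnum_def scale_sum_left power_mult)
    moreover have "qnum (\<xi> ^ r) n = 0" if "\<xi> ^ r \<noteq> 1"
      using qnum_eq_0_iff[OF that, of n] \<xi>(2) by (simp add: mult.commute flip: power_mult)
    moreover have "v \<in> ?Y" if "\<xi> ^ r = 1"
      using v that by (intro span_base) (simp add: funpow_K_eigen[OF \<xi>(1)])
    ultimately show ?thesis by (metis scale_zero_left span_zero span_scale)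
  qed
  have "P f \<in> ?Y" using f(1)
  proof (induction rule: span_induct_alt)
    case base
    then show ?case using P_sc[of 0 0] by (simp add: span_zero)
  next
    case (step c v g)
    then show ?case by (simp add: P_add P_sc Pv span_add span_scale)
  qed
  moreover have "P f = of_nat n \<cdot> f"
  proof -
    have "((K ^^ r) ^^ i) f = f" for i by (induction i) (simp_all add: f)
    then have "P f = (\<Sum>i<n. 1 \<cdot> f)" by (simp add: P_def)
    then show ?thesis by (simp only: flip: scale_sum_left) simp
  qed
  ultimately have "inverse (of_nat n) \<cdot> (of_nat n \<cdot> f) \<in> ?Y" by (metis span_scale)
  then show ?thesis using n by simp
qed

text \<open>Two scalars combine into the base of the q-number: \<kappa> from K acting on the right
  factor in the skew Leibniz rule, \<theta> from moving y to the right of z.\<close>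

lemma D_power:
  assumes "D z = y" "K z = \<kappa> \<cdot> z" "y * z = \<theta> \<cdot> (z * y)"
  shows "D (z ^ Suc k) = qnum (\<kappa> * \<theta>) (Suc k) \<cdot> (z ^ k * y)"
proof (induction k)
  case (Suc k)
  have "D (z ^ Suc (Suc k)) = D (z ^ Suc k) * K z + z ^ Suc k * D z"
    by (simp only: power_Suc2[of z "Suc k"] D_mult)
  also have "D (z ^ Suc k) * K z = (qnum (\<kappa> * \<theta>) (Suc k) * \<kappa>) \<cdot> (z ^ k * (y * z))"
    by (subst Suc, subst assms(2)) (simp add: sc_simps)
  also have "\<dots> = (qnum (\<kappa> * \<theta>) (Suc k) * \<kappa> * \<theta>) \<cdot> (z ^ Suc k * y)"
    by (subst assms(3)) (simp add: sc_simps power_Suc2 del: power_Suc)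
  also have "\<dots> + z ^ Suc k * D z = (qnum (\<kappa> * \<theta>) (Suc k) * \<kappa> * \<theta> + 1) \<cdot> (z ^ Suc k * y)"
    by (simp add: scale_left_distrib assms)
  also have "qnum (\<kappa> * \<theta>) (Suc k) * \<kappa> * \<theta> + 1 = qnum (\<kappa> * \<theta>) (Suc (Suc k))"
    by (simp add: qnum_Suc[of _ "Suc k"] mult_ac)
  finally show ?case .
qed (simp add: assms qnum_Suc)

text \<open>On polynomials in z, D acts as a q-derivative followed by right multiplication by the
  unit y. Its kernel is therefore the constants as long as the q-numbers below N are
  nonzero.\<close>

lemma kernel_gen_alg_single:
  assumes z: "D z = y" "K z = z" "y * z = \<theta> \<cdot> (z * y)" "y * y' = 1"
    and zN: "z ^ N = 0" "z ^ (N - 1) \<noteq> 0" and \<theta>: "\<And>k. 0 < k \<Longrightarrow> k < N \<Longrightarrow> qnum \<theta> k \<noteq> 0"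
    and f: "f \<in> gen_alg {z}" "D f = 0"
  shows "\<exists>c. f = c \<cdot> 1"
proof -
  have "N > 0" using zN by (cases N) auto
  have "\<exists>c. f = (\<Sum>k<N. c k \<cdot> z ^ k)"
  proof -
    let ?V = "range (\<lambda>c. \<Sum>k<N. c k \<cdot> z ^ k)"
    have V: "(\<Sum>k<N. b k \<cdot> z ^ k) \<in> ?V" for b by (rule range_eqI[of _ _ b]) (rule refl)
    have "f \<in> ?V"
    proof (rule gen_alg_left_closed[OF f(1)])
      fix u v assume "u \<in> {z}" "v \<in> ?V"
      then obtain c where u: "u = z" "v = (\<Sum>k<N. c k \<cdot> z ^ k)" by auto
      obtain M where M: "N = Suc M" using \<open>N > 0\<close> by (cases N) auto
      have "u * v = (\<Sum>k<N. c k \<cdot> z ^ Suc k)" by (simp add: u sum_distrib_left sc_simps)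
      also have "\<dots> = (\<Sum>k<M. c k \<cdot> z ^ Suc k)" using zN(1) by (simp add: M)
      also have "\<dots> = (\<Sum>k<N. (if k = 0 then 0 else c (k - 1)) \<cdot> z ^ k)"
        unfolding M by (subst sum.lessThan_Suc_shift) simp
      finally show "u * v \<in> ?V" by (simp only: V)
    next
      fix c v assume "v \<in> ?V"
      then obtain b where "v = (\<Sum>k<N. b k \<cdot> z ^ k)" by auto
      then have "c \<cdot> v = (\<Sum>k<N. (c * b k) \<cdot> z ^ k)" by (simp add: scale_sum_right)
      then show "c \<cdot> v \<in> ?V" by (simp only: V)
    next
      fix u v assume "u \<in> ?V" "v \<in> ?V"
      then obtain b c where "u = (\<Sum>k<N. b k \<cdot> z ^ k)" "v = (\<Sum>k<N. c k \<cdot> z ^ k)" by auto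
      then have "u + v = (\<Sum>k<N. (b k + c k) \<cdot> z ^ k)" by (simp add: scale_left_distrib sum.distrib)
      then show "u + v \<in> ?V" by (simp only: V)
    next
      have "1 = (\<Sum>k<N. (if k = 0 then 1 else 0) \<cdot> z ^ k)"
        using \<open>N > 0\<close> by (simp add: if_distrib[of "\<lambda>c. c \<cdot> _"] sum.delta cong: if_cong)
      then show "1 \<in> ?V" by (rule ssubst) (rule V)
    qed
    then show ?thesis by auto
  qed
  then obtain c where c: "f = (\<Sum>k<N. c k \<cdot> z ^ k)" by blast
  have Dsum: "D (sum h S) = (\<Sum>k\<in>S. D (h k))" if "finite S" for h and S :: "nat set"
    using that by induction (simp_all add: D_add)
  have Dz: "D (z ^ k) = qnum \<theta> k \<cdot> (z ^ (k - 1) * y)" for k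
    using D_power[of z y 1 \<theta> "k - 1"] z by (cases k) auto
  have "c k = 0" if "0 < k" "k < N" for k
    using that
  proof (induction k rule: less_induct)
    case (less k)
    \<comment> \<open>Multiplying by z^(N-k) kills every term j > k because z^N = 0. The terms 0 < j
      < k vanish by induction and j = 0 has q-number 0, which leaves a multiple of z^(N-1).\<close>
    have "0 = z ^ (N - k) * D f * y'" by (simp add: f)
    also have "\<dots> = (\<Sum>j<N. (c j * qnum \<theta> j) \<cdot> (z ^ (N - k) * z ^ (j - 1)))"
      unfolding c by (simp add: Dsum D_sc Dz sum_distrib_left sum_distrib_right sc_simps z)
    also have "\<dots> = (\<Sum>j<N. if j = k then (c k * qnum \<theta> k) \<cdot> z ^ (N - 1) else 0)"
    proof (rule sum.cong)
      fix j assume "j \<in> {..<N}"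
      consider "j = 0" | "0 < j" "j < k" | "j = k" | "j > k" by linarith
      then show "(c j * qnum \<theta> j) \<cdot> (z ^ (N - k) * z ^ (j - 1))
        = (if j = k then (c k * qnum \<theta> k) \<cdot> z ^ (N - 1) else 0)"
      proof cases
        case 3
        then show ?thesis using less.prems by (simp flip: power_add)
      next
        case 4
        then have "N - k + (j - 1) = N + (j - 1 - k)" using less.prems by simp
        then have "z ^ (N - k) * z ^ (j - 1) = z ^ N * z ^ (j - 1 - k)"
          by (simp only: power_add[symmetric])
        then show ?thesis using 4 zN(1) by simp
      qed (use less in auto)
    qed simp
    also have "\<dots> = (c k * qnum \<theta> k) \<cdot> z ^ (N - 1)" using less.prems by (simp add: sum.delta)
    finally show ?case using zN(2) \<theta>[OF less.prems] by simp
  qed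
  then have "f = (\<Sum>k<N. if k = 0 then c 0 \<cdot> 1 else 0)"
    unfolding c by (intro sum.cong) auto
  then show ?thesis using \<open>N > 0\<close> by (auto simp: sum.delta)
qed

end

text \<open>The instances have \<omega> = q, l = 1 for E and \<omega> = q^-1, l = (q - q^-1) q^-1
  for G. The fourth generator of the coordinate algebra is absent: the determinant relation
  expresses it through x, s and the inverse of t. Linear independence of monomials is not
  assumed.\<close>

locale quantum_half = skew_der sc K D
  for sc :: "'k::field_char_0 \<Rightarrow> 'c::ring_1 \<Rightarrow> 'c" (infixr \<open>\<cdot>\<close> 75) and K D +
  fixes x s t :: 'c and \<omega> l :: 'k and N :: nat
  assumes tx: "t * x = \<omega> \<cdot> (x * t)" and ts: "t * s = \<omega> \<cdot> (s * t)" and xs: "s * x = x * s"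
    and Kx: "K x = \<omega> \<cdot> x" and Ks: "K s = inverse \<omega> \<cdot> s" and Kt: "K t = inverse \<omega> \<cdot> t"
    and Dx: "D x = l \<cdot> t" and Ds: "D s = 0" and Dt: "D t = 0" and l: "l \<noteq> 0"
    and xN: "x ^ N = 0" and sN: "s ^ N = 0" and tN: "t ^ N = 1"
    and N: "N > 1" "odd N" and \<omega>N: "\<omega> ^ N = 1" and prim: "\<And>m. 0 < m \<Longrightarrow> m < N \<Longrightarrow> \<omega> ^ m \<noteq> 1"
begin

text \<open>The inverse of t, because t^N = 1. Accordingly z below is s t^-1, that is c d^-1 for E
  and b a^-1 for G.\<close>

definition "t' = t ^ (N - 1)"
definition "z = s * t'"

lemma \<omega>_nz: "\<omega> \<noteq> 0" using \<omega>N N by (metis power_0_left not_one_less_zero zero_neq_one)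

lemma tt': "t * t' = 1" "t' * t = 1"
proof -
  from N obtain n where n: "N = Suc n" by (cases N) auto
  show "t * t' = 1" using tN unfolding t'_def unfolding n by simp
  show "t' * t = 1" using tN unfolding t'_def unfolding n by (simp add: power_Suc2 del: power_Suc)
qed

lemma \<omega>_iff: "\<omega> ^ i = 1 \<longleftrightarrow> N dvd i"
  using power_eq_iff_cong[OF \<omega>N prim] N by simp

text \<open>The base is \<omega>^2 because in \<open>D_power\<close> for x both scalars equal
  \<omega>. As N is odd, \<omega>^2 is again a primitive N-th root of unity.\<close>

lemma qnum_\<omega>: "qnum (\<omega>\<^sup>2) j \<noteq> 0" if "0 < j" "j < N"
proof -
  have odd: "N dvd 2 * i \<longleftrightarrow> N dvd i" for i
    using N by (metis coprime_dvd_mult_right_iff coprime_right_2_iff_odd)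
  have "\<omega>\<^sup>2 \<noteq> 1" using \<omega>_iff[of 2] odd[of 1] N by auto
  moreover have "(\<omega>\<^sup>2) ^ j \<noteq> 1" using \<omega>_iff[of "2 * j"] odd[of j] that
    by (auto simp: power_mult dest: dvd_imp_le)
  ultimately show ?thesis by (simp add: qnum_eq_0_iff)
qed

abbreviation "B \<equiv> gen_alg {s, t}"
abbreviation "M \<equiv> gen_alg {x, s, t}"

section \<open>The subalgebra \<open>B\<close> and the filtration by degree in x\<close>

lemma B_in: "s \<in> B" "t \<in> B" "t' \<in> B" "z \<in> B"
  by (auto simp: t'_def z_def intro: gen_alg.incl)

lemma B_span: "B \<subseteq> span {s ^ k * t ^ i |k i. True}" (is "_ \<subseteq> span ?X")
proof
  fix f assume f: "f \<in> B"
  show "f \<in> span ?X"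
  proof (rule gen_alg_left_closed[OF f])
    fix u v assume u: "u \<in> {s, t}" and v: "v \<in> span ?X"
    show "u * v \<in> span ?X" using v
    proof (induction rule: span_induct_alt)
      case (step c v g)
      then obtain k i where v: "v = s ^ k * t ^ i" by auto
      have "u * v \<in> span ?X"
      proof (cases "u = s")
        case True
        then have "u * v = s ^ Suc k * t ^ i" by (simp add: v mult.assoc)
        then show ?thesis by (intro span_base) blast
      next
        case False
        then have "u * v = (t ^ 1 * s ^ k) * t ^ i" using u by (simp add: v mult.assoc)
        also have "\<dots> = (\<omega> ^ k) \<cdot> (s ^ k * t ^ Suc i)"
          by (subst qcomm_power[OF ts]) (simp add: sc_simps)
        finally have e: "u * v = (\<omega> ^ k) \<cdot> (s ^ k * t ^ Suc i)" .
        show ?thesis unfolding e by (intro span_scale span_base) blast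
      qed
      then show ?case using step by (simp add: distrib_left sc_simps span_add span_scale)
    qed (simp add: span_zero)
  next
    show "1 \<in> span ?X" by (intro span_base) (auto intro!: exI[of _ 0])
  qed (auto simp: span_add span_scale)
qed

text \<open>The sum of the spaces x^j B with j < m, so that \<open>filt 0\<close> is zero and
  \<open>filt 1\<close> is B. The recursion exposes a top coefficient; that it is unique for m < N
  is the content of \<open>top_coeff_0\<close>.\<close>

fun filt :: "nat \<Rightarrow> 'c set" where
  "filt 0 = {0}"
| "filt (Suc m) = {f + x ^ m * g |f g. f \<in> filt m \<and> g \<in> B}"

lemma filt_0 [simp]: "0 \<in> filt m"
  by (induction m) (auto intro!: exI[of _ "0::'c"])

lemma filt_SucI: "f \<in> filt m \<Longrightarrow> g \<in> B \<Longrightarrow> f + x ^ m * g \<in> filt (Suc m)"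
  by auto

lemma filt_mono: "f \<in> filt m \<Longrightarrow> f \<in> filt (Suc m)"
  using filt_SucI[of f m 0] by simp

lemma filt_mono': "f \<in> filt m \<Longrightarrow> m \<le> k \<Longrightarrow> f \<in> filt k"
  by (induction k) (auto simp: le_Suc_eq simp del: filt.simps intro: filt_mono)

lemma filt_monom: "g \<in> B \<Longrightarrow> j < m \<Longrightarrow> x ^ j * g \<in> filt m"
  using filt_mono'[of "x ^ j * g" "Suc j" m] filt_SucI[of 0 j g] by simp

lemma filt_add: "f \<in> filt m \<Longrightarrow> g \<in> filt m \<Longrightarrow> f + g \<in> filt m"
proof (induction m arbitrary: f g)
  case (Suc m)
  then obtain f1 f2 g1 g2 where "f = f1 + x ^ m * f2" "g = g1 + x ^ m * g2"
    "f1 \<in> filt m" "g1 \<in> filt m" "f2 \<in> B" "g2 \<in> B" by auto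
  then show ?case using filt_SucI[OF Suc.IH, of f1 g1 "f2 + g2"] by (auto simp: algebra_simps)
qed simp

lemma filt_map:
  assumes "f \<in> filt m" "\<And>j g. j < m \<Longrightarrow> g \<in> B \<Longrightarrow> h (x ^ j * g) \<in> filt k"
    and "\<And>f g. h (f + g) = h f + h g"
  shows "h f \<in> filt k"
  using assms(1,2)
proof (induction m arbitrary: f)
  case 0
  then show ?case using assms(3)[of 0 0] by simp
next
  case (Suc m)
  then obtain f1 g where f: "f = f1 + x ^ m * g" "f1 \<in> filt m" "g \<in> B" by auto
  then show ?case using Suc.IH[of f1] Suc.prems(2) by (auto simp: assms(3) intro!: filt_add)
qed

lemma filt_sc: "f \<in> filt m \<Longrightarrow> c \<cdot> f \<in> filt m"
proof (rule filt_map[where m = m and h = "\<lambda>f. c \<cdot> f"])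
  fix j g assume "j < m" "g \<in> B"
  then show "c \<cdot> (x ^ j * g) \<in> filt m"
    using filt_monom[of "c \<cdot> g" j m] by (auto simp: sc_simps)
qed (simp_all add: scale_right_distrib)

lemma filt_diff: "f \<in> filt m \<Longrightarrow> g \<in> filt m \<Longrightarrow> f - g \<in> filt m"
  using filt_add[of f m "(-1) \<cdot> g"] filt_sc[of g m "-1"] by (simp add: scale_minus_left)

lemma filt_x: "f \<in> filt m \<Longrightarrow> x * f \<in> filt (Suc m)"
proof (rule filt_map[where m = m and h = "\<lambda>f. x * f"])
  fix j g assume "j < m" "g \<in> B"
  then show "x * (x ^ j * g) \<in> filt (Suc m)"
    using filt_monom[of g "Suc j" "Suc m"] by (simp only: power_Suc mult.assoc Suc_less_eq)
qed (simp_all add: algebra_simps)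

lemma filt_t: "f \<in> filt m \<Longrightarrow> t * f \<in> filt m"
proof (rule filt_map[where m = m and h = "\<lambda>f. t * f"])
  fix j g assume j: "j < m" "g \<in> B"
  have "t * (x ^ j * g) = (t ^ 1 * x ^ j) * g" by (simp add: mult.assoc)
  also have "\<dots> = (\<omega> ^ j) \<cdot> (x ^ j * (t * g))" by (subst qcomm_power[OF tx]) (simp add: sc_simps)
  finally show "t * (x ^ j * g) \<in> filt m" using j B_in by (auto intro!: filt_sc filt_monom)
qed (simp_all add: algebra_simps)

lemma filt_s: "f \<in> filt m \<Longrightarrow> s * f \<in> filt m"
proof (rule filt_map[where m = m and h = "\<lambda>f. s * f"])
  fix j g assume j: "j < m" "g \<in> B"
  have "s * (x ^ j * g) = (s ^ 1 * x ^ j) * g" by (simp add: mult.assoc)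
  also have "\<dots> = x ^ j * (s * g)"
    using xs by (subst qcomm_power[where c = 1]) (simp_all add: mult.assoc)
  finally show "s * (x ^ j * g) \<in> filt m" using j B_in by (auto intro!: filt_monom)
qed (simp_all add: algebra_simps)

text \<open>Left multiplication by s and t preserves the filtration and x raises it by one, but x^N
  = 0 stops it at level N.\<close>

lemma M_filt: "M \<subseteq> filt N"
proof
  fix f assume f: "f \<in> M"
  show "f \<in> filt N"
  proof (rule gen_alg_left_closed[OF f])
    fix u v assume "u \<in> {x, s, t}" "v \<in> filt N"
    moreover have "x * v \<in> filt N" if v: "v \<in> filt N" for v
    proof -
      from filt_x[OF v] obtain f g where "x * v = f + x ^ N * g" "f \<in> filt N" by auto
      then show ?thesis by (simp add: xN)
    qed
    ultimately show "u * v \<in> filt N" using filt_s filt_t by auto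
  next
    show "1 \<in> filt N" using filt_monom[of 1 0 N] N by simp
  qed (auto intro: filt_add filt_sc)
qed

lemma M_span: "M \<subseteq> span {x ^ j * s ^ k * t ^ i |j k i. True}" (is "_ \<subseteq> span ?X")
proof -
  have *: "x ^ j * g \<in> span ?X" if "g \<in> B" for j g
  proof -
    from that B_span have "g \<in> span {s ^ k * t ^ i |k i. True}" by blast
    then show ?thesis
    proof (induction rule: span_induct_alt)
      case (step c v g)
      then obtain k i where "v = s ^ k * t ^ i" by auto
      then have "x ^ j * v \<in> span ?X" by (intro span_base) (auto simp: mult.assoc)
      then show ?case using step by (simp add: distrib_left sc_simps span_add span_scale)
    qed (simp add: span_zero)
  qed
  have "filt m \<subseteq> span ?X" for m
  proof (induction m)
    case (Suc m)
    show ?case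
    proof
      fix f assume "f \<in> filt (Suc m)"
      then obtain f1 g where "f = f1 + x ^ m * g" "f1 \<in> filt m" "g \<in> B" by auto
      then show "f \<in> span ?X" using Suc * span_add by blast
    qed
  qed (simp add: span_zero)
  then show ?thesis using M_filt by blast
qed

section \<open>The kernel of \<open>D\<close>\<close>

lemma Kt': "K t' = \<omega> \<cdot> t'"
proof -
  have "inverse \<omega> ^ (N - 1) = \<omega>"
    using \<omega>N N \<omega>_nz by (simp add: power_inverse field_simps flip: power_Suc)
  then show ?thesis by (simp add: t'_def K_power Kt sc_power)
qed

lemma Kz: "K z = z"
  using \<omega>_nz by (simp add: z_def K_mult Ks Kt' sc_simps)

lemma K_B: "g \<in> B \<Longrightarrow> K g \<in> B"
  by (induction rule: gen_alg.induct) (use B_in in \<open>auto simp: K_add K_sc K_mult Ks Kt\<close>)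

lemma D_B: "g \<in> B \<Longrightarrow> D g = 0"
  by (rule gen_alg_killed) (auto simp: Ds Dt)

text \<open>The N-th iterate of K fixes s and t, hence all of B.\<close>

lemma K_inj: "g \<in> B \<Longrightarrow> K g = 0 \<Longrightarrow> g = 0"
proof -
  assume g: "g \<in> B" "K g = 0"
  have "(K ^^ N) g = g"
    by (rule gen_alg_fixed[OF g(1)])
      (auto simp: funpow_K_eigen[OF Ks] funpow_K_eigen[OF Kt] power_inverse \<omega>N)
  moreover have "(K ^^ N) g = (K ^^ (N - 1)) (K g)"
    using N by (metis Suc_diff_1 funpow_Suc_right less_trans o_apply zero_less_one)
  moreover have "(K ^^ n) 0 = 0" for n by (induction n) simp_all
  ultimately show ?thesis by (simp add: g)
qed

lemma D_xg:
  assumes "g \<in> B"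
  shows "D (x ^ Suc m * g) = x ^ m * (l * qnum (\<omega>\<^sup>2) (Suc m)) \<cdot> (t * K g)"
proof -
  have "(l \<cdot> t) * x = \<omega> \<cdot> (x * (l \<cdot> t))" by (simp add: sc_simps tx mult.commute)
  from D_power[OF Dx Kx this, of m] show ?thesis
    by (simp add: D_mult D_B[OF assms] sc_simps power2_eq_square mult.commute del: power_Suc)
qed

lemma D_filt: "f \<in> filt (Suc m) \<Longrightarrow> D f \<in> filt m"
proof (rule filt_map[where m = "Suc m" and h = D])
  fix j g assume j: "j < Suc m" "g \<in> B"
  show "D (x ^ j * g) \<in> filt m"
  proof (cases j)
    case 0
    then show ?thesis using j by (simp add: D_B)
  next
    case (Suc i)
    then show ?thesis using j
      by (simp only: D_xg) (auto intro!: filt_monom B_in K_B)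
  qed
qed (simp_all add: D_add)

text \<open>\<open>M\<close> is free over \<open>B\<close> on \<open>1, x, \<dots>, x\<^sup>N\<^sup>-\<^sup>1\<close>: applying \<open>D\<close> repeatedly isolates the top coefficient.\<close>

lemma top_coeff_0:
  assumes "f \<in> filt m" "g \<in> B" "m < N" "f + x ^ m * g = 0"
  shows "g = 0"
  using assms
proof (induction m arbitrary: f g)
  case (Suc m)
  have "D f + D (x ^ Suc m * g) = 0" using Suc.prems by (simp only: D_add[symmetric]) simp
  then have eq: "D f + x ^ m * (l * qnum (\<omega>\<^sup>2) (Suc m)) \<cdot> (t * K g) = 0"
    by (simp only: D_xg[OF Suc.prems(2)])
  have "t * K g \<in> B" using Suc.prems(2) by (intro gen_alg.mult K_B B_in)
  then have "(l * qnum (\<omega>\<^sup>2) (Suc m)) \<cdot> (t * K g) = 0"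
    using Suc.prems(3) by (intro Suc.IH[OF D_filt[OF Suc.prems(1)] _ _ eq]) auto
  then have "t * K g = 0" using l qnum_\<omega>[of "Suc m"] Suc.prems by simp
  then have "t' * t * K g = 0" by (simp add: mult.assoc)
  then show ?case using K_inj Suc.prems by (simp add: tt')
qed simp

text \<open>Freeness applied to the coefficient 1. For the half of G this says that c^(N-1) is
  nonzero, which is needed for the invariants of the whole algebra.\<close>

lemma x_top_nz: "x ^ (N - 1) \<noteq> 0"
  using top_coeff_0[of 0 "N - 1" 1] N by auto

text \<open>For top degree m > 0 the coefficient of x^(m-1) in D f is a nonzero multiple of t K g,
  so D f = 0 forces g = 0 and the degree drops. The descent ends at \<open>filt 1\<close>, which is
  B.\<close>

lemma ker_D_filt:
  assumes "f \<in> filt m" "m \<le> N" "D f = 0"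
  shows "f \<in> B"
  using assms
proof (induction m arbitrary: f)
  case (Suc m)
  then obtain f1 g where f: "f = f1 + x ^ m * g" "f1 \<in> filt m" "g \<in> B" by auto
  show ?case
  proof (cases m)
    case 0
    then show ?thesis using f by simp
  next
    case m: (Suc i)
    have i: "i < N" "Suc i < N" using Suc.prems(2) m by simp_all
    have eq: "D f1 + x ^ i * (l * qnum (\<omega>\<^sup>2) (Suc i)) \<cdot> (t * K g) = 0"
      using Suc.prems(3) D_xg[OF f(3), of i] by (simp only: f m D_add)
    have "D f1 \<in> filt i" using f(2) unfolding m by (rule D_filt)
    moreover have "t * K g \<in> B" using f(3) by (intro gen_alg.mult K_B B_in)
    ultimately have "(l * qnum (\<omega>\<^sup>2) (Suc i)) \<cdot> (t * K g) = 0"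
      using i by (intro top_coeff_0[OF _ _ _ eq]) auto
    then have "t * K g = 0" using l qnum_\<omega>[of "Suc i"] i by simp
    then have "t' * t * K g = 0" by (simp add: mult.assoc)
    then have "g = 0" using K_inj f by (simp add: tt')
    then have "f = f1" using f(1) by simp
    then show ?thesis using f(2) Suc.prems Suc.IH[of f] by simp
  qed
qed simp

lemma ker_D: "f \<in> M \<and> D f = 0 \<longleftrightarrow> f \<in> B"
proof
  show "f \<in> B" if "f \<in> M \<and> D f = 0" using that M_filt ker_D_filt[of f N] by auto
  have "B \<subseteq> M" by (rule gen_alg_mono) (auto intro: gen_alg.incl)
  then show "f \<in> M \<and> D f = 0" if "f \<in> B" using that D_B by auto
qed

section \<open>Elements fixed by a power of \<open>K\<close>\<close>

lemma t's: "t' * s = (\<omega> ^ (N - 1)) \<cdot> (s * t')"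
  using qcomm_power[OF ts, of "N - 1" 1] by (simp add: t'_def)

lemma K_monom: "K (x ^ j * s ^ k * t ^ i) = (\<omega> ^ j * inverse \<omega> ^ (k + i)) \<cdot> (x ^ j * s ^ k * t ^ i)"
  by (simp add: K_mult K_power Kx Ks Kt sc_power sc_simps power_add mult_ac)

text \<open>The exponent \<open>e\<close> solves \<open>n e \<equiv> i + k - j\<close> modulo \<open>N\<close>.\<close>

lemma fixed_monom:
  assumes "(K ^^ r) (x ^ j * s ^ k * t ^ i) = x ^ j * s ^ k * t ^ i" "N = n * r"
  shows "\<exists>u e. x ^ j * s ^ k * t ^ i = u \<cdot> ((x * t) ^ j * z ^ k * (t ^ n) ^ e)"
proof (cases "x ^ j * s ^ k * t ^ i = 0")
  case True
  \<comment> \<open>A vanishing monomial carries no information on its eigenvalue, so it is treated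
    apart, with scalar u = 0.\<close>
  then show ?thesis by (intro exI[of _ 0]) simp
next
  case False
  have r: "r > 0" using assms N by (cases r) auto
  have "((\<omega> ^ j * inverse \<omega> ^ (k + i)) ^ r - 1) \<cdot> (x ^ j * s ^ k * t ^ i) = 0"
    using assms(1) by (simp add: funpow_K_eigen[OF K_monom] scale_left_diff_distrib)
  then have eq: "(\<omega> ^ j * inverse \<omega> ^ (k + i)) ^ r = 1" using False by simp
  \<comment> \<open>The K-eigenvalue is \<omega>^(j - k - i). Its inverse is used, with (N - 1) j in
    place of -j to stay within natural exponents.\<close>
  have "\<omega> ^ (r * (i + k + (N - 1) * j)) = 1"
  proof -
    have "\<omega> ^ (r * (i + k + (N - 1) * j)) * (\<omega> ^ j * inverse \<omega> ^ (k + i)) ^ r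
      = (\<omega> ^ (N * j)) ^ r * (\<omega> ^ (i + k) * inverse \<omega> ^ (k + i)) ^ r"
      using N by (simp add: power_mult_distrib mult_ac add_ac flip: power_mult power_add)
        (simp add: algebra_simps flip: power_add; cases N; simp add: algebra_simps)
    also have "\<dots> = 1" using \<omega>_nz by (simp add: power_mult \<omega>N power_inverse add.commute)
    finally show ?thesis by (simp add: eq)
  qed
  then have "n * r dvd r * (i + k + (N - 1) * j)" using \<omega>_iff assms(2) by simp
  then have "n dvd i + k + (N - 1) * j" using r by (simp add: mult.commute)
  then obtain e where e: "i + k + (N - 1) * j = n * e" by auto
  from qcomm_mult_power[OF tx \<omega>_nz] obtain u
    where u: "u \<noteq> 0" "(x * t) ^ j = u \<cdot> (x ^ j * t ^ j)" by blast
  from qcomm_mult_power[OF t's] \<omega>_nz obtain v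
    where v: "v \<noteq> 0" "z ^ k = v \<cdot> (s ^ k * t' ^ k)" unfolding z_def by auto
  have tj: "t ^ j * s ^ k = (\<omega> ^ (j * k)) \<cdot> (s ^ k * t ^ j)" by (rule qcomm_power[OF ts])
  have "(x * t) ^ j * z ^ k * (t ^ n) ^ e
      = (u * v) \<cdot> (x ^ j * (t ^ j * s ^ k) * (t' ^ k * (t ^ n) ^ e))"
    by (simp add: u v sc_simps)
  also have "\<dots> = (u * v * \<omega> ^ (j * k)) \<cdot> (x ^ j * s ^ k * (t ^ j * (t' ^ k * (t ^ n) ^ e)))"
    by (simp add: tj sc_simps)
  \<comment> \<open>Here the choice of e pays off: the total exponent j + (N - 1) k + n e equals i +
    N j + N k, and t^N = 1.\<close>
  also have "t ^ j * (t' ^ k * (t ^ n) ^ e) = t ^ i * (t ^ N) ^ j * (t ^ N) ^ k"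
  proof -
    have "j + ((N - 1) * k + n * e) = i + N * j + N * k"
      using N unfolding e[symmetric] by (cases N) (auto simp: algebra_simps)
    then show ?thesis by (simp only: t'_def power_mult[symmetric] power_add[symmetric])
  qed
  finally have "(x * t) ^ j * z ^ k * (t ^ n) ^ e
      = (u * v * \<omega> ^ (j * k)) \<cdot> (x ^ j * s ^ k * t ^ i)" by (simp add: tN)
  moreover have "u * v * \<omega> ^ (j * k) \<noteq> 0" using u v \<omega>_nz by simp
  ultimately have "x ^ j * s ^ k * t ^ i
      = inverse (u * v * \<omega> ^ (j * k)) \<cdot> ((x * t) ^ j * z ^ k * (t ^ n) ^ e)"
    by (simp only: scale_scale left_inverse scale_one not_False_eq_True)
  then show ?thesis by blast
qed

lemma monom_root: "(\<omega> ^ j * inverse \<omega> ^ (k + i)) ^ N = 1"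
  by (simp add: power_mult_distrib power_inverse \<omega>N flip: power_mult)
    (simp add: mult.commute[of _ N] power_mult \<omega>N)

lemma K_gens: assumes "N = n * r"
  shows "(K ^^ r) (t ^ n) = t ^ n" "(K ^^ r) (x * t) = x * t" "(K ^^ r) z = z"
proof -
  have "inverse \<omega> ^ (n * r) = 1" using \<omega>N assms by (simp add: power_inverse)
  moreover have "(K ^^ r) (t ^ n) = ((inverse \<omega> ^ n) ^ r) \<cdot> t ^ n"
    by (rule funpow_K_eigen) (simp add: K_power Kt sc_power)
  ultimately show "(K ^^ r) (t ^ n) = t ^ n" by (simp add: power_mult)
  have "K (x * t) = 1 \<cdot> (x * t)" using \<omega>_nz by (simp add: K_mult Kx Kt sc_simps)
  from funpow_K_eigen[OF this] show "(K ^^ r) (x * t) = x * t" by simp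
  have "K z = 1 \<cdot> z" by (simp add: Kz)
  from funpow_K_eigen[OF this] show "(K ^^ r) z = z" by simp
qed

lemma fixed_M: assumes "N = n * r"
  shows "f \<in> M \<and> (K ^^ r) f = f \<longleftrightarrow> f \<in> gen_alg {t ^ n, x * t, z}"
proof
  let ?X = "{x ^ j * s ^ k * t ^ i |j k i. True}"
  have n: "of_nat n \<noteq> (0::'k)" using assms N by (cases "n = 0") simp_all
  assume f: "f \<in> M \<and> (K ^^ r) f = f"
  have "f \<in> span {v \<in> ?X. (K ^^ r) v = v}"
  proof (rule span_eigen_fixed[OF _ n])
    show "\<exists>\<xi>. K v = \<xi> \<cdot> v \<and> \<xi> ^ (n * r) = 1" if "v \<in> ?X" for v
      using that K_monom monom_root assms by blast
  qed (use f M_span in auto)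
  moreover have "{v \<in> ?X. (K ^^ r) v = v} \<subseteq> gen_alg {t ^ n, x * t, z}"
  proof
    fix v assume "v \<in> {v \<in> ?X. (K ^^ r) v = v}"
    then obtain j k i where v: "v = x ^ j * s ^ k * t ^ i" "(K ^^ r) v = v" by auto
    then obtain u e where e: "v = u \<cdot> ((x * t) ^ j * z ^ k * (t ^ n) ^ e)"
      using fixed_monom[of r j k i n] assms by metis
    show "v \<in> gen_alg {t ^ n, x * t, z}" unfolding e
      by (rule gen_alg.scale gen_alg.mult[OF gen_alg.mult, OF gen_alg_power gen_alg_power gen_alg_power]
          gen_alg.incl insertI1 insertI2)+
  qed
  ultimately show "f \<in> gen_alg {t ^ n, x * t, z}" using gen_alg_span by blast
next
  assume f: "f \<in> gen_alg {t ^ n, x * t, z}"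
  have "{t ^ n, x * t, z} \<subseteq> M"
    by (auto simp: z_def t'_def intro!: gen_alg.mult gen_alg_power intro: gen_alg.incl)
  then have "f \<in> M" using f gen_alg_mono by blast
  moreover have "(K ^^ r) f = f" by (rule gen_alg_fixed[OF f]) (use K_gens[OF assms] in auto)
  ultimately show "f \<in> M \<and> (K ^^ r) f = f" by blast
qed

lemma fixed_B: assumes "N = n * r"
  shows "f \<in> B \<and> (K ^^ r) f = f \<longleftrightarrow> f \<in> gen_alg {t ^ n, z}"
proof
  let ?X = "{s ^ k * t ^ i |k i. True}"
  have n: "of_nat n \<noteq> (0::'k)" using assms N by (cases "n = 0") simp_all
  assume f: "f \<in> B \<and> (K ^^ r) f = f"
  have "f \<in> span {v \<in> ?X. (K ^^ r) v = v}"
  proof (rule span_eigen_fixed[OF _ n])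
    fix v assume "v \<in> ?X"
    then obtain k i where "v = s ^ k * t ^ i" by auto
    then show "\<exists>\<xi>. K v = \<xi> \<cdot> v \<and> \<xi> ^ (n * r) = 1"
      using K_monom[of 0 k i] monom_root[of 0 k i] assms by (intro exI) (rule conjI; simp)
  qed (use f B_span in auto)
  moreover have "{v \<in> ?X. (K ^^ r) v = v} \<subseteq> gen_alg {t ^ n, z}"
  proof
    fix v assume "v \<in> {v \<in> ?X. (K ^^ r) v = v}"
    then obtain k i where v: "v = x ^ 0 * s ^ k * t ^ i" "(K ^^ r) v = v" by auto
    then obtain u e where e: "v = u \<cdot> ((x * t) ^ 0 * z ^ k * (t ^ n) ^ e)"
      using fixed_monom[of r 0 k i n] assms by metis
    show "v \<in> gen_alg {t ^ n, z}" unfolding e power_0 mult_1_left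
      by (rule gen_alg.scale gen_alg.mult[OF gen_alg_power gen_alg_power]
          gen_alg.incl insertI1 insertI2)+
  qed
  ultimately show "f \<in> gen_alg {t ^ n, z}" using gen_alg_span by blast
next
  assume f: "f \<in> gen_alg {t ^ n, z}"
  have "{t ^ n, z} \<subseteq> B" using B_in by auto
  then have "f \<in> B" using f gen_alg_mono by blast
  moreover have "(K ^^ r) f = f" by (rule gen_alg_fixed[OF f]) (use K_gens[OF assms] in auto)
  ultimately show "f \<in> B \<and> (K ^^ r) f = f" by blast
qed

lemma fixed_B_one: "f \<in> B \<and> K f = f \<longleftrightarrow> f \<in> gen_alg {z}"
proof -
  have "gen_alg {t ^ N, z} = gen_alg {z}"
    by (intro equalityI gen_alg_mono) (auto simp: tN intro: gen_alg.incl)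
  then show ?thesis using fixed_B[of N 1 f] by simp
qed

section \<open>Invariants of \<open>D + \<alpha> K\<close>\<close>

context
  fixes \<alpha> \<mu> :: 'k
  assumes \<mu>: "\<mu> * l = \<alpha> * (\<omega> - inverse \<omega>)"
begin

text \<open>In D w + \<alpha> K w the coefficient of xt is \<alpha> \<mu> for every \<mu>, since K
  fixes xt. The coefficient of t^2 is \<mu> l \<omega>^-1 + \<alpha> \<omega>^-2, and equating it
  with \<alpha> gives the hypothesis on \<mu>.\<close>

definition "w = t\<^sup>2 + \<mu> \<cdot> (x * t)"

lemma w_twisted: "D w + \<alpha> \<cdot> K w = \<alpha> \<cdot> w"
proof -
  have "D w + \<alpha> \<cdot> K w = (\<mu> * l * inverse \<omega> + \<alpha> * (inverse \<omega>)\<^sup>2) \<cdot> t\<^sup>2 + (\<alpha> * \<mu>) \<cdot> (x * t)"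
    using \<omega>_nz
    by (simp add: w_def D_add D_sc D_mult Dx Dt K_add K_sc K_mult Kx Kt power2_eq_square sc_simps
        scale_right_distrib scale_left_distrib mult_ac)
  also have "\<mu> * l * inverse \<omega> + \<alpha> * (inverse \<omega>)\<^sup>2 = \<alpha>"
    using \<omega>_nz by (simp add: \<mu> power2_eq_square field_simps)
  finally show ?thesis by (simp add: w_def scale_right_distrib)
qed

text \<open>In each factor only \<mu> xt raises the degree in x, so the leading coefficient of w^m
  is a multiple of t^m, nonzero when \<mu> is. This lets w^m cancel a prescribed top
  coefficient.\<close>

lemma w_power: "\<exists>\<kappa> f. f \<in> filt m \<and> w ^ m = f + x ^ m * \<kappa> \<cdot> t ^ m \<and> (\<mu> \<noteq> 0 \<longrightarrow> \<kappa> \<noteq> 0)"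
proof (induction m)
  case 0
  show ?case by (intro exI[of _ 1] exI[of _ 0]) simp
next
  case (Suc m)
  then obtain \<kappa> f where f: "f \<in> filt m" "w ^ m = f + x ^ m * \<kappa> \<cdot> t ^ m" "\<mu> \<noteq> 0 \<longrightarrow> \<kappa> \<noteq> 0" by blast
  have wf: "w * f = t * (t * f) + \<mu> \<cdot> (x * (t * f))"
    by (simp add: w_def distrib_right power2_eq_square sc_simps)
  have "x * (t * f) \<in> filt (Suc m)" "t * (t * f) \<in> filt (Suc m)"
    using f filt_t filt_x filt_mono by blast+
  then have 1: "w * f \<in> filt (Suc m)" unfolding wf by (intro filt_add filt_sc)
  have tm: "t * x ^ m = (\<omega> ^ m) \<cdot> (x ^ m * t)" using qcomm_power[OF tx, of 1 m] by simp
  have "w * (x ^ m * \<kappa> \<cdot> t ^ m) = t * (t * (x ^ m * \<kappa> \<cdot> t ^ m)) + (\<mu> * \<kappa>) \<cdot> (x * (t * x ^ m) * t ^ m)"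
    by (simp add: w_def distrib_right power2_eq_square sc_simps scale_right_distrib mult.commute[of \<kappa>])
  also have "(\<mu> * \<kappa>) \<cdot> (x * (t * x ^ m) * t ^ m) = x ^ Suc m * (\<mu> * \<kappa> * \<omega> ^ m) \<cdot> t ^ Suc m"
    by (simp add: tm sc_simps)
  finally have 2: "w * (x ^ m * \<kappa> \<cdot> t ^ m)
      = t * (t * (x ^ m * \<kappa> \<cdot> t ^ m)) + x ^ Suc m * (\<mu> * \<kappa> * \<omega> ^ m) \<cdot> t ^ Suc m" .
  have "t * (t * (x ^ m * \<kappa> \<cdot> t ^ m)) \<in> filt (Suc m)"
    by (intro filt_t filt_monom) (auto intro!: gen_alg_power B_in)
  then have "w * f + t * (t * (x ^ m * \<kappa> \<cdot> t ^ m)) \<in> filt (Suc m)" using 1 by (intro filt_add)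
  moreover have "w ^ Suc m = (w * f + t * (t * (x ^ m * \<kappa> \<cdot> t ^ m))) + x ^ Suc m * (\<mu> * \<kappa> * \<omega> ^ m) \<cdot> t ^ Suc m"
    by (simp only: power_Suc[of w] f distrib_left 2 add.assoc)
  moreover have "\<mu> \<noteq> 0 \<longrightarrow> \<mu> * \<kappa> * \<omega> ^ m \<noteq> 0" using f \<omega>_nz by simp
  ultimately show ?case by blast
qed

lemma filt_right_B: "f \<in> filt m \<Longrightarrow> p \<in> B \<Longrightarrow> f * p \<in> filt m"
proof (rule filt_map[where m = m and h = "\<lambda>f. f * p"])
  fix j g assume "j < m" "g \<in> B" "p \<in> B"
  then show "x ^ j * g * p \<in> filt m" by (simp add: mult.assoc filt_monom gen_alg.mult)
qed (simp_all add: algebra_simps)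

lemma K_filt: "f \<in> filt m \<Longrightarrow> K f \<in> filt m"
proof (rule filt_map[where m = m and h = "K"])
  fix j g assume j: "j < m" "g \<in> B"
  have "K (x ^ j * g) = x ^ j * (\<omega> ^ j) \<cdot> K g" by (simp add: K_mult K_power Kx sc_power sc_simps)
  then show "K (x ^ j * g) \<in> filt m" using j by (auto intro!: filt_monom K_B)
qed (simp_all add: K_add)

text \<open>D f has lower degree than f, so the top coefficient g satisfies \<omega>^m K g = g.
  Hence t^-m g is a K-fixed element p of B, a polynomial in z, and x^m g is the leading term of
  \<kappa>^-1 w^m p. Subtracting this invariant lowers the degree.\<close>

lemma twisted_filt:
  assumes "\<alpha> \<noteq> 0" "f \<in> filt m" "m \<le> N" "D f + \<alpha> \<cdot> K f = \<alpha> \<cdot> f"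
  shows "f \<in> gen_alg {z, w}"
  using assms(2-)
proof (induction m arbitrary: f)
  case (Suc m)
  then obtain f1 g where f: "f = f1 + x ^ m * g" "f1 \<in> filt m" "g \<in> B" by auto
  have Kxg: "K (x ^ m * g) = x ^ m * (\<omega> ^ m) \<cdot> K g" by (simp add: K_mult K_power Kx sc_power sc_simps)
  have "D f + \<alpha> \<cdot> K f1 - \<alpha> \<cdot> f1 + x ^ m * \<alpha> \<cdot> ((\<omega> ^ m) \<cdot> K g - g) = D f + \<alpha> \<cdot> K f - \<alpha> \<cdot> f"
    by (simp add: f K_add Kxg scale_right_distrib scale_right_diff_distrib algebra_simps sc_mult_right)
  then have eq: "D f + \<alpha> \<cdot> K f1 - \<alpha> \<cdot> f1 + x ^ m * \<alpha> \<cdot> ((\<omega> ^ m) \<cdot> K g - g) = 0"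
    using Suc.prems by simp
  have in_filt: "D f + \<alpha> \<cdot> K f1 - \<alpha> \<cdot> f1 \<in> filt m"
    using Suc.prems f by (intro filt_diff filt_add filt_sc D_filt K_filt)
  have in_B: "\<alpha> \<cdot> ((\<omega> ^ m) \<cdot> K g - g) \<in> B" using f by (auto intro!: K_B)
  have "\<alpha> \<cdot> ((\<omega> ^ m) \<cdot> K g - g) = 0"
    by (rule top_coeff_0[OF in_filt in_B _ eq]) (use Suc.prems(2) in simp)
  then have Kg: "(\<omega> ^ m) \<cdot> K g = g" using assms by simp
  define p where "p = t' ^ m * g"
  have tp: "t ^ m * t' ^ m = 1"
  proof -
    have "t ^ m * t' ^ m = (t ^ N) ^ m"
    proof -
      have "m + (N - 1) * m = N * m" using N by (cases N) auto
      then show ?thesis by (simp only: t'_def power_mult[symmetric] power_add[symmetric])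
    qed
    then show ?thesis by (simp add: tN)
  qed
  have g: "g = t ^ m * p" by (simp add: p_def tp flip: mult.assoc)
  have "p \<in> B" using f B_in by (auto simp: p_def)
  moreover have "K p = p"
    using Kg by (simp add: p_def K_mult K_power Kt' sc_power sc_simps) (metis sc_mult_right)
  ultimately have p: "p \<in> gen_alg {z}" "p \<in> B" using fixed_B_one by blast+
  \<comment> \<open>If \<mu> were 0, then \<alpha> \<noteq> 0 would force \<omega>^2 = 1,
    contradicting primitivity for odd N > 1.\<close>
  have "\<mu> \<noteq> 0"
  proof
    assume "\<mu> = 0"
    then have "\<omega>\<^sup>2 = 1" using \<mu> \<open>\<alpha> \<noteq> 0\<close> \<omega>_nz by (simp add: field_simps power2_eq_square)
    then show False using qnum_\<omega>[of 2] prim[of 2] \<omega>N N by (cases "N = 2") auto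
  qed
  with w_power[of m] obtain \<kappa> f2 where f2: "f2 \<in> filt m" "w ^ m = f2 + x ^ m * \<kappa> \<cdot> t ^ m" "\<kappa> \<noteq> 0" by blast
  define h where "h = inverse \<kappa> \<cdot> (w ^ m * p)"
  have h: "h \<in> gen_alg {z, w}"
  proof -
    have "gen_alg {z} \<subseteq> gen_alg {z, w}" by (rule gen_alg_mono) (auto intro: gen_alg.incl)
    then show ?thesis unfolding h_def using p
      by (intro gen_alg.scale gen_alg.mult gen_alg_power) (auto intro: gen_alg.incl)
  qed
  have "h = inverse \<kappa> \<cdot> (f2 * p) + x ^ m * g"
    using f2(3) by (simp add: h_def f2 distrib_right sc_simps scale_right_distrib g)
  then have "f - h = f1 - inverse \<kappa> \<cdot> (f2 * p)" by (simp add: f)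
  moreover have "f1 - inverse \<kappa> \<cdot> (f2 * p) \<in> filt m"
    using f f2 p by (intro filt_diff filt_sc filt_right_B)
  ultimately have 1: "f - h \<in> filt m" by simp
  have hT: "D h + \<alpha> \<cdot> K h = \<alpha> \<cdot> h"
  proof (rule gen_alg_twisted[OF h])
    fix u assume "u \<in> {z, w}"
    moreover have "D z = 0" using B_in D_B by blast
    ultimately show "D u + \<alpha> \<cdot> K u = \<alpha> \<cdot> u" using w_twisted by (auto simp: Kz)
  qed
  have "D (f - h) = D f - D h" "K (f - h) = K f - K h"
    using D_add[of "f - h" h] K_add[of "f - h" h] by simp_all
  then have "D (f - h) + \<alpha> \<cdot> K (f - h) = (D f + \<alpha> \<cdot> K f) - (D h + \<alpha> \<cdot> K h)"
    by (simp add: scale_right_diff_distrib)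
  then have "D (f - h) + \<alpha> \<cdot> K (f - h) = \<alpha> \<cdot> (f - h)"
    by (simp add: hT Suc.prems scale_right_diff_distrib)
  with 1 Suc have "f - h \<in> gen_alg {z, w}" by simp
  with h have "(f - h) + h \<in> gen_alg {z, w}" by blast
  then show ?case by simp
qed simp

lemma twisted_M: "f \<in> M \<and> D f + \<alpha> \<cdot> K f = \<alpha> \<cdot> f \<longleftrightarrow> f \<in> gen_alg {z, w}"
proof
  assume f: "f \<in> M \<and> D f + \<alpha> \<cdot> K f = \<alpha> \<cdot> f"
  show "f \<in> gen_alg {z, w}"
  proof (cases "\<alpha> = 0")
    case False
    then show ?thesis using f M_filt twisted_filt[of f N] by blast
  next
    case True
    then have "\<mu> = 0" using \<mu> l by simp
    then have w: "w = t\<^sup>2" unfolding w_def by simp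
    have "f \<in> B" using f True ker_D by auto
    \<comment> \<open>For \<alpha> = 0 the condition is D f = 0, so f lies in B, while w is only
      t^2. As N is odd, t = t^(N+1) is a power of t^2, and then s = z t is recovered as
      well.\<close>
    moreover have t: "t \<in> gen_alg {z, w}"
    proof -
      from N obtain j where "N = 2 * j + 1" by (auto elim: oddE)
      then have j: "2 * Suc j = Suc N" by simp
      have "w ^ Suc j = t ^ (2 * Suc j)" by (simp only: w power_mult)
      also have "\<dots> = t ^ N * t" by (simp only: j power_Suc2)
      finally have "w ^ Suc j = t ^ N * t" .
      then have "w ^ Suc j = t" by (simp add: tN)
      moreover have "w ^ Suc j \<in> gen_alg {z, w}" by (intro gen_alg_power gen_alg.incl) simp
      ultimately show ?thesis by simp
    qed
    moreover have "z * t \<in> gen_alg {z, w}" by (rule gen_alg.mult[OF gen_alg.incl t]) simp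
    then have "s \<in> gen_alg {z, w}" by (simp add: z_def mult.assoc tt')
    ultimately show ?thesis using gen_alg_mono[of "{s, t}"] by blast
  qed
next
  assume f: "f \<in> gen_alg {z, w}"
  have "{z, w} \<subseteq> M"
    by (auto simp: z_def t'_def w_def power2_eq_square intro!: gen_alg.mult gen_alg.add gen_alg.scale gen_alg_power intro: gen_alg.incl)
  then have "f \<in> M" using f gen_alg_mono by blast
  moreover have "D f + \<alpha> \<cdot> K f = \<alpha> \<cdot> f"
  proof (rule gen_alg_twisted[OF f])
    fix u assume "u \<in> {z, w}"
    moreover have "D z = 0" using B_in D_B by blast
    ultimately show "D u + \<alpha> \<cdot> K u = \<alpha> \<cdot> u" using w_twisted by (auto simp: Kz)
  qed
  ultimately show "f \<in> M \<and> D f + \<alpha> \<cdot> K f = \<alpha> \<cdot> f" by blast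
qed

end

end

section \<open>The convolution algebra\<close>

datatype letter = LK | LE | LG

text \<open>A type of its own, so that \<open>*\<close> can denote convolution in an instance of
  \<open>ring_1\<close>.\<close>

datatype 'k conv = Conv (coef: "letter list \<Rightarrow> 'k")

lemma conv_eqI: "(\<And>w. coef f w = coef g w) \<Longrightarrow> f = g"
  by (cases f; cases g) (simp add: fun_eq_iff)

text \<open>The value of f \<otimes> g on the coproduct of a word, where K is group-like and each
  other letter x has coproduct x \<otimes> K + 1 \<otimes> x. Reading the first letter replaces f
  and g by translates, hence the recursion over functions.\<close>

fun cmul :: "letter list \<Rightarrow> (letter list \<Rightarrow> 'k::field) \<Rightarrow> (letter list \<Rightarrow> 'k) \<Rightarrow> 'k" where
  "cmul [] f g = f [] * g []"
| "cmul (x # w) f g =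
    (if x = LK then cmul w (\<lambda>v. f (LK # v)) (\<lambda>v. g (LK # v))
     else cmul w (\<lambda>v. f (x # v)) (\<lambda>v. g (LK # v)) + cmul w f (\<lambda>v. g (x # v)))"

lemma cmul_add_left: "cmul w (\<lambda>v. f v + f' v) g = cmul w f g + cmul w f' g"
  by (induction w arbitrary: f f' g) (simp_all add: distrib_right)

lemma cmul_add_right: "cmul w g (\<lambda>v. f v + f' v) = cmul w g f + cmul w g f'"
  by (induction w arbitrary: f f' g) (simp_all add: distrib_left)

lemma cmul_scale_left: "cmul w (\<lambda>v. c * f v) g = c * cmul w f g"
  by (induction w arbitrary: f g) (simp_all add: distrib_left mult.assoc)

lemma cmul_scale_right: "cmul w f (\<lambda>v. c * g v) = c * cmul w f g"
  by (induction w arbitrary: f g) (simp_all add: distrib_left mult.left_commute)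

lemma cmul_zero: "cmul w (\<lambda>v. 0) g = 0" "cmul w f (\<lambda>v. 0) = 0"
  using cmul_scale_left[of w 0 "\<lambda>v. 0" g] cmul_scale_right[of w f 0 "\<lambda>v. 0"] by simp_all

text \<open>Coassociativity of the coproduct on words: both ways of iterating it send a letter x
  other than K to x \<otimes> K \<otimes> K + 1 \<otimes> x \<otimes> K + 1 \<otimes> 1 \<otimes>
  x.\<close>

lemma cmul_assoc: "cmul w (\<lambda>v. cmul v f g) h = cmul w f (\<lambda>v. cmul v g h)"
proof (induction w arbitrary: f g h)
  case (Cons x w)
  show ?case
    by (simp add: cmul_add_left cmul_add_right Cons.IH[symmetric] add.assoc)
qed simp

definition ceval :: "letter list \<Rightarrow> 'k::field" where
  "ceval w = (if set w \<subseteq> {LK} then 1 else 0)"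

lemma ceval_simps [simp]: "ceval [] = 1" "ceval (LK # w) = ceval w"
  "x \<noteq> LK \<Longrightarrow> ceval (x # w) = 0"
  by (auto simp: ceval_def)

lemma cmul_ceval: "cmul w ceval f = f w" "cmul w f ceval = f w"
  by (induction w arbitrary: f) (simp_all add: cmul_zero)

instantiation conv :: (field) ring_1
begin

definition zero_conv where "0 = Conv (\<lambda>w. 0)"
definition one_conv where "1 = Conv ceval"
definition plus_conv where "f + g = Conv (\<lambda>w. coef f w + coef g w)"
definition uminus_conv where "- f = Conv (\<lambda>w. - coef f w)"
definition minus_conv where "f - g = Conv (\<lambda>w. coef f w - coef g w)"
definition times_conv where "f * g = Conv (\<lambda>w. cmul w (coef f) (coef g))"

instance
proof
  show "(0::'a conv) \<noteq> 1"
    using ceval_simps(1) by (auto simp: zero_conv_def one_conv_def fun_eq_iff intro!: exI[of _ "[]"])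
qed (simp_all add: zero_conv_def one_conv_def plus_conv_def uminus_conv_def minus_conv_def times_conv_def
    cmul_assoc cmul_ceval cmul_add_left cmul_add_right conv.expand add_ac)

end

lemma coef_simps [simp]: "coef 0 w = 0" "coef 1 w = ceval w" "coef (f + g) w = coef f w + coef g w"
  "coef (- f) w = - coef f w" "coef (f - g) w = coef f w - coef g w"
  "coef (f * g) w = cmul w (coef f) (coef g)"
  by (simp_all add: zero_conv_def one_conv_def plus_conv_def uminus_conv_def minus_conv_def times_conv_def)

definition cscale :: "'k::field \<Rightarrow> 'k conv \<Rightarrow> 'k conv" where
  "cscale c f = Conv (\<lambda>w. c * coef f w)"

text \<open>The right action of a letter, the dual of left multiplication by it. With this choice
  the skew Leibniz rule is one step of the recursion of \<open>cmul\<close>.\<close>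

definition shift :: "letter \<Rightarrow> 'k conv \<Rightarrow> 'k conv" where
  "shift x f = Conv (\<lambda>w. coef f (x # w))"

lemma coef_cscale [simp]: "coef (cscale c f) w = c * coef f w"
  by (simp add: cscale_def)

lemma coef_shift [simp]: "coef (shift x f) w = coef f (x # w)"
  by (simp add: shift_def)

lemma coef_cscale_fun: "coef (cscale c f) = (\<lambda>w. c * coef f w)"
  and coef_shift_fun: "coef (shift x f) = (\<lambda>w. coef f (x # w))"
  by auto

lemma skew_der_shift: "x \<noteq> LK \<Longrightarrow> skew_der cscale (shift LK) (shift x)"
  by unfold_locales
    (auto intro!: conv_eqI simp: algebra_simps coef_cscale_fun coef_shift_fun cmul_scale_left cmul_scale_right)

section \<open>The relations are respected\<close>

lemma scal_scal: "scal c * (scal d * t) = scal (c * d) * t"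
  by (simp only: scal_mult mult.assoc)

text \<open>Needed for Y = K with exponent N - 1, that is for commuting the inverse of K past E and
  F.\<close>

lemma power_qcomm_mem:
  fixes X :: "'m::monoid_add \<Rightarrow>\<^sub>0 'k::field"
  assumes "two_sided J" "Y * X - scal c * (X * Y) \<in> J"
  shows "Y ^ n * X - scal (c ^ n) * (X * Y ^ n) \<in> J"
proof (induction n)
  case 0
  then show ?case using two_sided.zero_mem[OF assms(1)] by simp
next
  case (Suc n)
  interpret J: two_sided J by (rule assms)
  have assoc: "Y ^ Suc n * X = Y * (Y ^ n * X)" by (simp add: mult.assoc)
  have *: "Y ^ Suc n * X - scal (c ^ Suc n) * (X * Y ^ Suc n)
    = Y * (Y ^ n * X - scal (c ^ n) * (X * Y ^ n)) + scal (c ^ n) * ((Y * X - scal c * (X * Y)) * Y ^ n)"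
    unfolding assoc power_Suc2[of c] power_Suc[of Y]
    by (simp only: right_diff_distrib left_diff_distrib mult.assoc scal_left_commute[of Y] scal_scal)
      (simp only: add_diff_eq diff_add_cancel)
  show ?case unfolding * by (intro J.add_mem J.lmult_mem[OF Suc] J.lmult_mem J.rmult_mem assms(2))
qed

locale root_of_unity =
  fixes N :: nat and q :: "'k::field_char_0"
  assumes N: "N > 1" "odd N" and qN: "q ^ N = 1" and prim: "\<And>m. 0 < m \<Longrightarrow> m < N \<Longrightarrow> q ^ m \<noteq> 1"
begin

lemma q_nz [simp]: "q \<noteq> 0" using qN N by (metis power_0_left not_one_less_zero zero_neq_one)

lemma q_iff: "q ^ i = 1 \<longleftrightarrow> N dvd i"
  using power_eq_iff_cong[OF qN prim] N by simp

lemma qq: "(q * q) ^ N = 1" "0 < j \<Longrightarrow> j < N \<Longrightarrow> (q * q) ^ j \<noteq> 1" "q * q \<noteq> 1"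
proof -
  have *: "(q * q) ^ j = 1 \<longleftrightarrow> N dvd j" for j
  proof -
    have "(q * q) ^ j = q ^ (2 * j)" by (simp add: power_mult power2_eq_square)
    moreover have "N dvd 2 * j \<longleftrightarrow> N dvd j"
      using N by (metis coprime_dvd_mult_right_iff coprime_right_2_iff_odd)
    ultimately show ?thesis by (simp add: q_iff)
  qed
  show "(q * q) ^ N = 1" using * by simp
  show "(q * q) ^ j \<noteq> 1" if "0 < j" "j < N" using * that by (auto dest: dvd_imp_le)
  show "q * q \<noteq> 1" using *[of 1] N by simp
qed

lemma inv_power: "q ^ (N - 1) = inverse q" "inverse q ^ (N - 1) = q"
proof -
  obtain M where M: "N = Suc M" using N by (cases N) auto
  have "q * q ^ M = 1" using qN by (simp only: M power_Suc)
  then have 1: "q ^ M = inverse q" by (rule inverse_unique[symmetric])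
  then show "q ^ (N - 1) = inverse q" by (simp only: M diff_Suc_1)
  show "inverse q ^ (N - 1) = q" by (simp only: M diff_Suc_1 power_inverse 1 inverse_inverse_eq)
qed

lemma qq': "q - inverse q \<noteq> 0"
  using qq(3) by (metis eq_iff_diff_eq_0 q_nz right_inverse)

section \<open>The comultiplication respects the relations of the small quantum group\<close>

abbreviation "KU \<equiv> (gen gK :: (gen_U, 'k) free_alg)"
abbreviation "EU \<equiv> (gen gE :: (gen_U, 'k) free_alg)"
abbreviation "FU \<equiv> (gen gF :: (gen_U, 'k) free_alg)"
abbreviation "IU \<equiv> rel_ideal (relators (Uq N q))"
abbreviation "JU \<equiv> rel_ideal (tensor_relators (Uq N q))"
abbreviation "IO \<equiv> rel_ideal (relators (Oq N q))"
abbreviation "JO \<equiv> rel_ideal (tensor_relators (Oq N q))"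
abbreviation "KU' \<equiv> KU ^ (N - 1)"

lemma relators_U: "relators (Uq N q) =
  {KU ^ N - 1, KU * EU - scal (q * q) * (EU * KU), KU * FU - scal (inverse (q * q)) * (FU * KU),
   EU ^ N, FU ^ N, EU * FU - FU * EU - scal (inverse (q - inverse q)) * (KU - KU')}"
  by (simp add: Uq_def Let_def mult.assoc power2_eq_square)

lemma cop_U: "cop (Uq N q) KU = tens KU KU" "cop (Uq N q) EU = tens EU KU + tens 1 EU"
  "cop (Uq N q) FU = tens FU 1 + tens KU' FU"
  by (simp_all add: cop_gen Uq_def Let_def)

lemma KK': "KU * KU' = KU ^ N" "KU' * KU = KU ^ N"
  using N by (cases N; simp add: power_commutes)+

lemma IU_mem: "KU ^ N - 1 \<in> IU" "KU * EU - scal (q * q) * (EU * KU) \<in> IU"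
  "KU * FU - scal (inverse (q * q)) * (FU * KU) \<in> IU" "EU ^ N \<in> IU" "FU ^ N \<in> IU"
  "EU * FU - FU * EU - scal (inverse (q - inverse q)) * (KU - KU') \<in> IU"
  by (rule rel_ideal_incl; simp add: relators_U)+

sublocale IU: two_sided IU by (rule two_sided_rel_ideal)
sublocale JU: two_sided JU by (rule two_sided_rel_ideal)
sublocale IO: two_sided IO by (rule two_sided_rel_ideal)
sublocale JO: two_sided JO by (rule two_sided_rel_ideal)

lemma inv_qq: "inverse (q * q) ^ (N - 1) = q * q"
  and qq_inv: "(q * q) ^ (N - 1) = inverse (q * q)"
proof -
  obtain M where M: "N = Suc M" using N by (cases N) auto
  have *: "(q * q) * (q * q) ^ M = 1" using qq(1) by (simp only: M power_Suc)
  then have "inverse (q * q) = (q * q) ^ M" by (rule inverse_unique)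
  then show "(q * q) ^ (N - 1) = inverse (q * q)" by (simp only: M diff_Suc_1)
  have "inverse ((q * q) ^ M) = q * q" by (rule inverse_unique) (use * in \<open>simp only: mult.commute\<close>)
  then show "inverse (q * q) ^ (N - 1) = q * q" by (simp only: M diff_Suc_1 power_inverse)
qed

lemma K'F: "KU' * FU - scal (q * q) * (FU * KU') \<in> IU"
  using power_qcomm_mem[OF two_sided_rel_ideal IU_mem(3), of "N - 1"] by (simp only: inv_qq)

lemma K'E: "KU' * EU - scal (inverse (q * q)) * (EU * KU') \<in> IU"
  using power_qcomm_mem[OF two_sided_rel_ideal IU_mem(2), of "N - 1"] by (simp only: qq_inv)

lemmas tens_simps = tens_mult tens_add_left tens_add_right tens_diff_left tens_diff_right
  tens_scal_left tens_scal_right distrib_left distrib_right right_diff_distrib left_diff_distrib mult.assoc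

lemma cop_relators_U:
  assumes "r \<in> relators (Uq N q)"
  shows "cop (Uq N q) r \<in> JU"
proof -
  note T = tens_rel_ideal[where P = "Uq N q"]
  have 1: "cop (Uq N q) (KU ^ N - 1) \<in> JU"
  proof -
    have "cop (Uq N q) (KU ^ N - 1) = tens (KU ^ N - 1) (KU ^ N) + tens 1 (KU ^ N - 1)"
      by (simp add: cop_add cop_diff cop_mult cop_scal cop_one cop_power cop_U tens_power tens_diff_left tens_diff_right)
    then show ?thesis using T IU_mem(1) by auto
  qed
  have 2: "cop (Uq N q) (KU * EU - scal (q * q) * (EU * KU)) \<in> JU"
  proof -
    have "cop (Uq N q) (KU * EU - scal (q * q) * (EU * KU))
      = tens (KU * EU - scal (q * q) * (EU * KU)) (KU * KU) + tens KU (KU * EU - scal (q * q) * (EU * KU))"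
      by (simp add: cop_mult cop_diff cop_scal cop_U tens_simps)
    then show ?thesis using T IU_mem(2) by auto
  qed
  have 3: "cop (Uq N q) (KU * FU - scal (inverse (q * q)) * (FU * KU)) \<in> JU"
  proof -
    have "cop (Uq N q) (KU * FU - scal (inverse (q * q)) * (FU * KU))
      = tens (KU * FU - scal (inverse (q * q)) * (FU * KU)) KU
        + tens (KU ^ N) (KU * FU - scal (inverse (q * q)) * (FU * KU))"
      by (simp add: cop_mult cop_diff cop_scal cop_U tens_simps KK'[simplified])
    then show ?thesis using T IU_mem(3) by auto
  qed
  have 4: "cop (Uq N q) (EU ^ N) \<in> JU"
  proof -
    \<comment> \<open>The order matters: KE = q^2 EK gives YX = q^2 XY, and q^2 is a primitive N-th
      root of unity since N is odd.\<close>
    let ?X = "tens 1 EU" and ?Y = "tens EU KU"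
    have "?Y * ?X - scal (q * q) * (?X * ?Y) = tens EU (KU * EU - scal (q * q) * (EU * KU))"
      by (simp add: tens_simps)
    then have "?Y * ?X - scal (q * q) * (?X * ?Y) \<in> JU" using T IU_mem(2) by auto
    from qbinomial_primitive_root[OF two_sided_rel_ideal this qq(1,2)] N
    have "(?X + ?Y) ^ N - (?X ^ N + ?Y ^ N) \<in> JU" by auto
    moreover have "?X ^ N + ?Y ^ N \<in> JU" using T IU_mem(4) by (auto simp: tens_power)
    ultimately show ?thesis
      using JU.diff_mem_cong by (auto simp: cop_add cop_diff cop_mult cop_scal cop_one cop_power cop_U add.commute)
  qed
  have 5: "cop (Uq N q) (FU ^ N) \<in> JU"
  proof -
    let ?X = "tens FU 1" and ?Y = "tens KU' FU"
    have "?Y * ?X - scal (q * q) * (?X * ?Y) = tens (KU' * FU - scal (q * q) * (FU * KU')) FU"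
      by (simp add: tens_simps)
    then have "?Y * ?X - scal (q * q) * (?X * ?Y) \<in> JU" using T K'F by auto
    from qbinomial_primitive_root[OF two_sided_rel_ideal this qq(1,2)] N
    have "(?X + ?Y) ^ N - (?X ^ N + ?Y ^ N) \<in> JU" by auto
    moreover have "?X ^ N + ?Y ^ N \<in> JU" using T IU_mem(5) by (auto simp: tens_power)
    ultimately show ?thesis using JU.diff_mem_cong by (auto simp: cop_add cop_diff cop_mult cop_scal cop_one cop_power cop_U)
  qed
  have 6: "cop (Uq N q) (EU * FU - FU * EU - scal (inverse (q - inverse q)) * (KU - KU')) \<in> JU" (is "cop _ ?R \<in> _")
  proof -
    \<comment> \<open>The terms F \<otimes> E cancel outright. The mixed terms EK' \<otimes> KF and
      K'E \<otimes> FK both reduce to q^-2 EK' \<otimes> FK, which is the last difference.\<close>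
    have "cop (Uq N q) ?R = tens ?R KU + tens KU' ?R
      + (tens (EU * KU') (KU * FU - scal (inverse (q * q)) * (FU * KU))
         - tens (KU' * EU - scal (inverse (q * q)) * (EU * KU')) (FU * KU))"
      by (simp add: cop_add cop_diff cop_mult cop_scal cop_one cop_power cop_U tens_power tens_simps)
    moreover have "tens ?R KU \<in> JU" "tens KU' ?R \<in> JU" using T IU_mem(6) by auto
    moreover have "tens (EU * KU') (KU * FU - scal (inverse (q * q)) * (FU * KU)) \<in> JU"
      "tens (KU' * EU - scal (inverse (q * q)) * (EU * KU')) (FU * KU) \<in> JU"
      using T IU_mem(3) K'E by auto
    ultimately show ?thesis using JU.add_mem JU.diff_mem by presburger
  qed
  show ?thesis using assms 1 2 3 4 5 6 unfolding relators_U by blast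
qed

lemma ceps_relators_U:
  assumes "r \<in> relators (Uq N q)"
  shows "ceps (Uq N q) r = 0"
proof -
  have "ceps (Uq N q) KU = 1" "ceps (Uq N q) EU = 0" "ceps (Uq N q) FU = 0"
    by (simp_all add: ceps_gen Uq_def Let_def)
  then show ?thesis using assms N unfolding relators_U by (auto simp: ceps_simps)
qed

lemma comult_U: "comult (Uq N q) (quot_class (relators (Uq N q)) p) = quot_class (tensor_relators (Uq N q)) (cop (Uq N q) p)"
  by (rule comult_quot_class) (rule cop_relators_U)

lemma counit_U: "counit (Uq N q) (quot_class (relators (Uq N q)) p) = ceps (Uq N q) p"
  by (rule counit_quot_class) (rule ceps_relators_U)

section \<open>The comultiplication respects the relations of the coordinate algebra\<close>

abbreviation "aO \<equiv> (gen ga :: (gen_O, 'k) free_alg)"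
abbreviation "bO \<equiv> (gen gb :: (gen_O, 'k) free_alg)"
abbreviation "cO \<equiv> (gen gc :: (gen_O, 'k) free_alg)"
abbreviation "dO \<equiv> (gen gd :: (gen_O, 'k) free_alg)"

lemma relators_O: "relators (Oq N q) =
  {bO * aO - scal q * (aO * bO), cO * aO - scal q * (aO * cO), bO * cO - cO * bO,
   dO * bO - scal q * (bO * dO), dO * cO - scal q * (cO * dO),
   aO * dO - scal (inverse q) * (bO * cO) - 1, dO * aO - scal q * (bO * cO) - 1,
   aO ^ N - 1, dO ^ N - 1, bO ^ N, cO ^ N}"
  by (simp add: Oq_def Let_def mult.assoc)

lemma IO_mem: "bO * aO - scal q * (aO * bO) \<in> IO" "cO * aO - scal q * (aO * cO) \<in> IO"
  "bO * cO - cO * bO \<in> IO" "dO * bO - scal q * (bO * dO) \<in> IO" "dO * cO - scal q * (cO * dO) \<in> IO"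
  "aO * dO - scal (inverse q) * (bO * cO) - 1 \<in> IO" "dO * aO - scal q * (bO * cO) - 1 \<in> IO"
  "aO ^ N - 1 \<in> IO" "dO ^ N - 1 \<in> IO" "bO ^ N \<in> IO" "cO ^ N \<in> IO"
  by (rule rel_ideal_incl; simp add: relators_O)+

lemma cop_O: "cop (Oq N q) aO = tens aO aO + tens bO cO" "cop (Oq N q) bO = tens aO bO + tens bO dO"
  "cop (Oq N q) cO = tens cO aO + tens dO cO" "cop (Oq N q) dO = tens cO bO + tens dO dO"
  by (simp_all add: cop_gen Oq_def Let_def)

lemma cop_relators_O:
  assumes "r \<in> relators (Oq N q)"
  shows "cop (Oq N q) r \<in> JO"
proof -
  note T = tens_rel_ideal[where P = "Oq N q"]
  define r1 r2 r3 r4 r5 r6 r7 where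
    "r1 = bO * aO - scal q * (aO * bO)" "r2 = cO * aO - scal q * (aO * cO)" "r3 = bO * cO - cO * bO"
    "r4 = dO * bO - scal q * (bO * dO)" "r5 = dO * cO - scal q * (cO * dO)"
    "r6 = aO * dO - scal (inverse q) * (bO * cO) - 1" "r7 = dO * aO - scal q * (bO * cO) - 1"
  note r_def = this
  have I: "r1 \<in> IO" "r2 \<in> IO" "r3 \<in> IO" "r4 \<in> IO" "r5 \<in> IO" "r6 \<in> IO" "r7 \<in> IO"
    by (simp_all only: r_def IO_mem)
  \<comment> \<open>The relations serve as rewrite rules towards an ordered form, each carrying its
    relator as an explicit error term. After expansion only terms with some r1, ..., r7 in a tensor
    factor remain, and these lie in the ideal.\<close>
  have R: "bO * aO = scal q * (aO * bO) + r1" "cO * aO = scal q * (aO * cO) + r2" "cO * bO = bO * cO - r3"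
    "dO * bO = scal q * (bO * dO) + r4" "dO * cO = scal q * (cO * dO) + r5"
    "aO * dO = 1 + scal (inverse q) * (bO * cO) + r6" "dO * aO = 1 + scal q * (bO * cO) + r7"
    by (simp_all add: r_def)
  note S = cop_add cop_diff cop_mult cop_scal cop_one cop_O tens_simps scal_scal R
  note M = T(1)[OF I(1)] T(1)[OF I(2)] T(1)[OF I(3)] T(1)[OF I(4)] T(1)[OF I(5)] T(1)[OF I(6)] T(1)[OF I(7)]
    T(2)[OF I(1)] T(2)[OF I(2)] T(2)[OF I(3)] T(2)[OF I(4)] T(2)[OF I(5)] T(2)[OF I(6)] T(2)[OF I(7)]
    JO.add_mem JO.diff_mem JO.lmult_mem
  have 1: "cop (Oq N q) (bO * aO - scal q * (aO * bO)) \<in> JO"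
    by (simp add: S del: R) (auto simp: R S algebra_simps intro!: M)
  have 2: "cop (Oq N q) (cO * aO - scal q * (aO * cO)) \<in> JO"
    by (simp add: S del: R) (auto simp: R S algebra_simps intro!: M)
  have 3: "cop (Oq N q) (bO * cO - cO * bO) \<in> JO"
    by (simp add: S del: R) (auto simp: R S algebra_simps intro!: M)
  have 4: "cop (Oq N q) (dO * bO - scal q * (bO * dO)) \<in> JO"
    by (simp add: S del: R) (auto simp: R S algebra_simps intro!: M)
  have 5: "cop (Oq N q) (dO * cO - scal q * (cO * dO)) \<in> JO"
    by (simp add: S del: R) (auto simp: R S algebra_simps intro!: M)
  have 6: "cop (Oq N q) (aO * dO - scal (inverse q) * (bO * cO) - 1) \<in> JO"
    by (simp add: S del: R) (auto simp: R S algebra_simps intro!: M)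
  have 7: "cop (Oq N q) (dO * aO - scal q * (bO * cO) - 1) \<in> JO"
    by (simp add: S del: R) (auto simp: R S algebra_simps intro!: M)
  have 8: "cop (Oq N q) (aO ^ N - 1) \<in> JO"
  proof -
    \<comment> \<open>Here and in the next three cases both legs q-commute, so YX = q^2 XY and the
      N-th power of the coproduct is X^N + Y^N modulo the ideal.\<close>
    let ?X = "tens aO aO" and ?Y = "tens bO cO"
    have "?Y * ?X - scal (q * q) * (?X * ?Y) \<in> JO"
      by (simp add: S del: R) (auto simp: R S algebra_simps intro!: M)
    from qbinomial_primitive_root[OF two_sided_rel_ideal this qq(1,2)] N
    have 1: "(?X + ?Y) ^ N - (?X ^ N + ?Y ^ N) \<in> JO" by auto
    have "?X ^ N + ?Y ^ N - 1 = (tens (aO ^ N - 1) (aO ^ N) + tens 1 (aO ^ N - 1)) + tens (bO ^ N) (cO ^ N)"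
      by (simp add: tens_power tens_diff_left tens_diff_right)
    then have 2: "?X ^ N + ?Y ^ N - 1 \<in> JO" using T IO_mem(8-11) by (auto intro!: JO.add_mem)
    have "cop (Oq N q) (aO ^ N - 1) - (?X ^ N + ?Y ^ N - 1) = (?X + ?Y) ^ N - (?X ^ N + ?Y ^ N)"
      by (simp add: cop_diff cop_one cop_power cop_O)
    with 1 have "cop (Oq N q) (aO ^ N - 1) - (?X ^ N + ?Y ^ N - 1) \<in> JO" by (simp only:)
    from JO.diff_mem_cong[OF this] 2 show ?thesis by blast
  qed
  have 9: "cop (Oq N q) (dO ^ N - 1) \<in> JO"
  proof -
    let ?X = "tens cO bO" and ?Y = "tens dO dO"
    have "?Y * ?X - scal (q * q) * (?X * ?Y) \<in> JO"
      by (simp add: S del: R) (auto simp: R S algebra_simps intro!: M)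
    from qbinomial_primitive_root[OF two_sided_rel_ideal this qq(1,2)] N
    have 1: "(?X + ?Y) ^ N - (?X ^ N + ?Y ^ N) \<in> JO" by auto
    have "?X ^ N + ?Y ^ N - 1 = (tens (dO ^ N - 1) (dO ^ N) + tens 1 (dO ^ N - 1)) + tens (cO ^ N) (bO ^ N)"
      by (simp add: tens_power tens_diff_left tens_diff_right)
    then have 2: "?X ^ N + ?Y ^ N - 1 \<in> JO" using T IO_mem(8-11) by (auto intro!: JO.add_mem)
    have "cop (Oq N q) (dO ^ N - 1) - (?X ^ N + ?Y ^ N - 1) = (?X + ?Y) ^ N - (?X ^ N + ?Y ^ N)"
      by (simp add: cop_diff cop_one cop_power cop_O)
    with 1 have "cop (Oq N q) (dO ^ N - 1) - (?X ^ N + ?Y ^ N - 1) \<in> JO" by (simp only:)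
    from JO.diff_mem_cong[OF this] 2 show ?thesis by blast
  qed
  have 10: "cop (Oq N q) (bO ^ N) \<in> JO"
  proof -
    let ?X = "tens aO bO" and ?Y = "tens bO dO"
    have "?Y * ?X - scal (q * q) * (?X * ?Y) \<in> JO"
      by (simp add: S del: R) (auto simp: R S algebra_simps intro!: M)
    from qbinomial_primitive_root[OF two_sided_rel_ideal this qq(1,2)] N
    have 1: "(?X + ?Y) ^ N - (?X ^ N + ?Y ^ N) \<in> JO" by auto
    have 2: "?X ^ N + ?Y ^ N \<in> JO" unfolding tens_power using T IO_mem(10,11) by (intro JO.add_mem) auto
    have "cop (Oq N q) (bO ^ N) - (?X ^ N + ?Y ^ N) = (?X + ?Y) ^ N - (?X ^ N + ?Y ^ N)"
      by (simp add: cop_power cop_O)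
    with 1 have "cop (Oq N q) (bO ^ N) - (?X ^ N + ?Y ^ N) \<in> JO" by (simp only:)
    from JO.diff_mem_cong[OF this] 2 show ?thesis by blast
  qed
  have 11: "cop (Oq N q) (cO ^ N) \<in> JO"
  proof -
    let ?X = "tens cO aO" and ?Y = "tens dO cO"
    have "?Y * ?X - scal (q * q) * (?X * ?Y) \<in> JO"
      by (simp add: S del: R) (auto simp: R S algebra_simps intro!: M)
    from qbinomial_primitive_root[OF two_sided_rel_ideal this qq(1,2)] N
    have 1: "(?X + ?Y) ^ N - (?X ^ N + ?Y ^ N) \<in> JO" by auto
    have 2: "?X ^ N + ?Y ^ N \<in> JO" unfolding tens_power using T IO_mem(10,11) by (intro JO.add_mem) auto
    have "cop (Oq N q) (cO ^ N) - (?X ^ N + ?Y ^ N) = (?X + ?Y) ^ N - (?X ^ N + ?Y ^ N)"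
      by (simp add: cop_power cop_O)
    with 1 have "cop (Oq N q) (cO ^ N) - (?X ^ N + ?Y ^ N) \<in> JO" by (simp only:)
    from JO.diff_mem_cong[OF this] 2 show ?thesis by blast
  qed
  show ?thesis using assms 1 2 3 4 5 6 7 8 9 10 11 unfolding relators_O by blast
qed

lemma comult_O: "comult (Oq N q) (quot_class (relators (Oq N q)) p) = quot_class (tensor_relators (Oq N q)) (cop (Oq N q) p)"
  by (rule comult_quot_class) (rule cop_relators_O)

end

section \<open>The two-dimensional representation on representatives\<close>

lemma mat_mult_component [simp]: "(mat c ** M) $ i $ j = c * M $ i $ j" for M :: "'k::field ^ 'n ^ 'm"
  by (simp add: matrix_matrix_mult_def mat_def if_distrib[of "\<lambda>x. x * _"] cong: if_cong)

lemma mat_mult_component_right: "(M ** (mat c ** M')) = mat c ** (M ** M')" for M :: "'k::field ^ 'n ^ 'm"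
  by (simp add: vec_eq_iff matrix_matrix_mult_def[of M] sum_distrib_left mult.left_commute)

lemma vector_space_mat: "vector_space (\<lambda>c. (**) (mat c) :: 'k::field ^ 'n ^ 'm \<Rightarrow> _)"
  by unfold_locales (simp_all add: vec_eq_iff algebra_simps)

interpretation mat_mod: vector_space "\<lambda>c. (**) (mat c) :: 'k::field ^ 'n ^ 'm \<Rightarrow> _"
  by (rule vector_space_mat)

definition rho_lin :: "'k::field \<Rightarrow> (gen_U, 'k) free_alg \<Rightarrow> 'k ^ 2 ^ 2" where
  "rho_lin q = lin_ext (\<lambda>c M. mat c ** M) (\<lambda>w. foldr (\<lambda>x M. \<rho>_gen q x ** M) (letters w) (mat 1))"

lemma rho_lin_add: "rho_lin q (p + p') = rho_lin q p + rho_lin q p'"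
  and rho_lin_diff: "rho_lin q (p - p') = rho_lin q p - rho_lin q p'"
  by (simp_all add: rho_lin_def mat_mod.lin_ext_add mat_mod.lin_ext_diff)

lemma rho_lin_mult: "rho_lin q (p * p') = rho_lin q p ** rho_lin q p'"
  unfolding rho_lin_def
proof (rule mat_mod.lin_ext_mult)
  have "foldr (\<lambda>x M. \<rho>_gen q x ** M) v M = foldr (\<lambda>x M. \<rho>_gen q x ** M) v (mat 1) ** M" for v M
    by (induction v) (simp_all add: matrix_mul_assoc[symmetric])
  then show "foldr (\<lambda>x M. \<rho>_gen q x ** M) (letters (v + w)) (mat 1) =
    foldr (\<lambda>x M. \<rho>_gen q x ** M) (letters v) (mat 1) ** foldr (\<lambda>x M. \<rho>_gen q x ** M) (letters w) (mat 1)" for v w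
    by (simp add: plus_word_def)
  show "mat c ** x ** (mat d ** y) = mat (c * d) ** (x ** y)" for c d :: 'a and x y :: "'a ^ 2 ^ 2"
    by (simp only: mat_mult_component_right) (simp only: matrix_mul_assoc[symmetric] mat_mod.scale_scale mult.commute)
qed (simp_all add: vec_eq_iff matrix_matrix_mult_def algebra_simps sum.distrib)

lemma rho_lin_scal: "rho_lin q (scal c) = mat c"
  by (simp add: rho_lin_def scal_def zero_word_def)

lemma rho_lin_gen: "rho_lin q (gen x) = \<rho>_gen q x"
  by (simp add: rho_lin_def gen_def vec_eq_iff)

lemma rho_lin_one: "rho_lin q 1 = mat 1"
  using rho_lin_scal[of q 1] by simp

lemma mat_eq_2x2: "A = B \<longleftrightarrow> A $ 1 $ 1 = B $ 1 $ 1 \<and> A $ 1 $ 2 = B $ 1 $ 2 \<and> A $ 2 $ 1 = B $ 2 $ 1 \<and> A $ 2 $ 2 = B $ 2 $ 2"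
  for A B :: "'k ^ 2 ^ 2"
  by (auto simp: vec_eq_iff forall_2)

lemma mult_2x2: "(A ** B) $ i $ j = A $ i $ 1 * B $ 1 $ j + A $ i $ 2 * B $ 2 $ j" for A B :: "'k::field ^ 2 ^ 2"
  by (simp add: matrix_matrix_mult_def sum_2)

lemma mat_2x2: "(mat c :: 'k::field ^ 2 ^ 2) $ 1 $ 1 = c" "(mat c :: 'k::field ^ 2 ^ 2) $ 1 $ 2 = 0"
  "(mat c :: 'k::field ^ 2 ^ 2) $ 2 $ 1 = 0" "(mat c :: 'k::field ^ 2 ^ 2) $ 2 $ 2 = c"
  by (simp_all add: mat_def)

context root_of_unity
begin

lemma rho_lin_K_power: "rho_lin q (KU ^ n) = vector [vector [q ^ n, 0], vector [0, inverse q ^ n]]"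
  by (induction n)
    (simp_all add: rho_lin_one rho_lin_mult rho_lin_gen \<rho>_gen_def mat_eq_2x2 mult_2x2 mat_2x2)

lemma rho_lin_nilpotent:
  assumes "rho_lin q p ** rho_lin q p = 0"
  shows "rho_lin q (p ^ N) = 0"
proof -
  obtain M where M: "N = Suc (Suc M)" using N by (cases N; cases "N - 1") auto
  show ?thesis
    using assms by (simp add: M rho_lin_mult matrix_mul_assoc)
qed

lemma rho_lin_relators:
  assumes "r \<in> relators (Uq N q)"
  shows "rho_lin q r = 0"
proof -
  have iN: "inverse q ^ N = 1" using qN by (simp add: power_inverse)
  note S = rho_lin_diff rho_lin_mult rho_lin_gen rho_lin_one rho_lin_scal \<rho>_gen_def mat_eq_2x2 mult_2x2 mat_2x2
  have "rho_lin q (KU ^ N - 1) = 0"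
    by (simp add: S rho_lin_K_power qN iN del: power_inverse)
  moreover have "rho_lin q (KU * EU - scal (q * q) * (EU * KU)) = 0" by (simp add: S)
  moreover have "rho_lin q (KU * FU - scal (inverse (q * q)) * (FU * KU)) = 0" by (simp add: S)
  moreover have "rho_lin q (EU ^ N) = 0" "rho_lin q (FU ^ N) = 0"
    by (rule rho_lin_nilpotent; simp add: S)+
  moreover have "rho_lin q (EU * FU - FU * EU - scal (inverse (q - inverse q)) * (KU - KU')) = 0"
  proof -
    define e where "e = q - inverse q"
    have e: "inverse e * e = 1" using qq' by (simp add: e_def)
    have e': "inverse q - q = - e" by (simp add: e_def)
    have "rho_lin q (EU * FU - FU * EU - scal (inverse e) * (KU - KU')) =
      rho_lin q EU ** rho_lin q FU - rho_lin q FU ** rho_lin q EU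
        - mat (inverse e) ** (rho_lin q (KU ^ 1) - rho_lin q KU')"
      by (simp only: rho_lin_diff rho_lin_mult rho_lin_scal power_one_right)
    also have "\<dots> = 0"
      unfolding rho_lin_K_power inv_power
      by (simp add: rho_lin_gen \<rho>_gen_def mat_eq_2x2 mult_2x2 mat_2x2 e e' flip: e_def)
    finally show ?thesis by (simp only: e_def)
  qed
  ultimately show ?thesis using assms unfolding relators_U by blast
qed

lemma rho_quot_class: "\<rho> q (quot_class (relators (Uq N q)) p) = rho_lin q p"
proof -
  have *: "two_sided {p. rho_lin q p = 0}"
    by unfold_locales (auto simp: rho_lin_add rho_lin_mult mat_eq_2x2 mult_2x2 rho_lin_scal[of q 0, simplified] mat_2x2)
  have "IU \<subseteq> {p. rho_lin q p = 0}" using rho_lin_relators by (intro rel_ideal_minimal[OF *]) auto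
  then show ?thesis
    unfolding \<rho>_def rho_lin_def[symmetric]
    by (intro the_elem_image_quot_class_hom) (auto simp: rho_lin_diff)
qed

end

section \<open>The embedding into the convolution algebra\<close>

locale dual_iso = root_of_unity N q for N and q :: "'k::field_char_0" +
  fixes \<phi> :: "(gen_O, 'k) free_alg set \<Rightarrow> (gen_U, 'k) free_alg set \<Rightarrow> 'k"
  assumes hopf: "hopf_iso N q \<phi>"
begin

section \<open>The pairing on representatives\<close>

abbreviation "U \<equiv> alg (Uq N q)"
abbreviation "H \<equiv> alg (Oq N q)"
abbreviation "cu \<equiv> quot_class (relators (Uq N q))"
abbreviation "co \<equiv> quot_class (relators (Oq N q))"

lemma carrier_alg: "carrier (alg P) = range (quot_class (relators P))"
  by (simp add: alg_def carrier_quot_alg)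

lemma alg_ops: "\<one>\<^bsub>alg P\<^esub> = quot_class (relators P) 1"
  "quot_class (relators P) p \<oplus>\<^bsub>alg P\<^esub> quot_class (relators P) p' = quot_class (relators P) (p + p')"
  "quot_class (relators P) p \<otimes>\<^bsub>alg P\<^esub> quot_class (relators P) p' = quot_class (relators P) (p * p')"
  "c \<odot>\<^bsub>alg P\<^esub> quot_class (relators P) p = quot_class (relators P) (scal c * p)"
  "\<ominus>\<^bsub>alg P\<^esub> quot_class (relators P) p = quot_class (relators P) (- p)"
  "quot_class (relators P) p [^]\<^bsub>alg P\<^esub> (n::nat) = quot_class (relators P) (p ^ n)"
  by (simp_all add: alg_def one_quot_alg add_quot_alg mult_quot_alg smult_quot_alg uminus_quot_alg power_quot_alg)

lemma iso: "bialg_iso_dual (Oq N q) (Uq N q) \<phi>"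
  using hopf by (simp add: hopf_iso_def)

lemma phi_dual: "\<phi> (co p) \<in> dual U"
  using iso by (auto simp: bialg_iso_dual_def bij_betw_def carrier_alg)

lemma phi_cong: "(\<And>s. \<phi> (co p) (cu s) = \<phi> (co p') (cu s)) \<Longrightarrow> co p = co p'"
proof -
  assume *: "\<And>s. \<phi> (co p) (cu s) = \<phi> (co p') (cu s)"
  have "\<phi> (co p) = \<phi> (co p')"
    by (rule extensionalityI[of _ "carrier U"])
      (use phi_dual * in \<open>auto simp: dual_def carrier_alg\<close>)
  then show ?thesis using iso by (auto simp: bialg_iso_dual_def bij_betw_def inj_on_def carrier_alg)
qed

lemma lin_fun_right: "lin_fun (Uq N q) (\<phi> (co p))"
  using phi_dual[of p] by (auto simp: dual_def lin_fun_def carrier_alg alg_ops)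

lemma lin_fun_left: "lin_fun (Oq N q) (\<lambda>f. \<phi> f (cu s))"
  using iso by (auto simp: bialg_iso_dual_def lin_fun_def carrier_alg alg_ops simp flip: alg_ops(2,4))

lemma phi_mult: "\<phi> (co (p * p')) (cu s) = bil (Uq N q) (\<phi> (co p)) (\<phi> (co p')) (cop (Uq N q) s)"
proof -
  have "\<phi> (co p \<otimes>\<^bsub>H\<^esub> co p') (cu s) = apply_both (Uq N q) (\<phi> (co p)) (\<phi> (co p')) (comult (Uq N q) (cu s))"
    using iso unfolding bialg_iso_dual_def carrier_alg by blast
  then show ?thesis by (simp add: alg_ops comult_U apply_both_quot_class lin_fun_right)
qed

lemma phi_one: "\<phi> (co 1) (cu s) = ceps (Uq N q) s"
proof -
  have "\<phi> \<one>\<^bsub>H\<^esub> (cu s) = counit (Uq N q) (cu s)"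
    using iso unfolding bialg_iso_dual_def carrier_alg by blast
  then show ?thesis by (simp add: alg_ops counit_U)
qed

lemma act_co: "act N q \<phi> (co p) (cu s) = co (slice (Oq N q) (\<lambda>g. \<phi> g (cu s)) (cop (Oq N q) p))"
  by (simp add: act_def comult_O apply_left_quot_class lin_fun_left)

lemma phi_act: "\<phi> (act N q \<phi> (co p) (cu s)) (cu t) = \<phi> (co p) (cu (s * t))"
proof -
  have "\<phi> (co p) (cu s \<otimes>\<^bsub>U\<^esub> cu t) = apply_both (Oq N q) (\<lambda>g. \<phi> g (cu s)) (\<lambda>g. \<phi> g (cu t)) (comult (Oq N q) (co p))"
    using iso unfolding bialg_iso_dual_def carrier_alg by blast
  then show ?thesis
    by (simp add: alg_ops comult_O apply_both_quot_class lin_fun_left act_co bil_slice[OF lin_fun_left lin_fun_left])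
qed

section \<open>Evaluation on words in K, E and G\<close>

definition ltr :: "letter \<Rightarrow> (gen_U, 'k) free_alg" where
  "ltr x = (case x of LK \<Rightarrow> KU | LE \<Rightarrow> EU | LG \<Rightarrow> scal (q - inverse q) * (KU * FU))"

definition lprod :: "letter list \<Rightarrow> (gen_U, 'k) free_alg" where
  "lprod w = prod_list (map ltr w)"

lemma lprod_simps [simp]: "lprod [] = 1" "lprod (x # w) = ltr x * lprod w"
  by (simp_all add: lprod_def)

lemma cop_ltr_K: "cop (Uq N q) (ltr LK) = tens (ltr LK) (ltr LK)"
  by (simp add: ltr_def cop_U)

lemma bil_K: "lin_fun (Uq N q) g \<Longrightarrow> lin_fun (Uq N q) h \<Longrightarrow>
    bil (Uq N q) g h (cop (Uq N q) (ltr LK * s))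
    = bil (Uq N q) (\<lambda>X. g (cu (ltr LK) \<otimes>\<^bsub>U\<^esub> X)) (\<lambda>X. h (cu (ltr LK) \<otimes>\<^bsub>U\<^esub> X)) (cop (Uq N q) s)"
  by (simp add: cop_mult cop_ltr_K bil_lmult)

lemma cu_KK': "cu (KU * KU') = cu 1"
  using IU_mem(1) by (simp only: quot_class_eq_iff KK')

lemma bil_skew:
  assumes g: "lin_fun (Uq N q) g" and h: "lin_fun (Uq N q) h" and x: "x \<noteq> LK"
  shows "bil (Uq N q) g h (cop (Uq N q) (ltr x * s))
    = bil (Uq N q) (\<lambda>X. g (cu (ltr x) \<otimes>\<^bsub>U\<^esub> X)) (\<lambda>X. h (cu (ltr LK) \<otimes>\<^bsub>U\<^esub> X)) (cop (Uq N q) s)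
      + bil (Uq N q) g (\<lambda>X. h (cu (ltr x) \<otimes>\<^bsub>U\<^esub> X)) (cop (Uq N q) s)"
proof -
  \<comment> \<open>Translation by the unit need not leave g unchanged off the carrier, so the two
    functionals are compared only inside \<open>bil\<close>.\<close>
  have 1: "bil (Uq N q) (\<lambda>X. g (cu 1 \<otimes>\<^bsub>U\<^esub> X)) h' t = bil (Uq N q) g h' t" if h': "lin_fun (Uq N q) h'" for h' t
    by (rule tens_eqI[where f = "bil _ _ _"])
      (simp_all add: bil_add bil_tens[OF lin_fun_lmult[OF g] h'] bil_tens[OF g h'] alg_ops)
  show ?thesis
  proof (cases x)
    case LE
    then show ?thesis
      by (simp add: ltr_def cop_mult cop_U distrib_right bil_add bil_lmult g h 1 lin_fun_lmult)
  next
    case LG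
    let ?\<kappa> = "q - inverse q"
    \<comment> \<open>The factor K K^(N-1) is 1 only modulo the relators. It becomes the unit once a
      functional is applied to its class.\<close>
    have "cop (Uq N q) (ltr LG) = tens (ltr LG) KU + tens (KU * KU') (ltr LG)"
      by (simp add: ltr_def cop_mult cop_scal cop_U tens_mult distrib_left tens_scal_left tens_scal_right)
    then show ?thesis using LG cu_KK'
      by (simp add: cop_mult distrib_right bil_add bil_lmult g h 1 lin_fun_lmult) (simp add: ltr_def)
  qed (use x in simp)
qed

text \<open>This matches the product of the dual with \<open>cmul\<close>. The functionals are
  arbitrary because every letter replaces them by translates.\<close>

lemma bil_lprod:
  assumes "lin_fun (Uq N q) g" "lin_fun (Uq N q) h"
  shows "bil (Uq N q) g h (cop (Uq N q) (lprod w)) = cmul w (\<lambda>v. g (cu (lprod v))) (\<lambda>v. h (cu (lprod v)))"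
  using assms
proof (induction w arbitrary: g h)
  case Nil
  then show ?case using bil_tens[OF Nil, of 1 1] by (simp add: cop_one)
next
  case (Cons x w)
  show ?case
  proof (cases "x = LK")
    case True
    then show ?thesis
      using Cons by (simp add: bil_K lin_fun_lmult alg_ops)
  next
    case False
    then show ?thesis
      using Cons by (simp add: bil_skew lin_fun_lmult alg_ops)
  qed
qed

text \<open>The dual form of the statement that words in K, E, G span the algebra; it makes the
  embedding into functions on words injective. The missing generator F is (q - q^-1)^-1 K^(N-1)
  G.\<close>

lemma lprod_total:
  assumes "lin_fun (Uq N q) g" "\<And>w. g (cu (lprod w)) = 0"
  shows "g (cu s) = 0"
proof -
  \<comment> \<open>Quantifying over all functionals makes the set stable under left multiplication
    by a letter, which passes to a translate of g.\<close>
  let ?Z = "{s. \<forall>g. lin_fun (Uq N q) g \<longrightarrow> (\<forall>w. g (cu (lprod w)) = 0) \<longrightarrow> g (cu s) = 0}"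
  have ltr: "ltr x * s \<in> ?Z" if s: "s \<in> ?Z" for x s
  proof (intro CollectI allI impI)
    fix g assume g: "lin_fun (Uq N q) g" "\<forall>w. g (cu (lprod w)) = 0"
    have "g (cu (ltr x) \<otimes>\<^bsub>U\<^esub> cu (lprod w)) = 0" for w
      using g(2)[rule_format, of "x # w"] by (simp add: alg_ops)
    then have "g (cu (ltr x) \<otimes>\<^bsub>U\<^esub> cu s) = 0" using s lin_fun_lmult[OF g(1)] by blast
    then show "g (cu (ltr x * s)) = 0" by (simp add: alg_ops)
  qed
  have K: "KU * s \<in> ?Z" and E: "EU * s \<in> ?Z" if "s \<in> ?Z" for s
    using ltr[OF that, of LK] ltr[OF that, of LE] by (simp_all add: ltr_def)
  have Kn: "KU ^ n * s \<in> ?Z" if "s \<in> ?Z" for s n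
    using that by (induction n) (simp_all only: power_0 mult_1_left power_Suc mult.assoc K)
  have F: "FU * s \<in> ?Z" if s: "s \<in> ?Z" for s
  proof -
    have "KU' * (ltr LG * s) \<in> ?Z" by (rule Kn[OF ltr[OF s]])
    moreover have "KU' * (ltr LG * s) = scal (q - inverse q) * (KU ^ N * FU * s)"
    proof -
      have "KU' * (ltr LG * s) = KU' * (scal (q - inverse q) * (KU * (FU * s)))"
        by (simp only: ltr_def letter.case mult.assoc)
      also have "\<dots> = scal (q - inverse q) * (KU' * (KU * (FU * s)))" by (rule scal_left_commute)
      also have "KU' * (KU * (FU * s)) = KU ^ N * FU * s" by (simp only: mult.assoc[symmetric] KK')
      finally show ?thesis .
    qed
    ultimately have *: "scal (q - inverse q) * (KU ^ N * FU * s) \<in> ?Z" by simp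
    have "KU ^ N * (FU * s) - 1 * (FU * s) \<in> IU" by (rule IU.mult_diff_mem[OF IU_mem(1)]) simp
    then have "cu (KU ^ N * FU * s) = cu (FU * s)" by (simp add: quot_class_eq_iff mult.assoc)
    then have "cu (scal (q - inverse q) * (KU ^ N * FU * s)) = cu (scal (q - inverse q) * (FU * s))"
      by (metis alg_ops(4))
    then show ?thesis using * qq' by (auto simp: lin_funD(2))
  qed
  have word: "sgl (Word l) 1 \<in> ?Z" for l
  proof (induction l)
    case Nil
    have "sgl (Word []) 1 = lprod []" by (simp add: zero_word_def[symmetric])
    then show ?case by (simp only:) blast
  next
    case (Cons x l)
    have "sgl (Word (x # l)) (1 :: 'k) = gen x * sgl (Word l) 1" by (simp add: gen_def mult_single plus_word_def)
    then show ?case using K[OF Cons] E[OF Cons] F[OF Cons] by (cases x) simp_all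
  qed
  have "g (cu (sgl v c)) = 0" for v c
    using word[of "letters v"] assms lin_funD(2)[OF assms(1), of c "sgl v 1"] by (simp add: scal_mult_single)
  then show ?thesis
    using additive_eqI[of "\<lambda>s. g (cu s)" "\<lambda>_. 0" s] lin_funD(1)[OF assms(1)] by simp
qed

section \<open>The embedding and the action in the convolution algebra\<close>

definition conv_of :: "(gen_O, 'k) free_alg set \<Rightarrow> 'k conv" where
  "conv_of f = Conv (\<lambda>w. \<phi> f (cu (lprod w)))"

abbreviation "Fo p \<equiv> conv_of (co p)"

lemma coef_conv_of: "coef (conv_of f) w = \<phi> f (cu (lprod w))"
  by (simp add: conv_of_def)

lemma Fo_add: "Fo (p + p') = Fo p + Fo p'" and Fo_scal: "Fo (scal c * p) = cscale c (Fo p)"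
  using lin_funD[OF lin_fun_left] by (auto intro!: conv_eqI simp: coef_conv_of)

lemma Fo_mult: "Fo (p * p') = Fo p * Fo p'"
  by (rule conv_eqI) (simp add: coef_conv_of phi_mult bil_lprod lin_fun_right conv_of_def)

lemma Fo_one: "Fo 1 = 1"
proof (rule conv_eqI)
  have "ceps (Uq N q) (lprod w) = ceval w" for w
  proof (induction w)
    case (Cons x w)
    then show ?case
      by (cases x) (simp_all add: ceps_mult ceps_scal ltr_def ceps_gen Uq_def Let_def)
  qed (simp add: ceps_one)
  then show "coef (Fo 1) w = coef 1 w" for w by (simp add: coef_conv_of phi_one)
qed

lemma Fo_uminus: "Fo (- p) = - Fo p"
  using Fo_add[of p "- p"] Fo_scal[of 0 p]
  by (simp add: eq_neg_iff_add_eq_0 add.commute) (auto intro!: conv_eqI)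

lemma Fo_diff: "Fo (p - p') = Fo p - Fo p'"
  using Fo_add[of p "- p'"] by (simp add: Fo_uminus)

lemma Fo_power: "Fo (p ^ n) = Fo p ^ n"
  by (induction n) (simp_all add: Fo_one Fo_mult)

lemma Fo_eq_iff: "Fo p = Fo p' \<longleftrightarrow> co p = co p'"
proof
  assume eq: "Fo p = Fo p'"
  show "co p = co p'"
  proof (rule phi_cong)
    fix s
    have "(\<lambda>X. \<phi> (co p) X - \<phi> (co p') X) (cu s) = 0"
    proof (rule lprod_total)
      show "lin_fun (Uq N q) (\<lambda>X. \<phi> (co p) X - \<phi> (co p') X)"
        using lin_fun_right[of p] lin_fun_right[of p'] by (simp add: lin_fun_def right_diff_distrib)
      show "\<phi> (co p) (cu (lprod w)) - \<phi> (co p') (cu (lprod w)) = 0" for w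
        using arg_cong[OF eq, of "\<lambda>f. coef f w"] by (simp add: coef_conv_of)
    qed
    then show "\<phi> (co p) (cu s) = \<phi> (co p') (cu s)" by simp
  qed
qed simp

lemma Fo_rel: "p - p' \<in> IO \<Longrightarrow> Fo p = Fo p'"
  by (simp add: Fo_eq_iff quot_class_eq_iff)

lemma coef_Fo_act: "coef (conv_of (act N q \<phi> (co p) (cu s))) w = \<phi> (co p) (cu (s * lprod w))"
  by (simp add: coef_conv_of phi_act)

lemma Fo_act_ltr: "conv_of (act N q \<phi> (co p) (cu (ltr x))) = shift x (Fo p)"
  by (rule conv_eqI) (simp add: coef_Fo_act, simp add: coef_conv_of)

lemma Fo_act_K_power: "conv_of (act N q \<phi> (co p) (cu (KU ^ r))) = (shift LK ^^ r) (Fo p)"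
proof (rule conv_eqI)
  have "coef ((shift LK ^^ r) F) w = coef F (replicate r LK @ w)" for F :: "'k conv" and r w
    by (induction r arbitrary: w) (simp_all add: replicate_app_Cons_same)
  moreover have "lprod (replicate r LK @ w) = KU ^ r * lprod w" for r w
    by (induction r) (simp_all add: mult.assoc ltr_def)
  ultimately show "coef (conv_of (act N q \<phi> (co p) (cu (KU ^ r)))) w = coef ((shift LK ^^ r) (Fo p)) w" for w
    by (simp only: coef_Fo_act) (simp only: coef_conv_of)
qed

lemma Fo_act_add: "conv_of (act N q \<phi> (co p) (cu (s + t)))
    = conv_of (act N q \<phi> (co p) (cu s)) + conv_of (act N q \<phi> (co p) (cu t))"
  and Fo_act_scal: "conv_of (act N q \<phi> (co p) (cu (scal c * s)))
    = cscale c (conv_of (act N q \<phi> (co p) (cu s)))"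
  by (rule conv_eqI; simp add: coef_Fo_act distrib_right mult.assoc lin_funD[OF lin_fun_right])+

section \<open>Invariance and its reduction to generators\<close>

definition inv_under :: "(gen_O, 'k) free_alg \<Rightarrow> (gen_U, 'k) free_alg \<Rightarrow> bool" where
  "inv_under p s \<longleftrightarrow> act N q \<phi> (co p) (cu s) = counit (Uq N q) (cu s) \<odot>\<^bsub>H\<^esub> co p"

text \<open>In this form it is evident that the s leaving p invariant are closed under sums and
  products: for s s' the condition is applied first to s, with argument s' t, and then to
  s'.\<close>

lemma inv_under_iff: "inv_under p s \<longleftrightarrow> (\<forall>t. \<phi> (co p) (cu (s * t)) = ceps (Uq N q) s * \<phi> (co p) (cu t))"
proof -
  have sc: "\<phi> (co (scal c * p)) (cu t) = c * \<phi> (co p) (cu t)" for c t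
    using lin_funD(2)[OF lin_fun_left] .
  have "co p1 = co p2 \<longleftrightarrow> (\<forall>t. \<phi> (co p1) (cu t) = \<phi> (co p2) (cu t))" for p1 p2
    using phi_cong by metis
  then show ?thesis
    using phi_act[of p s] by (simp add: inv_under_def alg_ops counit_U act_co sc)
qed

lemma inv_under_conv: "inv_under p s \<longleftrightarrow> conv_of (act N q \<phi> (co p) (cu s)) = cscale (ceps (Uq N q) s) (Fo p)"
  unfolding inv_under_def alg_ops counit_U act_co Fo_scal[symmetric] by (simp add: Fo_eq_iff)

lemma dagger_subalg:
  "co p \<in> dagger N q \<phi> (subalg U (cu ` S)) \<longleftrightarrow> (\<forall>s\<in>S. inv_under p s)"
proof
  assume "co p \<in> dagger N q \<phi> (subalg U (cu ` S))"
  then show "\<forall>s\<in>S. inv_under p s"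
    by (auto simp: dagger_def inv_under_def subalg_def intro: generate_ring.incl)
next
  assume S: "\<forall>s\<in>S. inv_under p s"
  have "\<exists>s. u = cu s \<and> inv_under p s" if "u \<in> subalg U (cu ` S)" for u
    using that unfolding subalg_def
  proof (induction rule: generate_ring.induct)
    case one
    show ?case by (rule exI[of _ 1]) (simp add: alg_ops inv_under_iff ceps_one)
  next
    case (incl h)
    then show ?case
    proof
      assume "h \<in> range (\<lambda>c. c \<odot>\<^bsub>U\<^esub> \<one>\<^bsub>U\<^esub>)"
      then obtain c where "h = cu (scal c)" by (auto simp: alg_ops)
      then show ?thesis
        by (intro exI[of _ "scal c"]) (simp add: inv_under_iff ceps_scal lin_funD[OF lin_fun_right])
    qed (use S in auto)
  next
    case (a_inv h)
    then obtain s where s: "h = cu s" "inv_under p s" by blast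
    have "\<phi> (co p) (cu (- t)) = - \<phi> (co p) (cu t)" for t
      using lin_funD(2)[OF lin_fun_right, of p "-1" t] by (simp add: scal_uminus)
    moreover have "ceps (Uq N q) (- s) = - ceps (Uq N q) s"
      using ceps_diff[of "Uq N q" 0 s] ceps_diff[of "Uq N q" 0 0] by simp
    ultimately show ?case using s by (intro exI[of _ "- s"]) (simp add: alg_ops inv_under_iff)
  next
    case (eng_add h1 h2)
    then obtain s t where "h1 = cu s" "inv_under p s" "h2 = cu t" "inv_under p t" by blast
    then show ?case
      by (intro exI[of _ "s + t"]) (simp add: alg_ops inv_under_iff ceps_add distrib_right lin_funD[OF lin_fun_right])
  next
    case (eng_mult h1 h2)
    then obtain s t where "h1 = cu s" "inv_under p s" "h2 = cu t" "inv_under p t" by blast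
    then show ?case
      by (intro exI[of _ "s * t"]) (simp add: alg_ops inv_under_iff ceps_mult mult.assoc)
  qed
  then show "co p \<in> dagger N q \<phi> (subalg U (cu ` S))"
    by (auto simp: dagger_def carrier_alg inv_under_def)
qed

lemma dagger_carrier: "co p \<in> dagger N q \<phi> (carrier U) \<longleftrightarrow> (\<forall>s. inv_under p s)"
  by (auto simp: dagger_def carrier_alg inv_under_def)

lemma dagger_in_carrier: "f \<in> dagger N q \<phi> A \<Longrightarrow> \<exists>p. f = co p"
  by (auto simp: dagger_def carrier_alg)

section \<open>The generators a, b, c, d and the two halves\<close>

abbreviation "a \<equiv> Fo aO"
abbreviation "b \<equiv> Fo bO"
abbreviation "c \<equiv> Fo cO"
abbreviation "d \<equiv> Fo dO"

lemma relations: "b * a = cscale q (a * b)" "c * a = cscale q (a * c)" "b * c = c * b"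
  "d * b = cscale q (b * d)" "d * c = cscale q (c * d)" "a * d = 1 + cscale (inverse q) (b * c)"
  "d * a = 1 + cscale q (b * c)" "a ^ N = 1" "d ^ N = 1" "b ^ N = 0" "c ^ N = 0"
proof -
  have 0: "Fo 0 = 0" using Fo_diff[of 0 0] by simp
  note H = Fo_mult[symmetric] Fo_scal[symmetric] Fo_power[symmetric] Fo_one[symmetric] Fo_add[symmetric]
  show "b * a = cscale q (a * b)" "c * a = cscale q (a * c)" "b * c = c * b"
    "d * b = cscale q (b * d)" "d * c = cscale q (c * d)"
    unfolding H by (intro Fo_rel IO_mem)+
  show "a ^ N = 1" "d ^ N = 1" unfolding H by (intro Fo_rel IO_mem)+
  show "b ^ N = 0" "c ^ N = 0" unfolding H 0[symmetric] using IO_mem(10,11) by (auto intro!: Fo_rel)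
  show "a * d = 1 + cscale (inverse q) (b * c)" "d * a = 1 + cscale q (b * c)"
    unfolding H using IO_mem(6,7) by (auto intro!: Fo_rel simp: algebra_simps)
qed

lemma phi_gen: "\<phi> (co aO) (cu s) = rho_lin q s $ 1 $ 1" "\<phi> (co bO) (cu s) = rho_lin q s $ 1 $ 2"
  "\<phi> (co cO) (cu s) = rho_lin q s $ 2 $ 1" "\<phi> (co dO) (cu s) = rho_lin q s $ 2 $ 2"
proof -
  have "vector [vector [\<phi> (co aO) (cu s), \<phi> (co bO) (cu s)], vector [\<phi> (co cO) (cu s), \<phi> (co dO) (cu s)]] = rho_lin q s"
    using hopf unfolding hopf_iso_def carrier_alg gen_class_def by (auto simp: rho_quot_class)
  from arg_cong[OF this, of "\<lambda>M. M $ 1 $ 1"] arg_cong[OF this, of "\<lambda>M. M $ 1 $ 2"]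
    arg_cong[OF this, of "\<lambda>M. M $ 2 $ 1"] arg_cong[OF this, of "\<lambda>M. M $ 2 $ 2"]
  show "\<phi> (co aO) (cu s) = rho_lin q s $ 1 $ 1" "\<phi> (co bO) (cu s) = rho_lin q s $ 1 $ 2"
    "\<phi> (co cO) (cu s) = rho_lin q s $ 2 $ 1" "\<phi> (co dO) (cu s) = rho_lin q s $ 2 $ 2"
    by simp_all
qed

text \<open>The action on the matrix of generators is left multiplication by \<rho>. The factor (q -
  q^-1) q^-1 is the only nonzero entry of the image of G, the q^-1 coming from K acting after
  F.\<close>

lemma shift_gens:
  "shift LK a = cscale q a" "shift LK b = cscale q b"
  "shift LK c = cscale (inverse q) c" "shift LK d = cscale (inverse q) d"
  "shift LE a = c" "shift LE b = d" "shift LE c = 0" "shift LE d = 0"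
  "shift LG a = 0" "shift LG b = 0"
  "shift LG c = cscale ((q - inverse q) * inverse q) a" "shift LG d = cscale ((q - inverse q) * inverse q) b"
  by (rule conv_eqI; simp add: coef_conv_of phi_gen rho_lin_mult ltr_def rho_lin_gen \<rho>_gen_def
      rho_lin_scal mult_2x2 mat_2x2 mult.assoc)+

sublocale E: quantum_half cscale "shift LK" "shift LE" b c d q 1 N
proof (rule quantum_half.intro)
  show "skew_der cscale (shift LK) (shift LE :: 'k conv \<Rightarrow> _)" by (rule skew_der_shift) simp
  have "cscale 1 f = f" for f :: "'k conv" by (rule conv_eqI) simp
  then show "quantum_half_axioms cscale (shift LK) (shift LE) b c d q 1 N"
    by unfold_locales (use relations N qN prim in \<open>simp_all add: shift_gens\<close>)
qed

text \<open>Exchanging a with d and b with c carries the relations of the coordinate algebra to the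
  same relations with q inverted, so the second half is an instance with \<omega> = q^-1.\<close>

sublocale G: quantum_half cscale "shift LK" "shift LG" c b a "inverse q" "(q - inverse q) * inverse q" N
proof (rule quantum_half.intro)
  show "skew_der cscale (shift LK) (shift LG :: 'k conv \<Rightarrow> _)" by (rule skew_der_shift) simp
  have inv: "cscale (inverse q) (cscale q f) = f" for f by (simp add: E.scale_scale)
  show "quantum_half_axioms cscale (shift LK) (shift LG) c b a (inverse q) ((q - inverse q) * inverse q) N"
  proof
    show "a * c = cscale (inverse q) (c * a)" "a * b = cscale (inverse q) (b * a)"
      unfolding relations(1,2) inv by simp_all
    show "(q - inverse q) * inverse q \<noteq> 0" using qq' by simp
    show "inverse q ^ m \<noteq> 1" if "0 < m" "m < N" for m using prim[OF that] by (simp add: power_inverse)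
  qed (use relations N qN in \<open>simp_all add: shift_gens power_inverse\<close>)
qed

lemma Fo_gen_alg: "Fo p \<in> E.gen_alg {a, b, c, d}"
proof -
  have word: "Fo (sgl (Word l) 1) \<in> E.gen_alg {a, b, c, d}" for l
  proof (induction l)
    case Nil
    have "(sgl (Word []) 1 :: (gen_O, 'k) free_alg) = 1" by (simp add: zero_word_def[symmetric])
    then show ?case by (simp add: Fo_one)
  next
    case (Cons x l)
    have "sgl (Word (x # l)) (1 :: 'k) = gen x * sgl (Word l) 1"
      by (simp add: gen_def mult_single plus_word_def)
    moreover have "Fo (gen x) \<in> E.gen_alg {a, b, c, d}" by (cases x) (auto intro: E.gen_alg.incl)
    ultimately show ?case using Cons by (simp add: Fo_mult E.gen_alg.mult)
  qed
  have sgl: "Fo (sgl v k) \<in> E.gen_alg {a, b, c, d}" for v k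
    using E.gen_alg.scale[OF word[of "letters v"], of k] by (simp add: scal_mult_single flip: Fo_scal)
  have *: "Fo (\<Sum>v\<in>S. sgl v (lk p v)) \<in> E.gen_alg {a, b, c, d}" if "finite S" for S
    using that
  proof (induction rule: finite_induct)
    case empty
    have "Fo 0 = 0" using Fo_diff[of 0 0] by simp
    then show ?case by simp
  qed (auto simp: Fo_add sgl)
  show ?thesis by (subst poly_mapping_sum_single[of p]) (rule *[OF finite_keys])
qed

text \<open>The determinant relation times d^-1; thus b, c, d generate everything and the results on
  \<open>E.M\<close> apply to all elements.\<close>

lemma a_in: "a \<in> E.M"
proof -
  have "a = (a * d) * E.t'" by (simp add: mult.assoc E.tt')
  also have "\<dots> = (1 + cscale (inverse q) (b * c)) * E.t'" by (simp only: relations)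
  finally have "a = (1 + cscale (inverse q) (b * c)) * E.t'" .
  moreover have "(1 + cscale (inverse q) (b * c)) * E.t' \<in> E.M"
    unfolding E.t'_def
    by (intro E.gen_alg.mult E.gen_alg.add E.gen_alg.scale E.gen_alg_power E.gen_alg.one)
      (auto intro: E.gen_alg.incl)
  ultimately show ?thesis by simp
qed

lemma d_in: "d \<in> G.M"
proof -
  have "d = (d * a) * G.t'" by (simp add: mult.assoc G.tt')
  also have "\<dots> = (1 + cscale q (b * c)) * G.t'" by (simp only: relations)
  finally have "d = (1 + cscale q (b * c)) * G.t'" .
  moreover have "(1 + cscale q (b * c)) * G.t' \<in> G.M"
    unfolding G.t'_def
    by (intro G.gen_alg.mult G.gen_alg.add G.gen_alg.scale G.gen_alg_power G.gen_alg.one)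
      (auto intro: G.gen_alg.incl)
  ultimately show ?thesis by simp
qed

lemma Fo_E: "Fo p \<in> E.M"
proof -
  have "E.gen_alg {a, b, c, d} \<subseteq> E.M"
    using a_in by (intro E.gen_alg_mono) (auto intro: E.gen_alg.incl)
  then show ?thesis using Fo_gen_alg by blast
qed

lemma Fo_G: "Fo p \<in> G.M"
proof -
  have "G.gen_alg {a, b, c, d} \<subseteq> G.M"
    using d_in by (intro G.gen_alg_mono) (auto intro: G.gen_alg.incl)
  then show ?thesis using Fo_gen_alg by blast
qed

section \<open>Generated subalgebras and invariance conditions under the embedding\<close>

lemma subalg_iff: "co p \<in> subalg H (co ` T) \<longleftrightarrow> Fo p \<in> E.gen_alg (Fo ` T)"
proof
  have "\<exists>p. f = co p \<and> Fo p \<in> E.gen_alg (Fo ` T)" if "f \<in> subalg H (co ` T)" for f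
    using that unfolding subalg_def
  proof (induction rule: generate_ring.induct)
    case one
    show ?case by (rule exI[of _ 1]) (simp add: alg_ops Fo_one)
  next
    case (incl h)
    then show ?case
    proof
      assume "h \<in> range (\<lambda>c. c \<odot>\<^bsub>H\<^esub> \<one>\<^bsub>H\<^esub>)"
      then obtain k where "h = k \<odot>\<^bsub>H\<^esub> \<one>\<^bsub>H\<^esub>" by blast
      then show ?thesis
        by (intro exI[of _ "scal k * 1"]) (simp only: alg_ops Fo_scal Fo_one, auto)
    qed (auto intro: E.gen_alg.incl)
  next
    case (a_inv h)
    then obtain p where "h = co p" "Fo p \<in> E.gen_alg (Fo ` T)" by blast
    then show ?case
      using E.gen_alg_diff[of 0 "Fo ` T" "Fo p"] by (intro exI[of _ "- p"]) (simp add: alg_ops Fo_uminus)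
  next
    case (eng_add h1 h2)
    then obtain p1 p2 where "h1 = co p1" "Fo p1 \<in> E.gen_alg (Fo ` T)" "h2 = co p2" "Fo p2 \<in> E.gen_alg (Fo ` T)"
      by blast
    then show ?case by (intro exI[of _ "p1 + p2"]) (auto simp: alg_ops Fo_add)
  next
    case (eng_mult h1 h2)
    then obtain p1 p2 where "h1 = co p1" "Fo p1 \<in> E.gen_alg (Fo ` T)" "h2 = co p2" "Fo p2 \<in> E.gen_alg (Fo ` T)"
      by blast
    then show ?case by (intro exI[of _ "p1 * p2"]) (auto simp: alg_ops Fo_mult)
  qed
  then show "Fo p \<in> E.gen_alg (Fo ` T)" if "co p \<in> subalg H (co ` T)"
    using that Fo_eq_iff by metis
next
  assume p: "Fo p \<in> E.gen_alg (Fo ` T)"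
  have "\<exists>p. y = Fo p \<and> co p \<in> subalg H (co ` T)" if "y \<in> E.gen_alg (Fo ` T)" for y
    using that
  proof induction
    case one
    have "co 1 \<in> subalg H (co ` T)"
      unfolding subalg_def alg_ops(1)[symmetric] by (rule generate_ring.one)
    then show ?case by (intro exI[of _ 1]) (simp add: Fo_one)
  next
    case (incl y)
    then show ?case by (auto simp: subalg_def intro: generate_ring.incl)
  next
    case (scale y k)
    then obtain p where p: "y = Fo p" "co p \<in> subalg H (co ` T)" by blast
    have "co (scal k * 1) \<otimes>\<^bsub>H\<^esub> co p \<in> subalg H (co ` T)"
      using p unfolding subalg_def alg_ops(4)[symmetric] alg_ops(1)[symmetric]
      by (intro generate_ring.eng_mult) (auto intro: generate_ring.incl)
    then show ?case using p by (intro exI[of _ "scal k * p"]) (simp add: alg_ops Fo_scal)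
  next
    case (add y z)
    then obtain p1 p2 where "y = Fo p1" "co p1 \<in> subalg H (co ` T)" "z = Fo p2" "co p2 \<in> subalg H (co ` T)"
      by blast
    then show ?case unfolding subalg_def
      using generate_ring.eng_add[of "co p1" H _ "co p2"]
      by (intro exI[of _ "p1 + p2"]) (simp add: alg_ops Fo_add)
  next
    case (mult y z)
    then obtain p1 p2 where "y = Fo p1" "co p1 \<in> subalg H (co ` T)" "z = Fo p2" "co p2 \<in> subalg H (co ` T)"
      by blast
    then show ?case unfolding subalg_def
      using generate_ring.eng_mult[of "co p1" H _ "co p2"]
      by (intro exI[of _ "p1 * p2"]) (simp add: alg_ops Fo_mult)
  qed
  from this[OF p] show "co p \<in> subalg H (co ` T)" using Fo_eq_iff by metis
qed

lemma ring_H: "ring H" by (simp add: alg_def ring_quot_alg)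

lemma subalg_in_carrier: "f \<in> subalg H (co ` T) \<Longrightarrow> \<exists>p. f = co p"
proof -
  interpret ring H by (rule ring_H)
  assume "f \<in> subalg H (co ` T)"
  then have "f \<in> carrier H"
    unfolding subalg_def by (rule generate_ring_in_carrier[rotated]) (auto simp: alg_ops carrier_alg)
  then show ?thesis by (auto simp: carrier_alg)
qed

lemma set_eq_coI:
  assumes "\<And>f. f \<in> A \<Longrightarrow> \<exists>p. f = co p" "\<And>f. f \<in> B \<Longrightarrow> \<exists>p. f = co p"
    and "\<And>p. co p \<in> A \<longleftrightarrow> co p \<in> B"
  shows "A = B"
proof (rule Set.set_eqI)
  fix f
  show "f \<in> A \<longleftrightarrow> f \<in> B"
  proof (cases "\<exists>p. f = co p")
    case True
    then show ?thesis using assms(3) by blast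
  next
    case False
    then show ?thesis using assms(1,2) by blast
  qed
qed

lemma dagger_eqI:
  assumes "\<And>p. (\<forall>s\<in>S. inv_under p s) \<longleftrightarrow> Fo p \<in> E.gen_alg (Fo ` T)"
  shows "dagger N q \<phi> (subalg U (cu ` S)) = subalg H (co ` T)"
  by (rule set_eq_coI[OF dagger_in_carrier subalg_in_carrier]) (simp_all only: dagger_subalg subalg_iff assms)

lemma ceps_gens: "ceps (Uq N q) KU = 1" "ceps (Uq N q) EU = 0" "ceps (Uq N q) FU = 0"
  by (simp_all add: ceps_gen Uq_def Let_def)

lemma act_gens:
  "conv_of (act N q \<phi> (co p) (cu KU)) = shift LK (Fo p)"
  "conv_of (act N q \<phi> (co p) (cu EU)) = shift LE (Fo p)"
  using Fo_act_ltr[of p LK] Fo_act_ltr[of p LE] by (simp_all add: ltr_def)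

lemma inv_K: "inv_under p (KU ^ r) \<longleftrightarrow> (shift LK ^^ r) (Fo p) = Fo p"
  by (simp add: inv_under_conv Fo_act_K_power ceps_power ceps_gens)

lemma inv_E: "inv_under p EU \<longleftrightarrow> shift LE (Fo p) = 0"
  by (simp add: inv_under_conv act_gens ceps_gens)

lemma inv_G: "inv_under p (ltr LG) \<longleftrightarrow> shift LG (Fo p) = 0"
  by (simp add: inv_under_conv Fo_act_ltr) (simp add: ltr_def ceps_mult ceps_scal ceps_gens)

lemma inv_E_K: "inv_under p (EU + scal \<alpha> * KU) \<longleftrightarrow>
    shift LE (Fo p) + cscale \<alpha> (shift LK (Fo p)) = cscale \<alpha> (Fo p)"
  by (simp add: inv_under_conv Fo_act_add Fo_act_scal act_gens ceps_add ceps_mult ceps_scal ceps_gens)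

lemma inv_G_K: "inv_under p (ltr LG + scal \<beta> * KU) \<longleftrightarrow>
    shift LG (Fo p) + cscale \<beta> (shift LK (Fo p)) = cscale \<beta> (Fo p)"
proof -
  have "ceps (Uq N q) (ltr LG) = 0" by (simp add: ltr_def ceps_mult ceps_scal ceps_gens)
  then show ?thesis
    by (simp add: inv_under_conv Fo_act_add Fo_act_scal Fo_act_ltr act_gens ceps_add ceps_mult ceps_scal ceps_gens)
qed

text \<open>If K acts trivially on p, then G = (q - q^-1) KF acts on p as a nonzero multiple of
  F.\<close>

lemma inv_K_F: "inv_under p KU \<and> inv_under p FU \<longleftrightarrow> inv_under p KU \<and> inv_under p (ltr LG)"
proof -
  have "inv_under p FU \<longleftrightarrow> inv_under p (ltr LG)" if K: "inv_under p KU"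
  proof -
    have "\<phi> (co p) (cu (KU * s)) = \<phi> (co p) (cu s)" for s
      using K by (simp add: inv_under_iff ceps_gens)
    then have "\<phi> (co p) (cu (ltr LG * s)) = (q - inverse q) * \<phi> (co p) (cu (FU * s))" for s
      by (simp add: ltr_def mult.assoc lin_funD(2)[OF lin_fun_right])
    moreover have "ceps (Uq N q) (ltr LG) = 0" by (simp add: ltr_def ceps_mult ceps_scal ceps_gens)
    ultimately show ?thesis using qq' by (simp add: inv_under_iff ceps_gens)
  qed
  then show ?thesis by blast
qed

section \<open>Matching generators and the invariants of the whole algebra\<close>

lemma gen_alg_insert_one: "E.gen_alg (insert 1 S) = E.gen_alg S"
  by (intro equalityI E.gen_alg_mono) (auto intro: E.gen_alg.incl)

lemma gen_alg_eqI: "S \<subseteq> E.gen_alg S' \<Longrightarrow> S' \<subseteq> E.gen_alg S \<Longrightarrow> E.gen_alg S = E.gen_alg S'"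
  by (intro equalityI E.gen_alg_mono)

lemma gen_alg_unit:
  assumes "k \<noteq> 0" shows "y \<in> E.gen_alg S \<longleftrightarrow> cscale k y \<in> E.gen_alg S"
  using E.gen_alg.scale[of y S k] E.gen_alg.scale[of "cscale k y" S "inverse k"] assms by auto

lemma ainv_b: "G.t' * b = cscale q G.z"
  using G.t's by (simp only: inv_power G.z_def)

lemma a_c: "a * c = cscale (inverse q) (c * a)"
  by (rule G.tx)

text \<open>The half of G yields b a^-1 and ca, whereas the generators wanted are a^-1 b and ac;
  they differ by nonzero scalars. This lemma and \<open>G_gens3\<close> absorb those
  scalars.\<close>

lemma G_gens: "E.gen_alg {y, G.z} = E.gen_alg {y, G.t' * b}" "E.gen_alg {G.z, y} = E.gen_alg {G.t' * b, y}"
  unfolding ainv_b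
  by (rule gen_alg_eqI; auto simp: gen_alg_unit[of q G.z] intro: E.gen_alg.incl)+

lemma G_gens3: "E.gen_alg {y, c * a, G.z} = E.gen_alg {y, G.t' * b, a * c}"
  unfolding ainv_b a_c
proof (rule gen_alg_eqI)
  let ?S = "{y, cscale q G.z, cscale (inverse q) (c * a)}"
  have "c * a \<in> E.gen_alg ?S" by (subst gen_alg_unit[of "inverse q"]) (auto intro: E.gen_alg.incl)
  moreover have "G.z \<in> E.gen_alg ?S" by (subst gen_alg_unit[of q]) (auto intro: E.gen_alg.incl)
  ultimately show "{y, c * a, G.z} \<subseteq> E.gen_alg ?S" by (auto intro: E.gen_alg.incl)
qed (auto intro: E.gen_alg.incl)

text \<open>Differentiating z d = c avoids differentiating d^-1 = d^(N-1). The Leibniz rule leaves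
  the factor a - z b, and the determinant relation ad - q^-1 bc = 1 identifies it as d^-1.\<close>

lemma shift_G_z: "shift LG E.z = cscale (q * ((q - inverse q) * inverse q)) (E.t' * E.t')"
proof -
  let ?l = "(q - inverse q) * inverse q"
  have zd: "E.z * d = c" by (simp add: E.z_def mult.assoc E.tt')
  have dt: "d * E.t' = 1" by (rule E.tt')
  have "cscale ?l a = shift LG (E.z * d)" by (simp only: zd shift_gens)
  also have "\<dots> = cscale (inverse q) (shift LG E.z * d) + cscale ?l (E.z * b)"
    by (simp add: G.D_mult shift_gens E.sc_simps)
  finally have "cscale (inverse q) (shift LG E.z * d) = cscale ?l (a - E.z * b)"
    by (simp add: E.scale_right_diff_distrib)
  then have "cscale q (cscale (inverse q) (shift LG E.z * d)) = cscale q (cscale ?l (a - E.z * b))" by simp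
  then have D: "shift LG E.z * d = cscale (q * ?l) (a - E.z * b)" by simp
  have bd: "b * d = cscale (inverse q) (d * b)" by (simp add: relations(4))
  have "E.z * b * d = cscale (inverse q) ((E.z * d) * b)" by (simp only: mult.assoc bd E.sc_mult_right)
  also have "\<dots> = cscale (inverse q) (b * c)" by (simp only: zd relations(3))
  finally have "(a - E.z * b) * d = 1" by (simp add: left_diff_distrib relations(6))
  then have "(a - E.z * b) * (d * E.t') = E.t'" by (simp flip: mult.assoc)
  then have "a - E.z * b = E.t'" by (simp add: dt)
  then have "shift LG E.z * (d * E.t') = cscale (q * ?l) (E.t' * E.t')"
    by (simp only: mult.assoc[symmetric] D E.sc_mult_left)
  then show ?thesis by (simp add: dt)
qed

lemma z_power: "\<exists>u. u \<noteq> 0 \<and> E.z ^ k = cscale u (c ^ k * E.t' ^ k)"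
  using E.qcomm_mult_power[OF E.t's, of k] unfolding E.z_def by auto

text \<open>The two halves meet here: the kernel lemma for the derivation of G is applied to
  polynomials in the z of the half of E. Then y is a nonzero multiple of d^-2 and \<theta> =
  q^-2.\<close>

lemma scalar_invariants:
  assumes "Fo p \<in> E.gen_alg {E.z}" "shift LG (Fo p) = 0"
  shows "\<exists>k. Fo p = cscale k 1"
proof (rule G.kernel_gen_alg_single[OF refl E.Kz _ _ _ _ _ assms, where N = N])
  let ?l = "q * ((q - inverse q) * inverse q)"
  have l: "?l \<noteq> 0" using qq' by simp
  have tz: "E.t' * E.z = cscale (inverse q) (E.z * E.t')"
    using E.t's unfolding inv_power E.z_def mult.assoc[symmetric] by (simp add: E.sc_mult_left)
  have "E.t' * E.t' * E.z = E.t' * cscale (inverse q) (E.z * E.t')" by (simp add: mult.assoc tz)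
  also have "\<dots> = cscale ((inverse q)\<^sup>2) (E.z * (E.t' * E.t'))"
    by (simp add: E.sc_simps tz power2_eq_square flip: mult.assoc)
  finally show "shift LG E.z * E.z = cscale ((inverse q)\<^sup>2) (E.z * shift LG E.z)"
    by (simp add: shift_G_z E.sc_simps mult.commute)
  have "E.t' * E.t' * (d * d) = E.t' * ((E.t' * d) * d)" by (simp only: mult.assoc)
  then have "E.t' * E.t' * (d * d) = 1" by (simp add: E.tt')
  moreover have "shift LG E.z * cscale (inverse ?l) (d * d) = cscale (inverse ?l * ?l) (E.t' * E.t' * (d * d))"
    by (simp only: shift_G_z E.sc_mult_left E.sc_mult_right E.scale_scale)
  ultimately show "shift LG E.z * cscale (inverse ?l) (d * d) = 1"
    by (simp only: left_inverse[OF l] E.scale_one)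
  show "E.z ^ N = 0" using z_power[of N] relations by auto
  \<comment> \<open>Up to a nonzero scalar this is c^(N-1) d^-(N-1), so it suffices that c^(N-1)
    \<noteq> 0. That is \<open>x_top_nz\<close> in the half of G, where x is c.\<close>
  show "E.z ^ (N - 1) \<noteq> 0"
  proof
    assume "E.z ^ (N - 1) = 0"
    then have c0: "c ^ (N - 1) * E.t' ^ (N - 1) = 0" using z_power[of "N - 1"] by auto
    have td: "E.t' ^ (N - 1) * d ^ (N - 1) = 1"
    proof -
      have "E.t' ^ n * d ^ n = 1" for n
      proof (induction n)
        case (Suc n)
        have "E.t' ^ Suc n * d ^ Suc n = E.t' ^ n * (E.t' * d) * d ^ n"
          by (simp only: power_Suc2[of E.t'] power_Suc[of d] mult.assoc)
        then show ?case by (simp only: E.tt' mult_1_right Suc)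
      qed simp
      then show ?thesis .
    qed
    have "c ^ (N - 1) * E.t' ^ (N - 1) * d ^ (N - 1) = c ^ (N - 1)"
      by (simp only: mult.assoc td mult_1_right)
    then have "c ^ (N - 1) = 0" by (simp only: c0 mult_zero_left)
    then show False using G.x_top_nz by simp
  qed
  show "qnum ((inverse q)\<^sup>2) k \<noteq> 0" if "0 < k" "k < N" for k by (rule G.qnum_\<omega>[OF that])
qed

text \<open>Invariance under K, E and G already forces a scalar: K and E leave the polynomials in c
  d^-1, and G cuts these down to constants.\<close>

lemma dagger_U: "dagger N q \<phi> (carrier U) = subalg H (co ` {1})"
proof (rule set_eq_coI[OF dagger_in_carrier subalg_in_carrier])
  fix p
  have "(\<forall>s. inv_under p s) \<longleftrightarrow> Fo p \<in> E.gen_alg (Fo ` {1})"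
  proof
    assume inv: "\<forall>s. inv_under p s"
    have "shift LK (Fo p) = Fo p" "shift LE (Fo p) = 0" "shift LG (Fo p) = 0"
      using inv inv_K[of p 1] inv_E inv_G by auto
    then have "Fo p \<in> E.gen_alg {E.z}" "shift LG (Fo p) = 0"
      using E.fixed_B_one E.ker_D Fo_E by blast+
    from scalar_invariants[OF this] show "Fo p \<in> E.gen_alg (Fo ` {1})" by (auto simp: Fo_one intro!: E.gen_alg.scale E.gen_alg.one)
  next
    assume "Fo p \<in> E.gen_alg (Fo ` {1})"
    then have "\<exists>k. Fo p = cscale k 1"
    proof induction
      case one
      show ?case by (rule exI[of _ 1]) simp
    next
      case (incl y)
      then show ?case by (intro exI[of _ 1]) (simp add: Fo_one)
    next
      case (scale y k)
      then show ?case by auto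
    next
      case (add y z)
      then show ?case by (auto simp flip: E.scale_left_distrib)
    next
      case (mult y z)
      then show ?case by (auto simp: E.sc_simps)
    qed
    then obtain k where "Fo p = Fo (scal k * 1)" by (auto simp only: Fo_scal Fo_one)
    then have p: "co p = co (scal k * 1)" by (simp only: Fo_eq_iff)
    show "\<forall>s. inv_under p s"
      unfolding inv_under_iff p using lin_funD(2)[OF lin_fun_left, of k 1]
      by (simp only: phi_one ceps_mult) simp
  qed
  then show "co p \<in> dagger N q \<phi> (carrier U) \<longleftrightarrow> co p \<in> subalg H (co ` {1})"
    by (simp only: dagger_carrier subalg_iff)
qed

text \<open>The two descriptions come from the two halves: both compute the elements of the same
  algebra fixed by K^r, so the equality of the two subalgebras needs no computation with
  generators.\<close>

lemma dagger_K:
  assumes "r > 0" "r dvd N"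
  shows "dagger N q \<phi> (subalg U (cu ` {KU ^ r})) = subalg H (co ` {aO ^ (N div r), aO ^ (N - 1) * bO, aO * cO})"
    "dagger N q \<phi> (subalg U (cu ` {KU ^ r})) = subalg H (co ` {dO ^ (N div r), bO * dO, cO * dO ^ (N - 1)})"
proof -
  have r: "N = N div r * r" using assms by simp
  show "dagger N q \<phi> (subalg U (cu ` {KU ^ r})) = subalg H (co ` {dO ^ (N div r), bO * dO, cO * dO ^ (N - 1)})"
  proof (rule dagger_eqI)
    fix p
    show "(\<forall>s\<in>{KU ^ r}. inv_under p s) \<longleftrightarrow> Fo p \<in> E.gen_alg (Fo ` {dO ^ (N div r), bO * dO, cO * dO ^ (N - 1)})"
      using E.fixed_M[OF r, of "Fo p"] Fo_E[of p] by (simp add: inv_K Fo_mult Fo_power E.z_def E.t'_def)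
  qed
  show "dagger N q \<phi> (subalg U (cu ` {KU ^ r})) = subalg H (co ` {aO ^ (N div r), aO ^ (N - 1) * bO, aO * cO})"
  proof (rule dagger_eqI)
    fix p
    show "(\<forall>s\<in>{KU ^ r}. inv_under p s) \<longleftrightarrow> Fo p \<in> E.gen_alg (Fo ` {aO ^ (N div r), aO ^ (N - 1) * bO, aO * cO})"
      using G.fixed_M[OF r, of "Fo p"] Fo_G[of p]
      unfolding G_gens3 by (simp add: inv_K Fo_mult Fo_power G.t'_def)
  qed
qed

lemma dagger_K_E:
  assumes "r > 0" "r dvd N"
  shows "dagger N q \<phi> (subalg U (cu ` {KU ^ r, EU})) = subalg H (co ` {dO ^ (N div r), cO * dO ^ (N - 1)})"
proof (rule dagger_eqI)
  fix p
  have r: "N = N div r * r" using assms by simp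
  show "(\<forall>s\<in>{KU ^ r, EU}. inv_under p s) \<longleftrightarrow> Fo p \<in> E.gen_alg (Fo ` {dO ^ (N div r), cO * dO ^ (N - 1)})"
    using E.fixed_B[OF r, of "Fo p"] E.ker_D[of "Fo p"] Fo_E[of p]
    by (auto simp add: inv_K inv_E Fo_mult Fo_power E.z_def E.t'_def)
qed

lemma dagger_K_G:
  assumes "r > 0" "r dvd N"
  shows "dagger N q \<phi> (subalg U (cu ` {KU ^ r, ltr LG})) = subalg H (co ` {aO ^ (N div r), aO ^ (N - 1) * bO})"
proof (rule dagger_eqI)
  fix p
  have r: "N = N div r * r" using assms by simp
  show "(\<forall>s\<in>{KU ^ r, ltr LG}. inv_under p s) \<longleftrightarrow> Fo p \<in> E.gen_alg (Fo ` {aO ^ (N div r), aO ^ (N - 1) * bO})"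
    using G.fixed_B[OF r, of "Fo p"] G.ker_D[of "Fo p"] Fo_G[of p]
    unfolding G_gens by (auto simp add: inv_K inv_G Fo_mult Fo_power G.t'_def)
qed

lemma dagger_E_K:
  "dagger N q \<phi> (subalg U (cu ` {EU + scal \<alpha> * KU}))
    = subalg H (co ` {cO * dO ^ (N - 1), dO ^ 2 + scal ((q - inverse q) * \<alpha>) * (bO * dO)})"
proof (rule dagger_eqI)
  fix p
  have \<mu>: "((q - inverse q) * \<alpha>) * 1 = \<alpha> * (q - inverse q)" by simp
  have w: "Fo (dO ^ 2 + scal k * (bO * dO)) = d\<^sup>2 + cscale k (b * d)" for k
    by (simp only: Fo_add Fo_scal) (simp only: Fo_mult Fo_power)
  show "(\<forall>s\<in>{EU + scal \<alpha> * KU}. inv_under p s) \<longleftrightarrow>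
      Fo p \<in> E.gen_alg (Fo ` {cO * dO ^ (N - 1), dO ^ 2 + scal ((q - inverse q) * \<alpha>) * (bO * dO)})"
    using E.twisted_M[OF \<mu>, of "Fo p"] Fo_E[of p]
    unfolding E.w_def[OF \<mu>] E.z_def E.t'_def image_insert image_empty w
    by (simp add: inv_E_K Fo_mult Fo_power)
qed

lemma dagger_G_K:
  "dagger N q \<phi> (subalg U (cu ` {ltr LG + scal \<beta> * KU}))
    = subalg H (co ` {aO ^ (N - 1) * bO, aO ^ 2 - scal (q ^ 2 * \<beta>) * (aO * cO)})"
proof (rule dagger_eqI)
  fix p
  \<comment> \<open>With \<omega> = q^-1 and l = (q - q^-1) q^-1 the equation for \<mu> has the
    solution -q \<beta>; rewriting ca as q ac turns it into the coefficient -q^2 \<beta>.\<close>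
  have \<mu>: "(- q * \<beta>) * ((q - inverse q) * inverse q) = \<beta> * (inverse q - inverse (inverse q))"
    by (simp add: algebra_simps)
  have w: "a\<^sup>2 + cscale (- q * \<beta>) (c * a) = a\<^sup>2 - cscale (q ^ 2 * \<beta>) (a * c)"
    by (simp add: relations E.scale_minus_left power2_eq_square mult_ac)
  have w': "Fo (aO ^ 2 - scal k * (aO * cO)) = a\<^sup>2 - cscale k (a * c)" for k
    by (simp only: Fo_diff Fo_scal) (simp only: Fo_mult Fo_power)
  have "Fo p \<in> E.gen_alg {G.t' * b, a\<^sup>2 - cscale (q ^ 2 * \<beta>) (a * c)} \<longleftrightarrow>
    shift LG (Fo p) + cscale \<beta> (shift LK (Fo p)) = cscale \<beta> (Fo p)"
    using G.twisted_M[OF \<mu>, of "Fo p"] Fo_G[of p]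
    unfolding G.w_def[OF \<mu>] w G_gens by simp
  then show "(\<forall>s\<in>{ltr LG + scal \<beta> * KU}. inv_under p s) \<longleftrightarrow>
      Fo p \<in> E.gen_alg (Fo ` {aO ^ (N - 1) * bO, aO ^ 2 - scal (q ^ 2 * \<beta>) * (aO * cO)})"
    unfolding image_insert image_empty w' by (simp add: inv_G_K Fo_mult Fo_power G.t'_def)
qed

lemma dagger_E: "dagger N q \<phi> (subalg U (cu ` {EU})) = subalg H (co ` {cO, dO})"
proof (rule dagger_eqI)
  show "(\<forall>s\<in>{EU}. inv_under p s) \<longleftrightarrow> Fo p \<in> E.gen_alg (Fo ` {cO, dO})" for p
    using E.ker_D[of "Fo p"] Fo_E[of p] by (simp add: inv_E)
qed

lemma dagger_G: "dagger N q \<phi> (subalg U (cu ` {ltr LG})) = subalg H (co ` {aO, bO})"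
proof (rule dagger_eqI)
  show "(\<forall>s\<in>{ltr LG}. inv_under p s) \<longleftrightarrow> Fo p \<in> E.gen_alg (Fo ` {aO, bO})" for p
    using G.ker_D[of "Fo p"] Fo_G[of p] by (simp add: inv_G insert_commute)
qed

lemma subalg_insert_one: "subalg H (co ` insert p T) = subalg H (co ` T)" if "co p = co 1"
proof (rule set_eq_coI[OF subalg_in_carrier subalg_in_carrier])
  fix p'
  have "Fo p = 1" using that Fo_one by (simp add: Fo_eq_iff flip: Fo_one)
  then show "co p' \<in> subalg H (co ` insert p T) \<longleftrightarrow> co p' \<in> subalg H (co ` T)"
    unfolding subalg_iff by (simp only: image_insert gen_alg_insert_one)
qed

lemma dagger_K_F:
  "dagger N q \<phi> (subalg U (cu ` {KU, FU})) = dagger N q \<phi> (subalg U (cu ` {KU, ltr LG}))"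
proof (rule set_eq_coI[OF dagger_in_carrier dagger_in_carrier])
  show "co p \<in> dagger N q \<phi> (subalg U (cu ` {KU, FU})) \<longleftrightarrow> co p \<in> dagger N q \<phi> (subalg U (cu ` {KU, ltr LG}))" for p
    unfolding dagger_subalg using inv_K_F[of p] by simp
qed

lemma co_powers: "co (aO ^ N) = co 1" "co (dO ^ N) = co 1"
  using relations(8,9) by (simp_all add: Fo_power Fo_one flip: Fo_eq_iff)

lemma inv_co: "inv\<^bsub>H\<^esub> (co p) = co (p ^ (N - 1))" if p: "co (p ^ N) = co 1"
proof -
  interpret ring H by (rule ring_H)
  obtain M where M: "N = Suc M" using N by (cases N) auto
  show ?thesis
    by (rule inv_char) (use p in \<open>simp_all add: carrier_alg alg_ops M power_commutes\<close>)
qed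

lemma minus_co: "co p \<ominus>\<^bsub>H\<^esub> co p' = co (p - p')"
  by (simp add: a_minus_def alg_ops)

lemma dagger_K_one:
  "dagger N q \<phi> (subalg U (cu ` {KU})) = subalg H (co ` {aO ^ (N - 1) * bO, aO * cO})"
  "dagger N q \<phi> (subalg U (cu ` {KU})) = subalg H (co ` {bO * dO, cO * dO ^ (N - 1)})"
  "dagger N q \<phi> (subalg U (cu ` {KU, EU})) = subalg H (co ` {cO * dO ^ (N - 1)})"
  "dagger N q \<phi> (subalg U (cu ` {KU, ltr LG})) = subalg H (co ` {aO ^ (N - 1) * bO})"
  using dagger_K[of 1] dagger_K_E[of 1] dagger_K_G[of 1]
  by (simp_all only: subalg_insert_one co_powers power_one_right div_by_1 one_dvd zero_less_one simp_thms)

lemma dagger_all: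
  assumes "r > 0" "r dvd N"
  shows "dagger N q \<phi> (carrier U) = subalg H {\<one>\<^bsub>H\<^esub>} \<and>
     dagger N q \<phi> (subalg U {cu KU [^]\<^bsub>U\<^esub> r})
       = subalg H {co aO [^]\<^bsub>H\<^esub> (N div r), inv\<^bsub>H\<^esub> co aO \<otimes>\<^bsub>H\<^esub> co bO, co aO \<otimes>\<^bsub>H\<^esub> co cO} \<and>
     dagger N q \<phi> (subalg U {cu KU [^]\<^bsub>U\<^esub> r})
       = subalg H {co dO [^]\<^bsub>H\<^esub> (N div r), co bO \<otimes>\<^bsub>H\<^esub> co dO, co cO \<otimes>\<^bsub>H\<^esub> inv\<^bsub>H\<^esub> co dO} \<and>
     dagger N q \<phi> (subalg U {cu KU [^]\<^bsub>U\<^esub> r, cu EU})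
       = subalg H {co dO [^]\<^bsub>H\<^esub> (N div r), co cO \<otimes>\<^bsub>H\<^esub> inv\<^bsub>H\<^esub> co dO} \<and>
     dagger N q \<phi> (subalg U {cu KU [^]\<^bsub>U\<^esub> r, (q - inverse q) \<odot>\<^bsub>U\<^esub> (cu KU \<otimes>\<^bsub>U\<^esub> cu FU)})
       = subalg H {co aO [^]\<^bsub>H\<^esub> (N div r), inv\<^bsub>H\<^esub> co aO \<otimes>\<^bsub>H\<^esub> co bO} \<and>
     dagger N q \<phi> (subalg U {cu EU \<oplus>\<^bsub>U\<^esub> \<alpha> \<odot>\<^bsub>U\<^esub> cu KU})
       = subalg H {co cO \<otimes>\<^bsub>H\<^esub> inv\<^bsub>H\<^esub> co dO,
           co dO [^]\<^bsub>H\<^esub> (2::nat) \<oplus>\<^bsub>H\<^esub> ((q - inverse q) * \<alpha>) \<odot>\<^bsub>H\<^esub> (co bO \<otimes>\<^bsub>H\<^esub> co dO)} \<and>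
     dagger N q \<phi> (subalg U {(q - inverse q) \<odot>\<^bsub>U\<^esub> (cu KU \<otimes>\<^bsub>U\<^esub> cu FU) \<oplus>\<^bsub>U\<^esub> \<beta> \<odot>\<^bsub>U\<^esub> cu KU})
       = subalg H {inv\<^bsub>H\<^esub> co aO \<otimes>\<^bsub>H\<^esub> co bO,
           co aO [^]\<^bsub>H\<^esub> (2::nat) \<ominus>\<^bsub>H\<^esub> (q ^ 2 * \<beta>) \<odot>\<^bsub>H\<^esub> (co aO \<otimes>\<^bsub>H\<^esub> co cO)} \<and>
     dagger N q \<phi> (subalg U {cu KU}) = subalg H {inv\<^bsub>H\<^esub> co aO \<otimes>\<^bsub>H\<^esub> co bO, co aO \<otimes>\<^bsub>H\<^esub> co cO} \<and>
     dagger N q \<phi> (subalg U {cu KU}) = subalg H {co bO \<otimes>\<^bsub>H\<^esub> co dO, co cO \<otimes>\<^bsub>H\<^esub> inv\<^bsub>H\<^esub> co dO} \<and>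
     dagger N q \<phi> (subalg U {cu EU}) = subalg H {co cO, co dO} \<and>
     dagger N q \<phi> (subalg U {(q - inverse q) \<odot>\<^bsub>U\<^esub> (cu KU \<otimes>\<^bsub>U\<^esub> cu FU)}) = subalg H {co aO, co bO} \<and>
     dagger N q \<phi> (subalg U {cu KU, cu EU}) = subalg H {co cO \<otimes>\<^bsub>H\<^esub> inv\<^bsub>H\<^esub> co dO} \<and>
     dagger N q \<phi> (subalg U {cu KU, (q - inverse q) \<odot>\<^bsub>U\<^esub> (cu KU \<otimes>\<^bsub>U\<^esub> cu FU)})
       = subalg H {inv\<^bsub>H\<^esub> co aO \<otimes>\<^bsub>H\<^esub> co bO} \<and>
     dagger N q \<phi> (subalg U {cu KU, cu FU}) = subalg H {inv\<^bsub>H\<^esub> co aO \<otimes>\<^bsub>H\<^esub> co bO}"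
proof -
  have G: "scal (q - inverse q) * (KU * FU) = ltr LG" by (simp add: ltr_def)
  note eqs = dagger_U dagger_K[OF assms] dagger_K_E[OF assms] dagger_K_G[OF assms] dagger_E_K dagger_G_K
    dagger_K_one dagger_E dagger_G dagger_K_F[unfolded dagger_K_one]
  show ?thesis
    \<comment> \<open>All operations of the quotient algebras, including the inverses of a and d,
      are moved into representatives, which is the form of the collected equations.\<close>
    unfolding alg_ops inv_co[OF co_powers(1)] inv_co[OF co_powers(2)] minus_co G
    by (intro conjI eqs[unfolded image_insert image_empty])
qed

end

theorem theorem5p6:
  fixes N r :: nat
    and q \<alpha> \<beta> :: "'k::{alg_closed_field, field_char_0}"
    and \<phi> :: "(gen_O, 'k) free_alg set \<Rightarrow> (gen_U, 'k) free_alg set \<Rightarrow> 'k"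
  defines "U \<equiv> alg (Uq N q)"
    and "K \<equiv> gen_class (Uq N q) gK"
    and "E \<equiv> gen_class (Uq N q) gE"
    and "F \<equiv> gen_class (Uq N q) gF"
    and "H \<equiv> alg (Oq N q)"
    and "a \<equiv> gen_class (Oq N q) ga"
    and "b \<equiv> gen_class (Oq N q) gb"
    and "c \<equiv> gen_class (Oq N q) gc"
    and "d \<equiv> gen_class (Oq N q) gd"
  defines "F' \<equiv> (q - inverse q) \<odot>\<^bsub>U\<^esub> (K \<otimes>\<^bsub>U\<^esub> F)"
  assumes "N > 1" and "odd N"
    and "q ^ N = 1" and "\<forall>m. 0 < m \<and> m < N \<longrightarrow> q ^ m \<noteq> 1"
    and "r > 0" and "r dvd N"
    and "hopf_iso N q \<phi>"
  shows
    "dagger N q \<phi> (carrier U) = subalg H {\<one>\<^bsub>H\<^esub>} \<and>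

     dagger N q \<phi> (subalg U {K [^]\<^bsub>U\<^esub> r})
       = subalg H {a [^]\<^bsub>H\<^esub> (N div r), inv\<^bsub>H\<^esub> a \<otimes>\<^bsub>H\<^esub> b, a \<otimes>\<^bsub>H\<^esub> c} \<and>
     dagger N q \<phi> (subalg U {K [^]\<^bsub>U\<^esub> r})
       = subalg H {d [^]\<^bsub>H\<^esub> (N div r), b \<otimes>\<^bsub>H\<^esub> d, c \<otimes>\<^bsub>H\<^esub> inv\<^bsub>H\<^esub> d} \<and>

     dagger N q \<phi> (subalg U {K [^]\<^bsub>U\<^esub> r, E})
       = subalg H {d [^]\<^bsub>H\<^esub> (N div r), c \<otimes>\<^bsub>H\<^esub> inv\<^bsub>H\<^esub> d} \<and>

     dagger N q \<phi> (subalg U {K [^]\<^bsub>U\<^esub> r, F'})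
       = subalg H {a [^]\<^bsub>H\<^esub> (N div r), inv\<^bsub>H\<^esub> a \<otimes>\<^bsub>H\<^esub> b} \<and>

     dagger N q \<phi> (subalg U {E \<oplus>\<^bsub>U\<^esub> \<alpha> \<odot>\<^bsub>U\<^esub> K})
       = subalg H {c \<otimes>\<^bsub>H\<^esub> inv\<^bsub>H\<^esub> d,
                   d [^]\<^bsub>H\<^esub> (2::nat) \<oplus>\<^bsub>H\<^esub> ((q - inverse q) * \<alpha>) \<odot>\<^bsub>H\<^esub> (b \<otimes>\<^bsub>H\<^esub> d)} \<and>

     dagger N q \<phi> (subalg U {F' \<oplus>\<^bsub>U\<^esub> \<beta> \<odot>\<^bsub>U\<^esub> K})
       = subalg H {inv\<^bsub>H\<^esub> a \<otimes>\<^bsub>H\<^esub> b,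
                   a [^]\<^bsub>H\<^esub> (2::nat) \<ominus>\<^bsub>H\<^esub> (q ^ 2 * \<beta>) \<odot>\<^bsub>H\<^esub> (a \<otimes>\<^bsub>H\<^esub> c)} \<and>

     dagger N q \<phi> (subalg U {K}) = subalg H {inv\<^bsub>H\<^esub> a \<otimes>\<^bsub>H\<^esub> b, a \<otimes>\<^bsub>H\<^esub> c} \<and>
     dagger N q \<phi> (subalg U {K}) = subalg H {b \<otimes>\<^bsub>H\<^esub> d, c \<otimes>\<^bsub>H\<^esub> inv\<^bsub>H\<^esub> d} \<and>
     dagger N q \<phi> (subalg U {E}) = subalg H {c, d} \<and>
     dagger N q \<phi> (subalg U {F'}) = subalg H {a, b} \<and>
     dagger N q \<phi> (subalg U {K, E}) = subalg H {c \<otimes>\<^bsub>H\<^esub> inv\<^bsub>H\<^esub> d} \<and>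
     dagger N q \<phi> (subalg U {K, F'}) = subalg H {inv\<^bsub>H\<^esub> a \<otimes>\<^bsub>H\<^esub> b} \<and>
     dagger N q \<phi> (subalg U {K, F}) = subalg H {inv\<^bsub>H\<^esub> a \<otimes>\<^bsub>H\<^esub> b}"
  unfolding U_def K_def E_def F_def H_def a_def b_def c_def d_def F'_def gen_class_def
proof (rule dual_iso.dagger_all)
  show "dual_iso N q \<phi>"
    using assms(11-14,17) by unfold_locales auto
qed (use assms(15,16) in auto)

end
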